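(* Let $E$ be a real separable Hilbert space, $C\subset E\times E$ a possibly multivalued nonlinear $m$-dissipative operator with $\overline{\mathcal D(C)}=E$ and $(0,0)\in C$, and let $G:E\times E\to\mathbb R$ satisfy: (1) $G$ is continuous; for each $\lambda>1$ and $M>0$ there are continuous functions $\rho_\lambda,\sigma_M:[0,\infty)\to\mathbb R$ with $\rho_\lambda(0)=\sigma_M(0)=0$ such that for all $x,y\in E$, $\mu>0$, $$\lambda G\Big(x,\frac{\mu(x-y)}\lambda\Big)-G(y,\mu(x-y))\le\rho_\lambda\big(\|x-y\|+\mu\|x-y\|^2\big),$$ and for all $r\ge0$, $\displaystyle\sup_{\|x\|+\|p\|+\|q\|<M,\ \|q-p\|\le r}|G(x,p)-G(x,q)|\le\sigma_M(r)$. (2) There is a nondecreasing $0\le\varphi\in C^1([0,\infty))$ with $\varphi'>0$, $\lim_{r\to\infty}\varphi(r)=\infty$, $\sup_{r\ge0}(|r\varphi'(r^2)|+|r\varphi'(r)|)<\infty$, and for each $M>0$, $\lambda>1$ there is a continuous $\gamma_{\lambda,M}:[0,\infty)\to\mathbb R$ with $\gamma_{\lambda,M}(0)=0$ such that $$\sup_{x\in E,\ \|p\|\le M}\Big(\lambda G\Big(x,\frac{p+\varepsilon\varphi'(\|x\|^2)x}{\lambda}\Big)-G(x,p)\Big)\le\gamma_{\lambda,M}(\varepsilon).$$ Let $\alpha>0$, let $h:E\to\mathbb R$ be bounded and uniformly continuous, and define $\hat H_0,\hat H_1$ from $C$ and $G$ as in the context. If $\overline f$ is a viscosity subsolution of $(I-\alpha\hat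 H_0)f=h$ and $\underline f$ is a viscosity supersolution of $(I-\alpha\hat H_1)f=h$ (in the sense defined in the context), then $\overline f\le\underline f$ on $E$.
   Context: $C$ is $m$-dissipative: $\langle x_1-x_2,y_1-y_2\rangle\le0$ for $(x_i,y_i)\in C$, and the range of $I-\alpha C$ is $E$ for all $\alpha>0$. $S(t)$, $t\ge0$, is the strongly continuous contraction semigroup generated by $C$: $S(t)x=\lim_n(I-\frac tnC)^{-n}x$. For $x\in\mathcal D(C)$, $C^0x$ is the unique element of minimal norm in $\{y:(x,y)\in C\}$. $d_C(x,y)=\inf_{t\ge0}\{t+\|x-S(t)y\|\}$. For $\mu,\rho>0$, $\xi\in\mathcal D(C)$, $y\in E$: with $g(x)=\frac\mu2\|x-\xi\|^2$, $f(x)=g(x)+\rho d_C(x,y)$, $$\hat H_0f(x)=\mu\langle x-\xi,C^0\xi\rangle+\rho+\sup_{\|q\|\le\rho}G(x,Dg(x)+q);$$ with $g(x)=-\frac\mu2\|x-\xi\|^2$, $f(x)=g(x)-\rho d_C(x,y)$, $$\hat H_1f(x)=-\mu\langle x-\xi,C^0\xi\rangle-\rho+\inf_{\|q\|\le\rho}G(x,Dg(x)+q).$$ The domains consist of all such $f$. $g^*(x)=\limsup_{y\to x}g(y)$, $g_*(x)=\liminf_{y\to x}g(y)$. Viscosity subsolution of $(I-\alpha H)f=h$: a bounded upper semicontinuous $\overline f$ such that whenever $x_0\in E$, $f_0\in\mathcal D(H)$ satisfy $(\overline f-f_0)(x_0)=\sup_E(\overline f-f_0)$, one has $\alpha^{-1}(\overline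 f-h)(x_0)\le(Hf_0)^*(x_0)$. Viscosity supersolution: a bounded lower semicontinuous $\underline f$ such that whenever $(f_0-\underline f)(x_0)=\sup_E(f_0-\underline f)$ with $f_0\in\mathcal D(H)$, one has $\alpha^{-1}(\underline f-h)(x_0)\ge(Hf_0)_*(x_0)$. *)

theory Defs
  imports "HOL-Analysis.Analysis"
begin

text \<open>A multivalued operator on a space is a set of pairs (its graph); its domain is \<open>Domain C\<close>.\<close>

definition m_dissipative :: "('a::real_inner \<times> 'a) set \<Rightarrow> bool" where
  "m_dissipative C \<longleftrightarrow>
     (\<forall>x1 y1 x2 y2. (x1, y1) \<in> C \<longrightarrow> (x2, y2) \<in> C \<longrightarrow> (x1 - x2) \<bullet> (y1 - y2) \<le> 0) \<and>
     (\<forall>\<alpha>>0. {x - \<alpha> *\<^sub>R y |x y. (x, y) \<in> C} = UNIV)"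

text \<open>\<open>resolvent C \<alpha>\<close> is \<open>(I - \<alpha> C)\<^sup>-\<^sup>1\<close>, single-valued and everywhere defined for
  \<open>\<alpha> > 0\<close> and \<open>C\<close> m-dissipative.\<close>

definition resolvent :: "('a::real_inner \<times> 'a) set \<Rightarrow> real \<Rightarrow> 'a \<Rightarrow> 'a" where
  "resolvent C \<alpha> z = (THE x. \<exists>y. (x, y) \<in> C \<and> x - \<alpha> *\<^sub>R y = z)"

text \<open>At \<open>t = 0\<close> the formula would involve the inverse of \<open>I\<close> restricted to \<open>Domain C\<close>, which
  need not be everywhere defined; so \<open>S(0) = I\<close> is set separately.\<close>

definition semigroup_of :: "('a::real_inner \<times> 'a) set \<Rightarrow> real \<Rightarrow> 'a \<Rightarrow> 'a" where
  "semigroup_of C t x =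
     (if t = 0 then x else lim (\<lambda>n. (resolvent C (t / real n) ^^ n) x))"

definition min_section :: "('a::real_inner \<times> 'a) set \<Rightarrow> 'a \<Rightarrow> 'a" where
  "min_section C x = (THE y. (x, y) \<in> C \<and> (\<forall>z. (x, z) \<in> C \<longrightarrow> norm y \<le> norm z))"

text \<open>The Tataru distance \<open>d\<^sub>C\<close>.\<close>

definition tataru_dist :: "('a::real_inner \<times> 'a) set \<Rightarrow> 'a \<Rightarrow> 'a \<Rightarrow> real" where
  "tataru_dist C x y = (INF t\<in>{0..}. t + norm (x - semigroup_of C t y))"

definition gradient :: "('a::real_inner \<Rightarrow> real) \<Rightarrow> 'a \<Rightarrow> 'a" where
  "gradient g x = (THE D. GDERIV g x :> D)"

text \<open>The operators are graphs \<open>{(f, H f)}\<close>, since \<open>H f\<close> is given through the parameters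
  \<open>\<mu>, \<rho>, \<xi>, y\<close> of \<open>f\<close>. On a nonzero space these are determined by \<open>f\<close> (for \<open>C\<close> as in the
  theorem), but on the zero space they are not.
  The real-valued suprema and infima below are over bounded sets when \<open>G x\<close> is bounded on
  bounded sets.\<close>

definition H0_hat ::
  "('a::real_inner \<times> 'a) set \<Rightarrow> ('a \<Rightarrow> 'a \<Rightarrow> real) \<Rightarrow> (('a \<Rightarrow> real) \<times> ('a \<Rightarrow> real)) set" where
  "H0_hat C G =
     {(f, Hf). \<exists>\<mu> \<rho> \<xi> y g. \<mu> > 0 \<and> \<rho> > 0 \<and> \<xi> \<in> Domain C \<and>
        g = (\<lambda>x. \<mu> / 2 * (norm (x - \<xi>))\<^sup>2) \<and>
        f = (\<lambda>x. g x + \<rho> * tataru_dist C x y) \<and>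
        Hf = (\<lambda>x. \<mu> * ((x - \<xi>) \<bullet> min_section C \<xi>) + \<rho>
                    + (SUP q\<in>cball 0 \<rho>. G x (gradient g x + q)))}"

definition H1_hat ::
  "('a::real_inner \<times> 'a) set \<Rightarrow> ('a \<Rightarrow> 'a \<Rightarrow> real) \<Rightarrow> (('a \<Rightarrow> real) \<times> ('a \<Rightarrow> real)) set" where
  "H1_hat C G =
     {(f, Hf). \<exists>\<mu> \<rho> \<xi> y g. \<mu> > 0 \<and> \<rho> > 0 \<and> \<xi> \<in> Domain C \<and>
        g = (\<lambda>x. - (\<mu> / 2) * (norm (x - \<xi>))\<^sup>2) \<and>
        f = (\<lambda>x. g x - \<rho> * tataru_dist C x y) \<and>
        Hf = (\<lambda>x. - \<mu> * ((x - \<xi>) \<bullet> min_section C \<xi>) - \<rho>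
                    + (INF q\<in>cball 0 \<rho>. G x (gradient g x + q)))}"

text \<open>Semicontinuous envelopes, possibly infinite. As usual for envelopes, the limit \<open>y \<rightarrow> x\<close>
  includes \<open>y = x\<close> (filter \<open>nhds x\<close>, not \<open>at x\<close>).\<close>

definition upper_envelope :: "('a::topological_space \<Rightarrow> real) \<Rightarrow> 'a \<Rightarrow> ereal" where
  "upper_envelope g x = Limsup (nhds x) (\<lambda>y. ereal (g y))"

definition lower_envelope :: "('a::topological_space \<Rightarrow> real) \<Rightarrow> 'a \<Rightarrow> ereal" where
  "lower_envelope g x = Liminf (nhds x) (\<lambda>y. ereal (g y))"

definition upper_semicontinuous :: "('a::topological_space \<Rightarrow> real) \<Rightarrow> bool" where
  "upper_semicontinuous g \<longleftrightarrow> (\<forall>x. upper_envelope g x \<le> ereal (g x))"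

definition lower_semicontinuous :: "('a::topological_space \<Rightarrow> real) \<Rightarrow> bool" where
  "lower_semicontinuous g \<longleftrightarrow> (\<forall>x. ereal (g x) \<le> lower_envelope g x)"

text \<open>Viscosity sub- and supersolutions \<open>u\<close> of \<open>(I - \<alpha> H) f = h\<close>.\<close>

definition viscosity_subsolution ::
  "real \<Rightarrow> (('a::topological_space \<Rightarrow> real) \<times> ('a \<Rightarrow> real)) set \<Rightarrow> ('a \<Rightarrow> real) \<Rightarrow> ('a \<Rightarrow> real) \<Rightarrow> bool"
  where
  "viscosity_subsolution \<alpha> H h u \<longleftrightarrow>
     bounded (range u) \<and> upper_semicontinuous u \<and>
     (\<forall>x0. \<forall>(f0, Hf0)\<in>H.
        (\<forall>x. u x - f0 x \<le> u x0 - f0 x0) \<longrightarrow>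
        ereal (inverse \<alpha> * (u x0 - h x0)) \<le> upper_envelope Hf0 x0)"

definition viscosity_supersolution ::
  "real \<Rightarrow> (('a::topological_space \<Rightarrow> real) \<times> ('a \<Rightarrow> real)) set \<Rightarrow> ('a \<Rightarrow> real) \<Rightarrow> ('a \<Rightarrow> real) \<Rightarrow> bool"
  where
  "viscosity_supersolution \<alpha> H h u \<longleftrightarrow>
     bounded (range u) \<and> lower_semicontinuous u \<and>
     (\<forall>x0. \<forall>(f0, Hf0)\<in>H.
        (\<forall>x. f0 x - u x \<le> f0 x0 - u x0) \<longrightarrow>
        ereal (inverse \<alpha> * (u x0 - h x0)) \<ge> lower_envelope Hf0 x0)"

end

theory Submission
  imports Defs
begin

text \<open>
  Write \<open>u\<close> and \<open>v\<close> for the sub- and the supersolution. If the function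
  \<open>\<lambda> u x - v y - \<mu> / 2 |x - y|\<^sup>2 - \<epsilon> \<phi> (|x|\<^sup>2)\<close> attained its maximum at \<open>(x, y)\<close>, and if its parts were admissible
  as test functions, the two viscosity inequalities would bound
  \<open>\<lambda> (u - h) x - (v - h) y\<close> by \<open>\<alpha>\<close> times
  \<open>\<lambda> G x ((\<mu> (x - y) + 2 \<epsilon> \<phi>' (|x|\<^sup>2) x) / \<lambda>) - G y (\<mu> (x - y))\<close>. For \<open>\<lambda> = \<kappa>\<^sup>2\<close> the growth condition removes the
  penalty as \<open>\<epsilon>\<close> tends to \<open>0\<close>, the dissipativity condition on \<open>G\<close> makes the rest vanish as \<open>\<mu>\<close> tends to
  infinity, and finally \<open>\<kappa>\<close> tends to \<open>1\<close> (lemma \<open>comparison_up_to_scaling\<close>). Two obstacles remain.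

  Maxima need not be attained. The perturbation admitted in the test functions is the Tataru
  distance, so Ekeland's principle is needed for this distance (\<open>ekeland_quasi_metric\<close>). That it is a
  quasi-metric, complete in the required sense, rests on \<open>S\<close> being a strongly continuous semigroup
  of contractions. This is derived from one estimate comparing powers of resolvents
  (\<open>resolvent_power_compare\<close>).

  The test functions are quadratic functions with centre in the domain of \<open>C\<close>, and the operators contain the
  minimal section at the centre. Neither \<open>y\<close> nor the penalty fits into this form. So two further
  points are inserted: one maximizes
  \<open>\<lambda> u x - v y - \<nu> / 2 |x - \<xi>|\<^sup>2 - \<nu> / 2 |y - \<eta>|\<^sup>2 - \<mu> / 2 |\<xi> - \<eta>|\<^sup>2 - \<epsilon> \<phi> (|\<xi>|\<^sup>2)\<close>, where \<open>\<xi>\<close> and \<open>\<eta>\<close> range over the points of the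
  domain whose minimal section has norm at most \<open>R\<close>. This set is closed and invariant
  under resolvents. Moving \<open>\<xi>\<close> and \<open>\<eta>\<close> along the resolvents increases neither \<open>|\<xi> - \<eta>|\<close> nor \<open>|\<xi>|\<close>, so
  maximality yields \<open>\<nu> (x - \<xi>) \<bullet> C\<^sup>0 \<xi> + \<nu> (y - \<eta>) \<bullet> C\<^sup>0 \<eta> \<le> 0\<close> up to a small error, which disposes of the drift terms in
  the difference of the two viscosity inequalities (\<open>chain_optimum\<close>). By density of the domain the restricted
  maximum is, for large \<open>R\<close>, almost the unrestricted one. Hence first order conditions in \<open>\<xi>\<close> and \<open>\<eta>\<close> hold
  approximately (\<open>chain_optimum_gradients\<close>); they keep \<open>\<nu> (x - \<xi>)\<close> and \<open>\<nu> (y - \<eta>)\<close> bounded as \<open>\<nu>\<close> tends to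
  infinity, so that \<open>\<xi>\<close> and \<open>\<eta>\<close> merge with \<open>x\<close> and \<open>y\<close> (\<open>penalized_doubling\<close>).
\<close>

section \<open>Resolvents and Yosida approximations\<close>

definition yosida :: "('a::real_inner \<times> 'a) set \<Rightarrow> real \<Rightarrow> 'a \<Rightarrow> 'a" where
  "yosida C t z = (1 / t) *\<^sub>R (resolvent C t z - z)"

text \<open>For m-dissipative \<open>C\<close> this is the set of all \<open>\<xi>\<close> in the domain with \<open>norm (min_section C \<xi>) \<le> R\<close>;
  see \<open>in_slope_le\<close>, \<open>slope_le_subset_Domain\<close> and \<open>yosida_tendsto_min_section\<close>. Bounding the Yosida
  approximations, which are continuous, makes it evident that the set is closed.\<close>

definition slope_le :: "('a::real_inner \<times> 'a) set \<Rightarrow> real \<Rightarrow> 'a set" where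
  "slope_le C R = {\<xi>. \<forall>t>0. norm (yosida C t \<xi>) \<le> R}"

context
  fixes C :: "('a::{real_inner, complete_space} \<times> 'a) set"
  assumes diss: "m_dissipative C"
begin

lemma dissipative: "(x1, y1) \<in> C \<Longrightarrow> (x2, y2) \<in> C \<Longrightarrow> (x1 - x2) \<bullet> (y1 - y2) \<le> 0"
  using diss unfolding m_dissipative_def by blast

lemma norm_diff_le_norm_diff_resolvent:
  assumes "(x1, y1) \<in> C" "(x2, y2) \<in> C" "t \<ge> 0"
  shows "norm (x1 - x2) \<le> norm ((x1 - t *\<^sub>R y1) - (x2 - t *\<^sub>R y2))"
proof -
  let ?d = "x1 - x2" and ?e = "y1 - y2"
  have eq: "(x1 - t *\<^sub>R y1) - (x2 - t *\<^sub>R y2) = ?d - t *\<^sub>R ?e"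
    by (simp add: algebra_simps)
  have "norm ?d * norm ?d = ?d \<bullet> ?d"
    by (simp add: dot_square_norm power2_eq_square)
  also have "\<dots> \<le> ?d \<bullet> ?d - t * (?d \<bullet> ?e)"
    using mult_nonneg_nonpos[OF assms(3) dissipative[OF assms(1,2)]] by linarith
  also have "\<dots> = ?d \<bullet> (?d - t *\<^sub>R ?e)"
    by (simp add: inner_diff_right)
  also have "\<dots> \<le> norm ?d * norm (?d - t *\<^sub>R ?e)"
    by (rule norm_cauchy_schwarz)
  finally show ?thesis
    unfolding eq by (cases "norm ?d = 0") (auto simp: mult_le_cancel_left)
qed

lemma resolvent_eqI:
  assumes "t > 0" "(x, y) \<in> C" "x - t *\<^sub>R y = z"
  shows "resolvent C t z = x"
  unfolding resolvent_def
proof (rule the_equality)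
  show "\<exists>y. (x, y) \<in> C \<and> x - t *\<^sub>R y = z"
    using assms by blast
next
  fix x' assume "\<exists>y. (x', y) \<in> C \<and> x' - t *\<^sub>R y = z"
  then obtain y' where "(x', y') \<in> C" "x' - t *\<^sub>R y' = z" by blast
  then show "x' = x"
    using norm_diff_le_norm_diff_resolvent[of x' y' x y t] assms by simp
qed

lemma resolvent_eq_yosida: "t > 0 \<Longrightarrow> resolvent C t z = z + t *\<^sub>R yosida C t z"
  by (simp add: yosida_def)

lemma yosida_in_graph:
  assumes "t > 0"
  shows "(resolvent C t z, yosida C t z) \<in> C"
proof -
  have "z \<in> {x - t *\<^sub>R y |x y. (x, y) \<in> C}"
    using diss assms unfolding m_dissipative_def by blast
  then obtain x y where xy: "(x, y) \<in> C" "x - t *\<^sub>R y = z" by blast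
  have "resolvent C t z = x"
    by (rule resolvent_eqI[OF assms xy])
  moreover from this have "resolvent C t z - z = t *\<^sub>R y"
    using xy by (simp add: algebra_simps)
  then have "yosida C t z = y"
    using assms by (simp add: yosida_def)
  ultimately show ?thesis using xy by simp
qed

lemma resolvent_nonexpansive:
  assumes "t > 0"
  shows "norm (resolvent C t z - resolvent C t w) \<le> norm (z - w)"
  using norm_diff_le_norm_diff_resolvent[OF yosida_in_graph[OF assms] yosida_in_graph[OF assms], of t z w]
    assms by (simp add: resolvent_eq_yosida)

lemma yosida_inner_le:
  assumes "t > 0" "(z, y) \<in> C"
  shows "(norm (yosida C t z))\<^sup>2 \<le> yosida C t z \<bullet> y"
proof -
  let ?A = "yosida C t z"
  have "(resolvent C t z - z) \<bullet> (?A - y) \<le> 0"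
    by (rule dissipative[OF yosida_in_graph[OF assms(1)] assms(2)])
  then have "t * (?A \<bullet> (?A - y)) \<le> 0"
    by (simp add: resolvent_eq_yosida[OF assms(1)])
  then have "?A \<bullet> (?A - y) \<le> 0"
    using assms(1) by (simp add: mult_le_0_iff)
  then show ?thesis
    by (simp add: inner_diff_right dot_square_norm)
qed

lemma norm_yosida_le:
  assumes "t > 0" "(z, y) \<in> C"
  shows "norm (yosida C t z) \<le> norm y"
proof -
  let ?A = "yosida C t z"
  have "norm ?A * norm ?A \<le> norm ?A * norm y"
    using yosida_inner_le[OF assms] norm_cauchy_schwarz[of ?A y] by (simp add: power2_eq_square)
  then show ?thesis by (cases "norm ?A = 0") (auto simp: mult_le_cancel_left)
qed

lemma norm_resolvent_diff_le:
  assumes "t > 0" "(z, y) \<in> C"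
  shows "norm (resolvent C t z - z) \<le> t * norm y"
  using norm_yosida_le[OF assms] assms(1) by (simp add: resolvent_eq_yosida)

text \<open>Dissipativity between the two graph points over \<open>z\<close>, with \<open>a\<close> and \<open>b\<close> the Yosida values for the step
  sizes \<open>t\<close> and \<open>s\<close>, gives \<open>(t + s) (a \<bullet> b) \<ge> t |a|\<^sup>2 + s |b|\<^sup>2\<close>. Hence the norms increase as the step
  size decreases, and a bound on them makes the Yosida approximations Cauchy in norm, so that no
  weak limits are needed to reach the minimal section.\<close>

lemma norm_yosida_diff_le:
  assumes "0 < s" "s \<le> t"
  shows "(norm (yosida C t z - yosida C s z))\<^sup>2 \<le> (norm (yosida C s z))\<^sup>2 - (norm (yosida C t z))\<^sup>2"
    (is "(norm (?a - ?b))\<^sup>2 \<le> _")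
proof (cases "s = t")
  case False
  with assms have st: "s < t" "0 < t" by auto
  have "(resolvent C t z - resolvent C s z) \<bullet> (?a - ?b) \<le> 0"
    by (rule dissipative[OF yosida_in_graph yosida_in_graph]) (use assms st in auto)
  then have "(t *\<^sub>R ?a - s *\<^sub>R ?b) \<bullet> (?a - ?b) \<le> 0"
    using assms st by (simp add: resolvent_eq_yosida)
  define K where "K = t * (?a \<bullet> ?a) + s * (?b \<bullet> ?b) - (t + s) * (?a \<bullet> ?b)"
  have *: "K \<le> 0"
    using \<open>(t *\<^sub>R ?a - s *\<^sub>R ?b) \<bullet> (?a - ?b) \<le> 0\<close> unfolding K_def
    by (simp add: inner_diff_left inner_diff_right inner_commute algebra_simps)
  have eq: "(norm (?a - ?b))\<^sup>2 = ?a \<bullet> ?a + ?b \<bullet> ?b - 2 * (?a \<bullet> ?b)"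
    by (simp add: power2_norm_eq_inner inner_diff_left inner_diff_right inner_commute algebra_simps)
  have "(t + s) * (norm (?a - ?b))\<^sup>2 = (t - s) * (?b \<bullet> ?b - ?a \<bullet> ?a)
      + 2 * K"
    unfolding eq K_def by (simp add: algebra_simps)
  then have "(t + s) * (norm (?a - ?b))\<^sup>2 \<le> (t - s) * (?b \<bullet> ?b - ?a \<bullet> ?a)"
    using * by linarith
  moreover have "0 \<le> (t + s) * (norm (?a - ?b))\<^sup>2"
    using assms st by simp
  ultimately have nn: "0 \<le> ?b \<bullet> ?b - ?a \<bullet> ?a"
    using st by (smt (verit) mult_pos_neg)
  have "(t + s) * (norm (?a - ?b))\<^sup>2 \<le> (t + s) * (?b \<bullet> ?b - ?a \<bullet> ?a)"
    using \<open>(t + s) * _ \<le> (t - s) * _\<close> mult_right_mono[OF _ nn, of "t - s" "t + s"] assms by linarith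
  then have "(norm (?a - ?b))\<^sup>2 \<le> ?b \<bullet> ?b - ?a \<bullet> ?a"
    using assms st by (simp add: mult_le_cancel_left)
  then show ?thesis by (simp add: power2_norm_eq_inner)
qed auto

text \<open>The resolvent at \<open>a - b\<close> is the limit of the resolvents at \<open>x n - y n\<close>, that is, of \<open>x n\<close>.\<close>

lemma graph_closed:
  assumes xy: "\<And>n. (x n, y n) \<in> C" and x: "x \<longlonglongrightarrow> a" and y: "y \<longlonglongrightarrow> b"
  shows "(a, b) \<in> C"
proof -
  let ?z = "a - b" and ?J = "resolvent C 1 (a - b)"
  have "norm (x n - ?J) \<le> norm ((x n - y n) - ?z)" for n
    using norm_diff_le_norm_diff_resolvent[OF xy yosida_in_graph[of 1 ?z], of 1 n]
    by (simp add: resolvent_eq_yosida)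
  moreover have "(\<lambda>n. norm ((x n - y n) - ?z)) \<longlonglongrightarrow> norm ((a - b) - ?z)"
    by (intro tendsto_intros x y)
  moreover have "(\<lambda>n. norm (x n - ?J)) \<longlonglongrightarrow> norm (a - ?J)"
    by (intro tendsto_intros x)
  ultimately have "norm (a - ?J) \<le> norm ((a - b) - ?z)"
    by (meson LIMSEQ_le)
  then have a: "?J = a" by simp
  then have "yosida C 1 ?z = b" by (simp add: yosida_def)
  with a yosida_in_graph[of 1 ?z] show ?thesis by simp
qed

lemma slope_le_yosida_convergent:
  assumes xi: "\<xi> \<in> slope_le C R"
  obtains w where "(\<lambda>n. yosida C (inverse (real (Suc n))) \<xi>) \<longlonglongrightarrow> w" "(\<xi>, w) \<in> C"
proof -
  define t where "t = (\<lambda>n. inverse (real (Suc n)))"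
  have t0: "t n > 0" for n by (simp add: t_def)
  have tm: "t n \<le> t m" if "m \<le> n" for m n using that by (simp add: t_def)
  let ?A = "\<lambda>n. yosida C (t n) \<xi>"
  let ?N = "\<lambda>n. (norm (?A n))\<^sup>2"
  have diff: "(norm (?A m - ?A n))\<^sup>2 \<le> ?N n - ?N m" if "m \<le> n" for m n
    by (rule norm_yosida_diff_le[OF t0 tm[OF that]])
  have mono: "incseq ?N"
    unfolding incseq_def using diff by (smt (verit) zero_le_power2)
  have "norm (?A n) \<le> R" for n
    using xi t0 by (simp add: slope_le_def)
  then have bnd: "\<forall>n. ?N n \<le> R\<^sup>2" by (simp add: power_mono)
  obtain L where "?N \<longlonglongrightarrow> L"
    using incseq_convergent[OF mono bnd] by blast
  then have cauN: "Cauchy ?N" by (rule LIMSEQ_imp_Cauchy)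
  have "Cauchy ?A"
  proof (rule metric_CauchyI)
    fix e :: real assume "e > 0"
    then obtain M where M: "\<And>m n. m \<ge> M \<Longrightarrow> n \<ge> M \<Longrightarrow> dist (?N m) (?N n) < e\<^sup>2"
      using cauN unfolding Cauchy_def by (metis zero_less_power)
    have *: "norm (?A m - ?A n) < e" if "M \<le> m" "m \<le> n" for m n
    proof -
      have "(norm (?A m - ?A n))\<^sup>2 < e\<^sup>2"
        using diff[OF that(2)] M[of m n] that by (simp add: dist_real_def)
      then show ?thesis using \<open>e > 0\<close> power2_less_imp_less by fastforce
    qed
    show "\<exists>M. \<forall>m\<ge>M. \<forall>n\<ge>M. dist (?A m) (?A n) < e"
    proof (intro exI allI impI)
      fix m n assume "M \<le> m" "M \<le> n"
      then show "dist (?A m) (?A n) < e"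
        using *[of m n] *[of n m] by (cases "m \<le> n") (auto simp: dist_norm norm_minus_commute)
    qed
  qed
  then obtain w where w: "?A \<longlonglongrightarrow> w" by (meson Cauchy_convergent convergent_def)
  have t: "t \<longlonglongrightarrow> 0" unfolding t_def by (rule LIMSEQ_inverse_real_of_nat)
  have "(\<lambda>n. \<xi> + t n *\<^sub>R ?A n) \<longlonglongrightarrow> \<xi> + 0 *\<^sub>R w"
    by (intro tendsto_intros t w)
  then have "(\<lambda>n. resolvent C (t n) \<xi>) \<longlonglongrightarrow> \<xi>"
    using t0 by (simp add: resolvent_eq_yosida)
  then have "(\<xi>, w) \<in> C"
    by (rule graph_closed[OF yosida_in_graph[OF t0] _ w])
  with w that show ?thesis by (simp add: t_def)
qed

lemma in_slope_le: "(\<xi>, y) \<in> C \<Longrightarrow> norm y \<le> R \<Longrightarrow> \<xi> \<in> slope_le C R"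
  unfolding slope_le_def using norm_yosida_le by fastforce

lemma slope_le_subset_Domain: "slope_le C R \<subseteq> Domain C"
  using slope_le_yosida_convergent by blast

text \<open>The bound \<open>|A\<^sub>t \<xi>|\<^sup>2 \<le> A\<^sub>t \<xi> \<bullet> y\<close> for all \<open>y\<close> in the value of \<open>C\<close> at \<open>\<xi>\<close> passes to the limit \<open>w\<close>.
  By Cauchy-Schwarz \<open>w\<close> has minimal norm, and equality of norms forces \<open>y = w\<close>.\<close>

lemma yosida_tendsto_min_section:
  assumes "\<xi> \<in> Domain C"
  shows "(\<lambda>n. yosida C (inverse (real (Suc n))) \<xi>) \<longlonglongrightarrow> min_section C \<xi>"
proof -
  obtain y0 where "(\<xi>, y0) \<in> C" using assms by blast
  then have "\<xi> \<in> slope_le C (norm y0)" by (rule in_slope_le) simp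
  then obtain w where w: "(\<lambda>n. yosida C (inverse (real (Suc n))) \<xi>) \<longlonglongrightarrow> w" "(\<xi>, w) \<in> C"
    by (rule slope_le_yosida_convergent)
  have le: "(norm w)\<^sup>2 \<le> w \<bullet> y" if "(\<xi>, y) \<in> C" for y
  proof (rule LIMSEQ_le)
    show "(\<lambda>n. (norm (yosida C (inverse (real (Suc n))) \<xi>))\<^sup>2) \<longlonglongrightarrow> (norm w)\<^sup>2"
      by (intro tendsto_intros w)
    show "(\<lambda>n. yosida C (inverse (real (Suc n))) \<xi> \<bullet> y) \<longlonglongrightarrow> w \<bullet> y"
      by (intro tendsto_intros w)
    show "\<exists>N. \<forall>n\<ge>N. (norm (yosida C (inverse (real (Suc n))) \<xi>))\<^sup>2
                 \<le> yosida C (inverse (real (Suc n))) \<xi> \<bullet> y"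
      using yosida_inner_le[OF _ that] by simp
  qed
  have "min_section C \<xi> = w"
    unfolding min_section_def
  proof (rule the_equality)
    have "norm w \<le> norm z" if "(\<xi>, z) \<in> C" for z
    proof -
      have "norm w * norm w \<le> norm w * norm z"
        using le[OF that] norm_cauchy_schwarz[of w z] by (simp add: power2_eq_square)
      then show ?thesis by (cases "norm w = 0") (auto simp: mult_le_cancel_left)
    qed
    with w(2) show "(\<xi>, w) \<in> C \<and> (\<forall>z. (\<xi>, z) \<in> C \<longrightarrow> norm w \<le> norm z)" by blast
  next
    fix y assume y: "(\<xi>, y) \<in> C \<and> (\<forall>z. (\<xi>, z) \<in> C \<longrightarrow> norm y \<le> norm z)"
    then have "norm y \<le> norm w" using w(2) by blast
    then have "(norm y)\<^sup>2 \<le> (norm w)\<^sup>2" by (simp add: power_mono)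
    moreover have "(norm (y - w))\<^sup>2 = (norm y)\<^sup>2 + (norm w)\<^sup>2 - 2 * (w \<bullet> y)"
      by (simp add: power2_norm_eq_inner inner_diff_left inner_diff_right inner_commute)
    ultimately have "(norm (y - w))\<^sup>2 \<le> 0" using le[of y] y by linarith
    then show "y = w" by simp
  qed
  with w show ?thesis by simp
qed

lemma closed_slope_le: "closed (slope_le C R)"
proof -
  have "continuous_on UNIV (resolvent C t)" if "t > 0" for t
    unfolding continuous_on_iff
    using resolvent_nonexpansive[OF that] by (metis dist_norm order_le_less_trans)
  then have "closed {\<xi>. norm (yosida C t \<xi>) \<le> R}" if "t > 0" for t
    unfolding yosida_def using that
    by (intro closed_Collect_le continuous_intros) auto
  then have "closed (\<Inter>t\<in>{0<..}. {\<xi>. norm (yosida C t \<xi>) \<le> R})" by auto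
  moreover have "slope_le C R = (\<Inter>t\<in>{0<..}. {\<xi>. norm (yosida C t \<xi>) \<le> R})"
    by (auto simp: slope_le_def)
  ultimately show ?thesis by simp
qed

lemma resolvent_in_slope_le:
  assumes "t > 0" "\<xi> \<in> slope_le C R"
  shows "resolvent C t \<xi> \<in> slope_le C R"
  by (rule in_slope_le[OF yosida_in_graph]) (use assms in \<open>auto simp: slope_le_def\<close>)

end

section \<open>The generated semigroup\<close>

lemma convex_combination_le_sqrt:
  fixes a b w :: real
  assumes "0 \<le> w" "w \<le> 1"
  shows "w * a + (1 - w) * b \<le> sqrt (w * a\<^sup>2 + (1 - w) * b\<^sup>2)"
proof (rule real_le_rsqrt)
  have "w * a\<^sup>2 + (1 - w) * b\<^sup>2 - (w * a + (1 - w) * b)\<^sup>2 = w * (1 - w) * (a - b)\<^sup>2"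
    by (simp add: power2_eq_square algebra_simps)
  moreover have "0 \<le> w * (1 - w) * (a - b)\<^sup>2" using assms by simp
  ultimately show "(w * a + (1 - w) * b)\<^sup>2 \<le> w * a\<^sup>2 + (1 - w) * b\<^sup>2" by linarith
qed

context
  fixes C :: "('a::{real_inner, complete_space} \<times> 'a) set"
  assumes diss: "m_dissipative C"
begin

lemma norm_resolvent_power_diff_le:
  assumes "t > 0"
  shows "norm ((resolvent C t ^^ n) z - (resolvent C t ^^ n) w) \<le> norm (z - w)"
proof (induction n)
  case (Suc n)
  then show ?case
    using resolvent_nonexpansive[OF diss assms, of "(resolvent C t ^^ n) z" "(resolvent C t ^^ n) w"] by simp
qed simp

lemma resolvent_power_displacement:
  assumes "t > 0" "(x, y) \<in> C"
  shows "norm ((resolvent C t ^^ n) x - x) \<le> real n * t * norm y"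
proof (induction n)
  case (Suc n)
  let ?J = "resolvent C t"
  have "norm (?J ((?J ^^ n) x) - x) \<le> norm (?J ((?J ^^ n) x) - ?J x) + norm (?J x - x)"
    using norm_triangle_ineq[of "?J ((?J ^^ n) x) - ?J x" "?J x - x"] by simp
  also have "\<dots> \<le> real n * t * norm y + t * norm y"
    using resolvent_nonexpansive[OF diss assms(1), of "(?J ^^ n) x" x] Suc norm_resolvent_diff_le[OF diss assms]
    by linarith
  finally show ?case by (simp add: algebra_simps)
qed simp

lemma resolvent_identity:
  assumes "0 < s" "s \<le> t"
  shows "resolvent C t z = resolvent C s ((s / t) *\<^sub>R z + (1 - s / t) *\<^sub>R resolvent C t z)"
proof (rule sym, rule resolvent_eqI[OF diss assms(1)])
  show "(resolvent C t z, yosida C t z) \<in> C"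
    by (rule yosida_in_graph[OF diss]) (use assms in simp)
  show "resolvent C t z - s *\<^sub>R yosida C t z = (s / t) *\<^sub>R z + (1 - s / t) *\<^sub>R resolvent C t z"
    by (simp add: yosida_def algebra_simps)
qed

text \<open>The resolvent identity writes the step of size \<open>t\<close> as a step of size \<open>s\<close> from a convex
  combination with weights \<open>s / t\<close> and \<open>1 - s / t\<close>. So the distance for \<open>(n, m)\<close> is at most the same
  combination of the distances for \<open>(n - 1, m - 1)\<close> and \<open>(n, m - 1)\<close>. The squared bound on the right
  is stable under this recursion because the cross terms \<open>2 s (n t - m s)\<close> cancel; what remains has
  a surplus of \<open>2 s\<^sup>2\<close>. This estimate of Crandall-Liggett type carries all properties of the
  semigroup.\<close>

lemma resolvent_power_compare_aux:
  assumes st: "0 < s" "s \<le> t" and xy: "(x, y) \<in> C"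
  shows "norm ((resolvent C t ^^ n) x - (resolvent C s ^^ m) x)
    \<le> norm y * sqrt ((real n * t - real m * s)\<^sup>2 + real n * t\<^sup>2 + real m * s\<^sup>2)"
proof (induction m arbitrary: n)
  case 0
  have t: "t > 0" using st by simp
  have "real n * t \<le> sqrt ((real n * t)\<^sup>2 + real n * t\<^sup>2)"
    by (rule real_le_rsqrt) simp
  then have "norm y * (real n * t) \<le> norm y * sqrt ((real n * t)\<^sup>2 + real n * t\<^sup>2)"
    by (rule mult_left_mono) simp
  then show ?case
    using resolvent_power_displacement[OF t xy, of n] by (simp add: mult_ac)
next
  case (Suc m)
  let ?J = "resolvent C t" and ?K = "resolvent C s"
  show ?case
  proof (cases n)
    case 0
    have "real (Suc m) * s \<le> sqrt ((real (Suc m) * s)\<^sup>2 + real (Suc m) * s\<^sup>2)"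
      by (rule real_le_rsqrt) simp
    then have "norm y * (real (Suc m) * s) \<le> norm y * sqrt ((real (Suc m) * s)\<^sup>2 + real (Suc m) * s\<^sup>2)"
      by (rule mult_left_mono) simp
    then show ?thesis
      using resolvent_power_displacement[OF st(1) xy, of "Suc m"] 0
      by (simp add: mult_ac norm_minus_commute)
  next
    case (Suc k)
    define w where "w = s / t"
    have w: "0 \<le> w" "w \<le> 1" "w * t = s" using st by (auto simp: w_def)
    define E where "E = (\<lambda>n m. (real n * t - real m * s)\<^sup>2 + real n * t\<^sup>2 + real m * s\<^sup>2)"
    have E0: "0 \<le> E n m" for n m unfolding E_def by simp
    let ?u = "(?J ^^ k) x" and ?v = "(?K ^^ m) x"
    have "norm (?J ?u - ?K ?v) \<le> norm (w *\<^sub>R ?u + (1 - w) *\<^sub>R ?J ?u - ?v)"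
      unfolding w_def
      by (subst (1) resolvent_identity[OF st]) (rule resolvent_nonexpansive[OF diss st(1)])
    also have "w *\<^sub>R ?u + (1 - w) *\<^sub>R ?J ?u - ?v = w *\<^sub>R (?u - ?v) + (1 - w) *\<^sub>R (?J ?u - ?v)"
      by (simp add: algebra_simps)
    also have "norm \<dots> \<le> w * norm (?u - ?v) + (1 - w) * norm ((?J ^^ Suc k) x - ?v)"
      using norm_triangle_ineq[of "w *\<^sub>R (?u - ?v)" "(1 - w) *\<^sub>R (?J ?u - ?v)"] w by simp
    also have "\<dots> \<le> w * (norm y * sqrt (E k m)) + (1 - w) * (norm y * sqrt (E (Suc k) m))"
      using Suc.IH[of k] Suc.IH[of "Suc k"] w unfolding E_def
      by (intro add_mono mult_left_mono) auto
    also have "\<dots> = norm y * (w * sqrt (E k m) + (1 - w) * sqrt (E (Suc k) m))"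
      by (simp add: algebra_simps)
    also have "\<dots> \<le> norm y * sqrt (w * (sqrt (E k m))\<^sup>2 + (1 - w) * (sqrt (E (Suc k) m))\<^sup>2)"
      by (intro mult_left_mono convex_combination_le_sqrt w) simp
    also have "\<dots> \<le> norm y * sqrt (E (Suc k) (Suc m))"
    proof (intro mult_left_mono real_sqrt_le_mono)
      have "w * (E (Suc k) m - E k m) = 2 * (w * t) * (real (Suc k) * t - real m * s)"
        unfolding E_def by (simp add: algebra_simps power2_eq_square)
      from this[unfolded w(3)] have "w * E k m + (1 - w) * E (Suc k) m
          = E (Suc k) m - 2 * s * (real (Suc k) * t - real m * s)"
        by (simp add: algebra_simps)
      also have "\<dots> = E (Suc k) (Suc m) - 2 * s\<^sup>2"
        unfolding E_def by (simp add: algebra_simps power2_eq_square)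
      finally show "w * (sqrt (E k m))\<^sup>2 + (1 - w) * (sqrt (E (Suc k) m))\<^sup>2 \<le> E (Suc k) (Suc m)"
        using E0 by simp
    qed simp
    finally show ?thesis unfolding Suc E_def by simp
  qed
qed

lemma resolvent_power_compare:
  assumes st: "0 < s" "0 < t" and xy: "(x, y) \<in> C"
  shows "norm ((resolvent C t ^^ n) x - (resolvent C s ^^ m) x)
    \<le> norm y * sqrt ((real n * t - real m * s)\<^sup>2 + real n * t\<^sup>2 + real m * s\<^sup>2)"
proof (cases "s \<le> t")
  case True
  then show ?thesis using resolvent_power_compare_aux st xy by blast
next
  case False
  then have "norm ((resolvent C s ^^ m) x - (resolvent C t ^^ n) x)
    \<le> norm y * sqrt ((real m * s - real n * t)\<^sup>2 + real m * s\<^sup>2 + real n * t\<^sup>2)"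
    using resolvent_power_compare_aux[of t s x y m n] st xy by simp
  moreover have "(real m * s - real n * t)\<^sup>2 = (real n * t - real m * s)\<^sup>2"
    by (rule power2_commute)
  ultimately show ?thesis by (simp add: norm_minus_commute add_ac)
qed

text \<open>Both \<open>n\<close> steps of size \<open>h\<close> and \<open>n'\<close> steps of size \<open>h'\<close> approximate the flow at time \<open>t\<close>. In
  \<open>resolvent_power_compare\<close> the terms \<open>n h\<^sup>2\<close> and \<open>n' h'\<^sup>2\<close> are at most \<open>(|t| + 1) d\<close>.\<close>

lemma resolvent_power_Cauchy_Domain:
  assumes xy: "(x, y) \<in> C" and e: "e > 0"
  obtains d where "d > 0"
    "\<And>h h' n n'. \<lbrakk>0 < h; h < d; 0 < h'; h' < d; \<bar>real n * h - t\<bar> < d; \<bar>real n' * h' - t\<bar> < d\<rbrakk>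
       \<Longrightarrow> norm ((resolvent C h ^^ n) x - (resolvent C h' ^^ n') x) < e"
proof -
  define q where "q = (e / (norm y + 1))\<^sup>2"
  have ey: "0 < e / (norm y + 1)"
    using e by (intro divide_pos_pos add_nonneg_pos) auto
  then have q: "q > 0" unfolding q_def by (rule zero_less_power)
  define d where "d = min 1 (q / (6 + 2 * \<bar>t\<bar>))"
  have d: "d > 0" "d \<le> 1" using q by (auto simp: d_def divide_simps)
  have "d \<le> q / (6 + 2 * \<bar>t\<bar>)" by (simp add: d_def)
  then have dq: "(6 + 2 * \<bar>t\<bar>) * d \<le> q"
    by (simp add: le_divide_eq mult.commute split: if_splits)
  have small: "real n * h\<^sup>2 \<le> (\<bar>t\<bar> + 1) * d" if "0 < h" "h < d" "\<bar>real n * h - t\<bar> < d" for h n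
  proof -
    have "real n * h * h \<le> (\<bar>t\<bar> + 1) * d"
      using that d by (intro mult_mono) auto
    then show ?thesis by (simp add: power2_eq_square)
  qed
  have "norm ((resolvent C h ^^ n) x - (resolvent C h' ^^ n') x) < e"
    if h: "0 < h" "h < d" "0 < h'" "h' < d" "\<bar>real n * h - t\<bar> < d" "\<bar>real n' * h' - t\<bar> < d" for h h' n n'
  proof -
    have "\<bar>real n * h - real n' * h'\<bar> \<le> 2 * d" using h by linarith
    then have "(real n * h - real n' * h')\<^sup>2 \<le> (2 * d)\<^sup>2"
      using abs_le_square_iff[of "real n * h - real n' * h'" "2 * d"] d by simp
    also have "\<dots> \<le> 4 * d" using d by (simp add: power2_eq_square)
    finally have "(real n * h - real n' * h')\<^sup>2 + real n * h\<^sup>2 + real n' * h'\<^sup>2 \<le> (6 + 2 * \<bar>t\<bar>) * d"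
      using small[of h n] small[of h' n'] h by (simp add: algebra_simps)
    then have "sqrt ((real n * h - real n' * h')\<^sup>2 + real n * h\<^sup>2 + real n' * h'\<^sup>2) \<le> sqrt q"
      using dq by (intro real_sqrt_le_mono) linarith
    also have "sqrt q = e / (norm y + 1)" unfolding q_def using ey by (simp only: real_sqrt_abs abs_of_pos)
    finally have "norm y * sqrt ((real n * h - real n' * h')\<^sup>2 + real n * h\<^sup>2 + real n' * h'\<^sup>2)
        \<le> norm y * (e / (norm y + 1))"
      by (intro mult_left_mono) auto
    also have "\<dots> < (norm y + 1) * (e / (norm y + 1))"
      using ey by (intro mult_strict_right_mono) auto
    also have "\<dots> = e"
    proof -
      have "norm y + 1 \<noteq> 0" using norm_ge_zero[of y] by linarith
      then show ?thesis by (simp only: times_divide_eq_right nonzero_mult_div_cancel_left not_False_eq_True)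
    qed
    finally show ?thesis
      using resolvent_power_compare[OF h(3) h(1) xy, of n n'] by linarith
  qed
  with d that show ?thesis by blast
qed

context
  assumes dense: "closure (Domain C) = UNIV"
begin

lemma Domain_approx:
  assumes "e > 0"
  obtains x' y where "(x', y) \<in> C" "norm (x - x') < e"
proof -
  have "x \<in> closure (Domain C)" using dense by simp
  then obtain x' where "x' \<in> Domain C" "dist x' x < e"
    using assms closure_approachable by blast
  then show ?thesis using that by (auto simp: dist_norm norm_minus_commute)
qed

lemma resolvent_power_Cauchy:
  assumes e: "e > 0"
  obtains d where "d > 0"
    "\<And>h h' n n'. \<lbrakk>0 < h; h < d; 0 < h'; h' < d; \<bar>real n * h - t\<bar> < d; \<bar>real n' * h' - t\<bar> < d\<rbrakk>
       \<Longrightarrow> norm ((resolvent C h ^^ n) x - (resolvent C h' ^^ n') x) < e"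
proof -
  obtain x' y where x': "(x', y) \<in> C" "norm (x - x') < e / 3"
    using Domain_approx[of "e / 3" x] e by auto
  obtain d where d: "d > 0" and *:
    "\<And>h h' n n'. \<lbrakk>0 < h; h < d; 0 < h'; h' < d; \<bar>real n * h - t\<bar> < d; \<bar>real n' * h' - t\<bar> < d\<rbrakk>
       \<Longrightarrow> norm ((resolvent C h ^^ n) x' - (resolvent C h' ^^ n') x') < e / 3"
    using resolvent_power_Cauchy_Domain[OF x'(1), of "e / 3"] e by (metis divide_pos_pos zero_less_numeral)
  have "norm ((resolvent C h ^^ n) x - (resolvent C h' ^^ n') x) < e"
    if h: "0 < h" "h < d" "0 < h'" "h' < d" "\<bar>real n * h - t\<bar> < d" "\<bar>real n' * h' - t\<bar> < d" for h h' n n'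
  proof -
    let ?a = "(resolvent C h ^^ n) x" and ?a' = "(resolvent C h ^^ n) x'"
    let ?b = "(resolvent C h' ^^ n') x" and ?b' = "(resolvent C h' ^^ n') x'"
    have "norm (?a - ?b) \<le> norm (?a - ?a') + norm (?a' - ?b') + norm (?b' - ?b)"
      using norm_triangle_ineq[of "?a - ?a'" "?a' - ?b'"] norm_triangle_ineq[of "?a - ?b'" "?b' - ?b"] by simp
    moreover have "norm (?a - ?a') < e / 3"
      using norm_resolvent_power_diff_le[OF h(1), of n x x'] x' by simp
    moreover have "norm (?b' - ?b) < e / 3"
      using norm_resolvent_power_diff_le[OF h(3), of n' x' x] x' by (simp add: norm_minus_commute)
    moreover have "norm (?a' - ?b') < e / 3" using *[OF h] .
    ultimately show ?thesis by linarith
  qed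
  with d that show ?thesis by blast
qed

lemma resolvent_power_tendsto_unique:
  assumes h: "\<And>k. h k > 0" "h \<longlonglongrightarrow> 0" "(\<lambda>k. real (n k) * h k) \<longlonglongrightarrow> t"
    and h': "\<And>k. h' k > 0" "h' \<longlonglongrightarrow> 0" "(\<lambda>k. real (n' k) * h' k) \<longlonglongrightarrow> t"
    and lim: "(\<lambda>k. (resolvent C (h k) ^^ n k) x) \<longlonglongrightarrow> l"
  shows "(\<lambda>k. (resolvent C (h' k) ^^ n' k) x) \<longlonglongrightarrow> l"
proof -
  have "(\<lambda>k. (resolvent C (h' k) ^^ n' k) x - (resolvent C (h k) ^^ n k) x) \<longlonglongrightarrow> 0"
    unfolding tendsto_iff
  proof (intro allI impI)
    fix e :: real assume "e > 0"
    then obtain d where d: "d > 0" and *: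
      "\<And>h h' n n'. \<lbrakk>0 < h; h < d; 0 < h'; h' < d; \<bar>real n * h - t\<bar> < d; \<bar>real n' * h' - t\<bar> < d\<rbrakk>
         \<Longrightarrow> norm ((resolvent C h ^^ n) x - (resolvent C h' ^^ n') x) < e"
      using resolvent_power_Cauchy by metis
    have "eventually (\<lambda>k. h k < d) sequentially" "eventually (\<lambda>k. h' k < d) sequentially"
      using h(2) h'(2) d by (auto dest: order_tendstoD)
    moreover have "eventually (\<lambda>k. \<bar>real (n k) * h k - t\<bar> < d) sequentially"
        "eventually (\<lambda>k. \<bar>real (n' k) * h' k - t\<bar> < d) sequentially"
      using h(3) h'(3) d unfolding tendsto_iff dist_real_def by auto
    ultimately show "eventually (\<lambda>k. dist ((resolvent C (h' k) ^^ n' k) x - (resolvent C (h k) ^^ n k) x) 0 < e) sequentially"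
      by eventually_elim (use * h(1) h'(1) in \<open>simp add: dist_norm\<close>)
  qed
  from tendsto_add[OF this lim] show ?thesis by simp
qed

text \<open>The freedom in the step sizes \<open>h k\<close> is what makes the semigroup law accessible: for times \<open>s\<close> and \<open>t\<close>
  one can use the same step size, whereas the defining sequence uses \<open>t / n\<close>.\<close>

lemma semigroup_exponential_formula:
  assumes t: "t \<ge> 0" and h: "\<And>k. h k > 0" "h \<longlonglongrightarrow> 0" "(\<lambda>k. real (n k) * h k) \<longlonglongrightarrow> t"
  shows "(\<lambda>k. (resolvent C (h k) ^^ n k) x) \<longlonglongrightarrow> semigroup_of C t x"
proof (cases "t = 0")
  case True
  have "(\<lambda>k. (resolvent C (h k) ^^ 0) x) \<longlonglongrightarrow> x" by simp
  then have "(\<lambda>k. (resolvent C (h k) ^^ n k) x) \<longlonglongrightarrow> x"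
    by (rule resolvent_power_tendsto_unique[OF h(1,2) _ h, where n = "\<lambda>_. 0", rotated]) (simp add: True)
  then show ?thesis by (simp add: semigroup_of_def True)
next
  case False
  with t have t0: "t > 0" by simp
  define g where "g k = t / real (Suc k)" for k
  have g0: "g k > 0" for k using t0 by (simp add: g_def)
  have "(\<lambda>k. t * inverse (real (Suc k))) \<longlonglongrightarrow> t * 0"
    by (intro tendsto_intros LIMSEQ_inverse_real_of_nat)
  then have glim: "g \<longlonglongrightarrow> 0"
    unfolding g_def by (simp add: divide_inverse)
  have gt: "real (Suc k) * g k = t" for k by (simp add: g_def)
  have "Cauchy (\<lambda>k. (resolvent C (g k) ^^ Suc k) x)"
  proof (rule metric_CauchyI)
    fix e :: real assume "e > 0"
    then obtain d where d: "d > 0" and *: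
      "\<And>h h' n n'. \<lbrakk>0 < h; h < d; 0 < h'; h' < d; \<bar>real n * h - t\<bar> < d; \<bar>real n' * h' - t\<bar> < d\<rbrakk>
         \<Longrightarrow> norm ((resolvent C h ^^ n) x - (resolvent C h' ^^ n') x) < e"
      using resolvent_power_Cauchy by metis
    have "eventually (\<lambda>k. g k < d) sequentially"
      using glim d by (auto dest: order_tendstoD)
    then obtain M where M: "\<And>k. k \<ge> M \<Longrightarrow> g k < d"
      unfolding eventually_sequentially by blast
    show "\<exists>M. \<forall>m\<ge>M. \<forall>n\<ge>M. dist ((resolvent C (g m) ^^ Suc m) x) ((resolvent C (g n) ^^ Suc n) x) < e"
      unfolding dist_norm
      by (intro exI[of _ M] allI impI *) (use M g0 gt d in \<open>auto simp del: of_nat_Suc\<close>)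
  qed
  then obtain l where l: "(\<lambda>k. (resolvent C (g k) ^^ Suc k) x) \<longlonglongrightarrow> l"
    by (meson Cauchy_convergent convergent_def)
  then have "(\<lambda>k. (resolvent C (t / real k) ^^ k) x) \<longlonglongrightarrow> l"
    unfolding g_def using filterlim_sequentially_Suc[of "\<lambda>k. (resolvent C (t / real k) ^^ k) x"] by blast
  then have S: "semigroup_of C t x = l"
    using False by (simp add: semigroup_of_def limI)
  show ?thesis
    unfolding S
    by (rule resolvent_power_tendsto_unique[OF g0 glim _ h l]) (simp add: gt del: of_nat_Suc)
qed

lemma floor_step_tendsto:
  assumes "t \<ge> 0"
  shows "(\<lambda>k. real (nat \<lfloor>t * real (Suc k)\<rfloor>) * inverse (real (Suc k))) \<longlonglongrightarrow> t"
proof (rule real_tendsto_sandwich)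
  show "\<forall>\<^sub>F k in sequentially. t - inverse (real (Suc k)) \<le> real (nat \<lfloor>t * real (Suc k)\<rfloor>) * inverse (real (Suc k))"
  proof (intro always_eventually allI)
    fix k
    have "t * real (Suc k) - 1 \<le> real (nat \<lfloor>t * real (Suc k)\<rfloor>)"
      using assms by linarith
    then have "(t * real (Suc k) - 1) * inverse (real (Suc k)) \<le> real (nat \<lfloor>t * real (Suc k)\<rfloor>) * inverse (real (Suc k))"
      by (rule mult_right_mono) simp
    moreover have "(t * real (Suc k) - 1) * inverse (real (Suc k)) = t - inverse (real (Suc k))"
      by (simp add: field_simps)
    ultimately show "t - inverse (real (Suc k)) \<le> real (nat \<lfloor>t * real (Suc k)\<rfloor>) * inverse (real (Suc k))"
      by (simp only:)
  qed
  show "\<forall>\<^sub>F k in sequentially. real (nat \<lfloor>t * real (Suc k)\<rfloor>) * inverse (real (Suc k)) \<le> t"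
  proof (intro always_eventually allI)
    fix k
    have "0 \<le> t * real (Suc k)" using assms by simp
    then have "real (nat \<lfloor>t * real (Suc k)\<rfloor>) \<le> t * real (Suc k)" by linarith
    then have "real (nat \<lfloor>t * real (Suc k)\<rfloor>) * inverse (real (Suc k)) \<le> t * real (Suc k) * inverse (real (Suc k))"
      by (rule mult_right_mono) simp
    also have "\<dots> = t" by (simp add: field_simps)
    finally show "real (nat \<lfloor>t * real (Suc k)\<rfloor>) * inverse (real (Suc k)) \<le> t" .
  qed
  show "(\<lambda>k. t - inverse (real (Suc k))) \<longlonglongrightarrow> t"
    using tendsto_diff[OF tendsto_const LIMSEQ_inverse_real_of_nat, of t] by simp
qed simp

text \<open>Common step sizes \<open>1 / (k + 1)\<close> for all times; successive flows then add their step numbers.\<close>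

lemma semigroup_floor_formula:
  assumes "t \<ge> 0"
  shows "(\<lambda>k. (resolvent C (inverse (real (Suc k))) ^^ nat \<lfloor>t * real (Suc k)\<rfloor>) x) \<longlonglongrightarrow> semigroup_of C t x"
  by (rule semigroup_exponential_formula[OF assms _ LIMSEQ_inverse_real_of_nat floor_step_tendsto[OF assms]]) simp

lemma semigroup_nonexpansive:
  assumes "t \<ge> 0"
  shows "norm (semigroup_of C t x - semigroup_of C t w) \<le> norm (x - w)"
proof (rule LIMSEQ_le_const2)
  show "(\<lambda>k. norm ((resolvent C (inverse (real (Suc k))) ^^ nat \<lfloor>t * real (Suc k)\<rfloor>) x
       - (resolvent C (inverse (real (Suc k))) ^^ nat \<lfloor>t * real (Suc k)\<rfloor>) w))
     \<longlonglongrightarrow> norm (semigroup_of C t x - semigroup_of C t w)"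
    by (intro tendsto_intros semigroup_floor_formula assms)
  show "\<exists>N. \<forall>k\<ge>N. norm ((resolvent C (inverse (real (Suc k))) ^^ nat \<lfloor>t * real (Suc k)\<rfloor>) x
       - (resolvent C (inverse (real (Suc k))) ^^ nat \<lfloor>t * real (Suc k)\<rfloor>) w) \<le> norm (x - w)"
    by (intro exI[of _ 0] allI impI norm_resolvent_power_diff_le) simp
qed

lemma semigroup_add:
  assumes "s \<ge> 0" "t \<ge> 0"
  shows "semigroup_of C (s + t) x = semigroup_of C s (semigroup_of C t x)"
proof (rule LIMSEQ_unique)
  let ?h = "\<lambda>k. inverse (real (Suc k))"
  let ?J = "\<lambda>k. resolvent C (?h k)" and ?n = "\<lambda>t k. nat \<lfloor>t * real (Suc k)\<rfloor>"
  have "(\<lambda>k. real (?n s k) * ?h k + real (?n t k) * ?h k) \<longlonglongrightarrow> s + t"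
    by (intro tendsto_add floor_step_tendsto assms)
  then have "(\<lambda>k. real (?n s k + ?n t k) * ?h k) \<longlonglongrightarrow> s + t"
    by (simp only: of_nat_add distrib_right)
  then show "(\<lambda>k. (?J k ^^ (?n s k + ?n t k)) x) \<longlonglongrightarrow> semigroup_of C (s + t) x"
    by (intro semigroup_exponential_formula LIMSEQ_inverse_real_of_nat) (use assms in auto)
  let ?y = "semigroup_of C t x"
  have "(\<lambda>k. norm ((?J k ^^ ?n t k) x - ?y)) \<longlonglongrightarrow> norm (?y - ?y)"
    by (intro tendsto_intros semigroup_floor_formula assms)
  then have y: "(\<lambda>k. norm ((?J k ^^ ?n t k) x - ?y)) \<longlonglongrightarrow> 0"
    by (simp only: diff_self norm_zero)
  have "(\<lambda>k. (?J k ^^ ?n s k) ((?J k ^^ ?n t k) x) - (?J k ^^ ?n s k) ?y) \<longlonglongrightarrow> 0"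
    by (rule Lim_null_comparison[OF always_eventually y]) (intro allI norm_resolvent_power_diff_le, simp)
  from tendsto_add[OF this semigroup_floor_formula[OF assms(1), of ?y]]
  show "(\<lambda>k. (?J k ^^ (?n s k + ?n t k)) x) \<longlonglongrightarrow> semigroup_of C s ?y"
    by (simp add: funpow_add)
qed

lemma semigroup_Lipschitz_in_time:
  assumes st: "s \<ge> 0" "t \<ge> 0" and xy: "(x, y) \<in> C"
  shows "norm (semigroup_of C t x - semigroup_of C s x) \<le> norm y * \<bar>t - s\<bar>"
proof (rule LIMSEQ_le)
  let ?h = "\<lambda>k. inverse (real (Suc k))"
  let ?J = "\<lambda>k. resolvent C (?h k)" and ?n = "\<lambda>t k. nat \<lfloor>t * real (Suc k)\<rfloor>"
  show "(\<lambda>k. norm ((?J k ^^ ?n t k) x - (?J k ^^ ?n s k) x)) \<longlonglongrightarrow> norm (semigroup_of C t x - semigroup_of C s x)"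
    by (intro tendsto_intros semigroup_floor_formula st)
  have "(\<lambda>k. norm y * sqrt ((real (?n t k) * ?h k - real (?n s k) * ?h k)\<^sup>2
         + real (?n t k) * ?h k * ?h k + real (?n s k) * ?h k * ?h k)) \<longlonglongrightarrow> norm y * sqrt ((t - s)\<^sup>2 + t * 0 + s * 0)"
    by (intro tendsto_intros floor_step_tendsto LIMSEQ_inverse_real_of_nat st)
  then show "(\<lambda>k. norm y * sqrt ((real (?n t k) * ?h k - real (?n s k) * ?h k)\<^sup>2
         + real (?n t k) * ?h k * ?h k + real (?n s k) * ?h k * ?h k)) \<longlonglongrightarrow> norm y * \<bar>t - s\<bar>"
    by simp
  show "\<exists>N. \<forall>k\<ge>N. norm ((?J k ^^ ?n t k) x - (?J k ^^ ?n s k) x)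
      \<le> norm y * sqrt ((real (?n t k) * ?h k - real (?n s k) * ?h k)\<^sup>2
         + real (?n t k) * ?h k * ?h k + real (?n s k) * ?h k * ?h k)"
  proof (intro exI[of _ 0] allI impI)
    fix k :: nat
    have "0 < ?h k" by simp
    from resolvent_power_compare[OF this this xy, of "?n t k" "?n s k"]
    show "norm ((?J k ^^ ?n t k) x - (?J k ^^ ?n s k) x)
      \<le> norm y * sqrt ((real (?n t k) * ?h k - real (?n s k) * ?h k)\<^sup>2
         + real (?n t k) * ?h k * ?h k + real (?n s k) * ?h k * ?h k)"
      unfolding power2_eq_square[of "?h k"] by (simp only: mult.assoc)
  qed
qed

lemma semigroup_tendsto:
  assumes s: "\<And>k. s k \<ge> 0" "s \<longlonglongrightarrow> t"
  shows "(\<lambda>k. semigroup_of C (s k) x) \<longlonglongrightarrow> semigroup_of C t x"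
  unfolding tendsto_iff
proof (intro allI impI)
  fix e :: real assume e: "e > 0"
  have t: "t \<ge> 0" using s by (intro LIMSEQ_le_const) auto
  obtain x' y where x': "(x', y) \<in> C" "norm (x - x') < e / 3"
    using Domain_approx[of "e / 3" x] e by auto
  have "(\<lambda>k. norm y * \<bar>s k - t\<bar>) \<longlonglongrightarrow> norm y * \<bar>t - t\<bar>"
    by (intro tendsto_intros s)
  then have "eventually (\<lambda>k. norm y * \<bar>s k - t\<bar> < e / 3) sequentially"
    by (rule order_tendstoD) (use e in simp)
  then show "eventually (\<lambda>k. dist (semigroup_of C (s k) x) (semigroup_of C t x) < e) sequentially"
  proof eventually_elim
    case (elim k)
    let ?S = "semigroup_of C"
    have "norm (?S (s k) x - ?S t x) \<le> norm (?S (s k) x - ?S (s k) x') + norm (?S (s k) x' - ?S t x') + norm (?S t x' - ?S t x)"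
      using norm_triangle_ineq[of "?S (s k) x - ?S (s k) x'" "?S (s k) x' - ?S t x'"]
        norm_triangle_ineq[of "?S (s k) x - ?S t x'" "?S t x' - ?S t x"] by simp
    moreover have "norm (?S (s k) x - ?S (s k) x') < e / 3"
      using semigroup_nonexpansive[OF s(1), of k x x'] x' by simp
    moreover have "norm (?S t x' - ?S t x) < e / 3"
      using semigroup_nonexpansive[OF t, of x' x] x' by (simp add: norm_minus_commute)
    moreover have "norm (?S (s k) x' - ?S t x') < e / 3"
      using semigroup_Lipschitz_in_time[OF t s(1) x'(1), of k] elim by simp
    ultimately show ?case by (simp add: dist_norm)
  qed
qed

end
end

section \<open>The Tataru distance\<close>

context
  fixes C :: "('a::{real_inner, complete_space} \<times> 'a) set"
  assumes diss: "m_dissipative C" and dense: "closure (Domain C) = UNIV"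
begin

lemma tataru_dist_le:
  assumes "t \<ge> 0"
  shows "tataru_dist C x y \<le> t + norm (x - semigroup_of C t y)"
  unfolding tataru_dist_def
  by (rule cINF_lower) (use assms in \<open>auto intro!: bdd_belowI[of _ 0]\<close>)

lemma tataru_dist_nonneg: "0 \<le> tataru_dist C x y"
  unfolding tataru_dist_def by (rule cINF_greatest) auto

lemma tataru_dist_self: "tataru_dist C x x = 0"
  using tataru_dist_le[of 0 x x] tataru_dist_nonneg[of x x] by (simp add: semigroup_of_def)

lemma tataru_dist_approx:
  assumes "tataru_dist C x y < r"
  obtains t where "t \<ge> 0" "t + norm (x - semigroup_of C t y) < r"
proof -
  have "\<exists>t\<in>{0..}. t + norm (x - semigroup_of C t y) < r"
    using assms unfolding tataru_dist_def
    by (subst (asm) cINF_less_iff) (auto intro!: bdd_belowI[of _ 0])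
  then show ?thesis using that by auto
qed

text \<open>Following the flow from \<open>z\<close> for time \<open>t\<close> and then for time \<open>s\<close>, the error made near \<open>y\<close> is not enlarged,
  since the flow is nonexpansive.\<close>

lemma tataru_dist_triangle: "tataru_dist C x z \<le> tataru_dist C x y + tataru_dist C y z"
proof (rule field_le_epsilon)
  fix e :: real assume e: "e > 0"
  obtain s where s: "s \<ge> 0" "s + norm (x - semigroup_of C s y) < tataru_dist C x y + e / 2"
    using tataru_dist_approx[of x y "tataru_dist C x y + e / 2"] e by auto
  obtain t where t: "t \<ge> 0" "t + norm (y - semigroup_of C t z) < tataru_dist C y z + e / 2"
    using tataru_dist_approx[of y z "tataru_dist C y z + e / 2"] e by auto
  let ?S = "semigroup_of C"
  have "tataru_dist C x z \<le> (s + t) + norm (x - ?S s (?S t z))"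
    using tataru_dist_le[of "s + t" x z] semigroup_add[OF diss dense s(1) t(1), of z] s t by simp
  also have "norm (x - ?S s (?S t z)) \<le> norm (x - ?S s y) + norm (?S s y - ?S s (?S t z))"
    using norm_triangle_ineq[of "x - ?S s y" "?S s y - ?S s (?S t z)"] by simp
  also have "norm (?S s y - ?S s (?S t z)) \<le> norm (y - ?S t z)"
    by (rule semigroup_nonexpansive[OF diss dense s(1)])
  finally show "tataru_dist C x z \<le> tataru_dist C x y + tataru_dist C y z + e"
    using s(2) t(2) by linarith
qed

lemma tataru_dist_Lipschitz: "tataru_dist C x z \<le> tataru_dist C y z + norm (x - y)"
proof -
  have "tataru_dist C x y \<le> norm (x - y)"
    using tataru_dist_le[of 0 x y] by (simp add: semigroup_of_def)
  then show ?thesis using tataru_dist_triangle[of x z y] by linarith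
qed

lemma continuous_on_tataru_dist: "continuous_on UNIV (\<lambda>x. tataru_dist C x y)"
  unfolding continuous_on_iff
proof (intro ballI allI impI)
  fix x :: 'a and e :: real assume e: "e > 0"
  have "dist (tataru_dist C x' y) (tataru_dist C x y) < e" if "dist x' x < e" for x'
    using that tataru_dist_Lipschitz[of x' y x] tataru_dist_Lipschitz[of x y x']
    by (simp add: dist_norm norm_minus_commute abs_less_iff)
  with e show "\<exists>d>0. \<forall>x'\<in>UNIV. dist x' x < d \<longrightarrow> dist (tataru_dist C x' y) (tataru_dist C x y) < e"
    by blast
qed

text \<open>The distance is not symmetric and does not control the norm, but consecutive points are joined by
  flow times \<open>t n\<close> with summable total. Hence the tail from \<open>n\<close> on stays within \<open>4 / 2\<^sup>n\<close> of the orbit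
  of \<open>x n\<close> over a bounded time interval, along which the times converge; continuity of the orbit
  makes the sequence Cauchy.\<close>

lemma tataru_dist_summable_convergent:
  assumes x: "\<And>n. tataru_dist C (x (Suc n)) (x n) \<le> (1 / 2) ^ n"
  shows "convergent x"
proof -
  let ?S = "semigroup_of C"
  have "\<exists>t\<ge>0. t + norm (x (Suc n) - ?S t (x n)) < 2 * (1 / 2) ^ n" for n
  proof -
    have "(0::real) < (1 / 2) ^ n" by simp
    then have "tataru_dist C (x (Suc n)) (x n) < 2 * (1 / 2) ^ n" using x[of n] by linarith
    then show ?thesis by (metis tataru_dist_approx)
  qed
  then obtain t where t: "\<And>n. t n \<ge> 0" "\<And>n. t n + norm (x (Suc n) - ?S (t n) (x n)) < 2 * (1 / 2) ^ n"
    by metis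
  define T where "T n k = (\<Sum>i<k. t (n + i))" for n k
  have T0: "T n k \<ge> 0" for n k unfolding T_def by (simp add: sum_nonneg t)
  have geo: "(\<Sum>i<k. 2 * (1 / 2 :: real) ^ (n + i)) = 4 * (1 / 2) ^ n - 4 * (1 / 2) ^ (n + k)" for n k :: nat
  proof (induction k)
    case (Suc k)
    have "(1 / 2 :: real) ^ (n + Suc k) = (1 / 2) ^ (n + k) / 2" by simp
    with Suc show ?case by (simp only: sum.lessThan_Suc)
  qed simp
  have track: "norm (x (n + k) - ?S (T n k) (x n)) \<le> 4 * (1 / 2) ^ n" for n k
  proof -
    have "norm (x (n + k) - ?S (T n k) (x n)) \<le> (\<Sum>i<k. 2 * (1 / 2) ^ (n + i))"
    proof (induction k)
      case 0
      then show ?case by (simp add: T_def semigroup_of_def)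
    next
      case (Suc k)
      have TS: "T n (Suc k) = t (n + k) + T n k" by (simp add: T_def)
      let ?y = "?S (T n k) (x n)"
      have "norm (x (n + Suc k) - ?S (T n (Suc k)) (x n))
          \<le> norm (x (Suc (n + k)) - ?S (t (n + k)) (x (n + k))) + norm (?S (t (n + k)) (x (n + k)) - ?S (t (n + k)) ?y)"
        unfolding TS semigroup_add[OF diss dense t(1) T0]
        using norm_triangle_ineq[of "x (Suc (n + k)) - ?S (t (n + k)) (x (n + k))" "?S (t (n + k)) (x (n + k)) - ?S (t (n + k)) ?y"]
        by simp
      also have "norm (?S (t (n + k)) (x (n + k)) - ?S (t (n + k)) ?y) \<le> norm (x (n + k) - ?y)"
        by (rule semigroup_nonexpansive[OF diss dense t(1)])
      also have "norm (x (Suc (n + k)) - ?S (t (n + k)) (x (n + k))) \<le> 2 * (1 / 2) ^ (n + k)"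
        using t(2)[of "n + k"] t(1)[of "n + k"] by linarith
      finally show ?case using Suc by simp
    qed
    also have "\<dots> \<le> 4 * (1 / 2) ^ n" unfolding geo by simp
    finally show ?thesis .
  qed
  have Tconv: "convergent (T n)" for n
  proof -
    have "incseq (T n)" by (rule incseq_SucI) (simp add: T_def t)
    moreover have "\<forall>k. T n k \<le> 4 * (1 / 2) ^ n"
    proof
      fix k
      have "t (n + i) \<le> 2 * (1 / 2) ^ (n + i)" for i
        using t(2)[of "n + i"] norm_ge_zero[of "x (Suc (n + i)) - ?S (t (n + i)) (x (n + i))"] by linarith
      then have "T n k \<le> (\<Sum>i<k. 2 * (1 / 2) ^ (n + i))"
        unfolding T_def by (intro sum_mono) auto
      also have "\<dots> \<le> 4 * (1 / 2) ^ n" unfolding geo by simp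
      finally show "T n k \<le> 4 * (1 / 2) ^ n" .
    qed
    ultimately show ?thesis by (metis incseq_convergent convergentI)
  qed
  have "Cauchy x"
  proof (rule metric_CauchyI)
    fix e :: real assume e: "e > 0"
    have "(\<lambda>n. 4 * (1 / 2 :: real) ^ n) \<longlonglongrightarrow> 4 * 0"
      by (intro tendsto_intros LIMSEQ_power_zero) simp
    then have "eventually (\<lambda>n. 4 * (1 / 2 :: real) ^ n < e / 4) sequentially"
      by (rule order_tendstoD) (use e in simp)
    then obtain n where n: "4 * (1 / 2 :: real) ^ n < e / 4"
      unfolding eventually_sequentially by blast
    obtain l where "T n \<longlonglongrightarrow> l" using Tconv convergent_def by blast
    then have "(\<lambda>k. ?S (T n k) (x n)) \<longlonglongrightarrow> ?S l (x n)"
      by (rule semigroup_tendsto[OF diss dense T0])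
    then have "Cauchy (\<lambda>k. ?S (T n k) (x n))" by (rule LIMSEQ_imp_Cauchy)
    then obtain M where M: "\<And>k j. k \<ge> M \<Longrightarrow> j \<ge> M \<Longrightarrow> dist (?S (T n k) (x n)) (?S (T n j) (x n)) < e / 2"
      using e unfolding Cauchy_def by (metis half_gt_zero)
    show "\<exists>M. \<forall>m\<ge>M. \<forall>j\<ge>M. dist (x m) (x j) < e"
    proof (intro exI allI impI)
      fix m j assume mj: "m \<ge> n + M" "j \<ge> n + M"
      define k k' where "k = m - n" and "k' = j - n"
      have k: "m = n + k" "k \<ge> M" "j = n + k'" "k' \<ge> M"
        using mj by (auto simp: k_def k'_def)
      let ?a = "?S (T n k) (x n)" and ?b = "?S (T n k') (x n)"
      have "norm (x m - x j) \<le> norm (x m - ?a) + norm (?a - ?b) + norm (?b - x j)"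
        using norm_triangle_ineq[of "x m - ?a" "?a - ?b"] norm_triangle_ineq[of "x m - ?b" "?b - x j"] by simp
      moreover have "norm (x m - ?a) < e / 4" using track[of n k] n k by simp
      moreover have "norm (?b - x j) < e / 4" using track[of n k'] n k by (simp add: norm_minus_commute)
      moreover have "norm (?a - ?b) < e / 2" using M[OF k(2,4)] by (simp add: dist_norm)
      ultimately show "dist (x m) (x j) < e" by (simp add: dist_norm)
    qed
  qed
  then show ?thesis by (rule Cauchy_convergent)
qed

end

section \<open>Ekeland's variational principle for a quasi-metric\<close>

text \<open>In the order where \<open>w\<close> lies
  above \<open>z\<close> if \<open>F z + r d w z \<le> F w\<close>, each \<open>x (n + 1)\<close> is chosen above \<open>x n\<close> and almost maximal there.
  The limit lies above all \<open>x n\<close>, and whatever lies above the limit lies above all \<open>x n\<close>, hence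
  cannot have a larger value.\<close>

lemma ekeland_quasi_metric:
  fixes F :: "'b::metric_space \<Rightarrow> real" and d :: "'b \<Rightarrow> 'b \<Rightarrow> real"
  assumes z0: "z0 \<in> S"
    and triangle: "\<And>x y z. d x z \<le> d x y + d y z"
    and d_nonneg: "\<And>x y. 0 \<le> d x y" and d_self: "\<And>x. d x x = 0"
    and d_cont: "\<And>y. continuous_on UNIV (\<lambda>x. d x y)"
    and complete: "\<And>x. (\<And>n. x n \<in> S) \<Longrightarrow> (\<And>n. d (x (Suc n)) (x n) \<le> (1 / 2) ^ n) \<Longrightarrow> \<exists>l\<in>S. x \<longlonglongrightarrow> l"
    and bdd: "\<And>x. x \<in> S \<Longrightarrow> F x \<le> B"
    and usc: "\<And>x l c. x \<longlonglongrightarrow> l \<Longrightarrow> (\<lambda>n. F (x n)) \<longlonglongrightarrow> c \<Longrightarrow> c \<le> F l"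
    and r: "r > 0"
  obtains z where "z \<in> S" "F z0 \<le> F z" "\<And>w. w \<in> S \<Longrightarrow> F w - r * d w z \<le> F z"
proof -
  define A where "A z = {w \<in> S. F z + r * d w z \<le> F w}" for z
  have selfA: "z \<in> A z" if "z \<in> S" for z using that by (simp add: A_def d_self)
  have transA: "A w \<subseteq> A z" if "w \<in> A z" for w z
  proof
    fix v assume "v \<in> A w"
    moreover have "r * d v z \<le> r * d v w + r * d w z"
      using mult_left_mono[OF triangle[of v z w], of r] r by (simp add: distrib_left)
    ultimately show "v \<in> A z" using that by (auto simp: A_def)
  qed
  have bddA: "bdd_above (F ` A z)" for z
    using bdd by (auto simp: A_def intro!: bdd_aboveI[of _ B])
  have step: "\<exists>w. w \<in> A z \<and> (\<forall>v\<in>A z. F v \<le> F w + r * (1 / 2) ^ n)" if "z \<in> S" for z and n :: nat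
  proof -
    have "(SUP v\<in>A z. F v) - r * (1 / 2) ^ n < (SUP v\<in>A z. F v)" using r by simp
    then obtain w where w: "w \<in> A z" "(SUP v\<in>A z. F v) - r * (1 / 2) ^ n < F w"
      using less_cSUP_iff[OF _ bddA] selfA[OF \<open>z \<in> S\<close>] by (metis empty_iff)
    have "F v \<le> F w + r * (1 / 2) ^ n" if "v \<in> A z" for v
      using cSUP_upper[OF that bddA] w by linarith
    with w show ?thesis by blast
  qed
  have AS: "A z \<subseteq> S" for z by (auto simp: A_def)
  have step': "\<exists>w. (w \<in> A z0 \<and> (\<forall>v\<in>A w. F v \<le> F w + r * (1 / 2) ^ n)) \<and> w \<in> A z" if z: "z \<in> A z0" for z and n :: nat
  proof -
    have zS: "z \<in> S" using z AS by blast
    obtain w where w: "w \<in> A z" "\<forall>v\<in>A z. F v \<le> F w + r * (1 / 2) ^ n"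
      using step[OF zS] by blast
    have "A w \<subseteq> A z" "A z \<subseteq> A z0" using transA w(1) z by blast+
    with w show ?thesis by blast
  qed
  have z00: "z0 \<in> A z0" by (rule selfA[OF z0])
  have "\<exists>x. \<forall>n. (x n \<in> A z0 \<and> (\<forall>v\<in>A (x n). F v \<le> F (x n) + r * (1 / 2) ^ n)) \<and> x (Suc n) \<in> A (x n)"
  proof (rule dependent_nat_choice)
    show "\<exists>w. w \<in> A z0 \<and> (\<forall>v\<in>A w. F v \<le> F w + r * (1 / 2) ^ (0 :: nat))"
      using step'[OF z00, of 0] by blast
  next
    fix z :: 'b and n :: nat
    assume "z \<in> A z0 \<and> (\<forall>v\<in>A z. F v \<le> F z + r * (1 / 2) ^ n)"
    then show "\<exists>w. (w \<in> A z0 \<and> (\<forall>v\<in>A w. F v \<le> F w + r * (1 / 2) ^ Suc n)) \<and> w \<in> A z"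
      using step' by blast
  qed
  then obtain x where x: "\<And>n. x n \<in> A z0" "\<And>n v. v \<in> A (x n) \<Longrightarrow> F v \<le> F (x n) + r * (1 / 2) ^ n"
    "\<And>n. x (Suc n) \<in> A (x n)"
    by blast
  have xin: "x n \<in> S" for n using x(1) AS by blast
  note gap = x(2)
  have inA: "x m \<in> A (x n)" if "n \<le> m" for m n
    using that
  proof (induction m rule: dec_induct)
    case base then show ?case by (rule selfA[OF xin])
  next
    case (step m) then show ?case using x(3)[of m] transA by blast
  qed
  have "d (x (Suc n)) (x n) \<le> (1 / 2) ^ n" for n
  proof -
    have "x (Suc n) \<in> A (x n)" by (rule x(3))
    then have "F (x n) + r * d (x (Suc n)) (x n) \<le> F (x (Suc n))" "F (x (Suc n)) \<le> F (x n) + r * (1 / 2) ^ n"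
      using gap by (auto simp: A_def)
    then have "r * d (x (Suc n)) (x n) \<le> r * (1 / 2) ^ n" by linarith
    then show ?thesis using r by (simp add: mult_le_cancel_left)
  qed
  then obtain z where z: "z \<in> S" "x \<longlonglongrightarrow> z" using complete xin by blast
  have Fmono: "F (x n) \<le> F (x m)" if "n \<le> m" for n m
  proof -
    have "0 \<le> r * d (x m) (x n)" using r d_nonneg by simp
    then show ?thesis using inA[OF that] unfolding A_def by auto
  qed
  then have "incseq (\<lambda>n. F (x n))" by (simp add: incseq_def)
  then obtain c where c: "(\<lambda>n. F (x n)) \<longlonglongrightarrow> c"
    using incseq_convergent[of "\<lambda>n. F (x n)" B] bdd xin by blast
  then have cF: "c \<le> F z" using usc z(2) by blast
  have zA: "z \<in> A (x n)" for n
  proof -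
    have "(\<lambda>m. d (x m) (x n)) \<longlonglongrightarrow> d z (x n)"
      using d_cont[of "x n"] z(2) by (rule continuous_on_tendsto_compose) auto
    then have lim: "(\<lambda>m. F (x n) + r * d (x m) (x n)) \<longlonglongrightarrow> F (x n) + r * d z (x n)"
      by (intro tendsto_intros)
    have "F (x n) + r * d (x m) (x n) \<le> F (x m)" if "n \<le> m" for m
      using inA[OF that] unfolding A_def by simp
    then have "F (x n) + r * d z (x n) \<le> c"
      by (intro LIMSEQ_le[OF lim c] exI[of _ n]) blast
    with cF z(1) show ?thesis unfolding A_def by simp
  qed
  have "F w - r * d w z \<le> F z" if "w \<in> S" for w
  proof (rule ccontr)
    assume "\<not> ?thesis"
    then have less: "F z + r * d w z < F w" by simp
    then have "w \<in> A z" using that by (simp add: A_def)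
    then have "w \<in> A (x n)" for n using transA[OF zA] by blast
    then have *: "F w \<le> F (x n) + r * (1 / 2) ^ n" for n by (rule gap)
    have "(\<lambda>n. F (x n) + r * (1 / 2) ^ n) \<longlonglongrightarrow> c + r * 0"
      by (intro tendsto_intros c LIMSEQ_power_zero) simp
    then have "F w \<le> c" using * by (intro LIMSEQ_le_const) auto
    moreover have "0 \<le> r * d w z" using r d_nonneg by simp
    ultimately show False using less cF by linarith
  qed
  moreover have "F z0 \<le> F z"
  proof -
    have "z \<in> A z0" using zA[of 0] transA[OF x(1)[of 0]] by blast
    moreover have "0 \<le> r * d z z0" using r d_nonneg by simp
    ultimately show ?thesis unfolding A_def by auto
  qed
  ultimately show ?thesis using that z(1) by blast
qed

section \<open>Viscosity inequalities at points of maximum\<close>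

lemma gradient_quadratic:
  fixes x \<xi> :: "'a::real_inner"
  shows "gradient (\<lambda>x. c / 2 * (norm (x - \<xi>))\<^sup>2) x = c *\<^sub>R (x - \<xi>)"
proof -
  have "GDERIV (\<lambda>x. c / 2 * (norm (x - \<xi>))\<^sup>2) x :> c *\<^sub>R (x - \<xi>)"
    unfolding gderiv_def power2_norm_eq_inner
    by (auto intro!: derivative_eq_intros simp: fun_eq_iff inner_commute algebra_simps)
  then show ?thesis
    unfolding gradient_def
  proof (rule the_equality)
    fix D assume "GDERIV (\<lambda>x. c / 2 * (norm (x - \<xi>))\<^sup>2) x :> D"
    with \<open>GDERIV _ x :> c *\<^sub>R (x - \<xi>)\<close> have "(\<lambda>h. h \<bullet> D) = (\<lambda>h. h \<bullet> (c *\<^sub>R (x - \<xi>)))"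
      unfolding gderiv_def by (rule has_derivative_unique[rotated])
    then show "D = c *\<^sub>R (x - \<xi>)"
      by (metis vector_eq_ldot)
  qed
qed

lemma upper_semicontinuous_eventually:
  assumes "upper_semicontinuous u" "e > 0"
  shows "\<forall>\<^sub>F y in nhds x. u y < u x + e"
proof -
  have "Limsup (nhds x) (\<lambda>y. ereal (u y)) < ereal (u x + e)"
    using assms unfolding upper_semicontinuous_def upper_envelope_def
    by (metis ereal_less_eq(3) less_add_same_cancel1 less_ereal.simps(1) order_le_less_trans)
  from Limsup_lessD[OF this] show ?thesis by simp
qed

lemma lower_semicontinuous_eventually:
  assumes "lower_semicontinuous u" "e > 0"
  shows "\<forall>\<^sub>F y in nhds x. u x - e < u y"
proof -
  have "ereal (u x - e) < Liminf (nhds x) (\<lambda>y. ereal (u y))"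
    using assms unfolding lower_semicontinuous_def lower_envelope_def
    by (metis diff_less_eq less_add_same_cancel1 less_ereal.simps(1) order_less_le_trans)
  from less_LiminfD[OF this] show ?thesis by simp
qed

lemma upper_envelope_le:
  assumes k: "isCont k x" and le: "\<forall>\<^sub>F y in nhds x. f y \<le> k y"
  shows "upper_envelope f x \<le> ereal (k x)"
proof -
  have "upper_envelope f x \<le> Limsup (nhds x) (\<lambda>y. ereal (k y))"
    unfolding upper_envelope_def by (rule Limsup_mono) (use le in simp)
  also have "\<dots> = ereal (k x)"
    by (rule lim_imp_Limsup) (use k in \<open>auto simp: isCont_def tendsto_at_iff_tendsto_nhds\<close>)
  finally show ?thesis .
qed

lemma lower_envelope_ge:
  assumes k: "isCont k x" and le: "\<forall>\<^sub>F y in nhds x. k y \<le> f y"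
  shows "ereal (k x) \<le> lower_envelope f x"
proof -
  have "ereal (k x) = Liminf (nhds x) (\<lambda>y. ereal (k y))"
    by (rule sym, rule lim_imp_Liminf) (use k in \<open>auto simp: isCont_def tendsto_at_iff_tendsto_nhds\<close>)
  also have "\<dots> \<le> lower_envelope f x"
    unfolding lower_envelope_def by (rule Liminf_mono) (use le in simp)
  finally show ?thesis .
qed

context
  fixes G :: "'a::real_inner \<Rightarrow> 'a \<Rightarrow> real" and M r e :: real
  assumes G_cont: "continuous_on UNIV (\<lambda>(x, p). G x p)"
    and G_osc: "\<And>x p q. norm x + norm p + norm q < M \<Longrightarrow> norm (q - p) \<le> r \<Longrightarrow> \<bar>G x p - G x q\<bar> \<le> e"
    and r: "r > 0"
begin

lemma isCont_along_gradient: "isCont (\<lambda>x. G x (c *\<^sub>R (x - \<xi>))) x0"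
proof -
  have "continuous_on UNIV (\<lambda>x. (\<lambda>(x, p). G x p) (x, c *\<^sub>R (x - \<xi>)))"
    by (rule continuous_on_compose2[OF G_cont]) (auto intro!: continuous_intros)
  then show ?thesis by (simp add: continuous_on_eq_continuous_at)
qed

text \<open>The supremum over \<open>q\<close> of a continuous function need not be upper semicontinuous when the ball is not
  compact, so the envelopes of the operators are estimated through the uniform modulus of \<open>G\<close> in
  the gradient variable.\<close>

lemma eventually_small_shift:
  assumes "norm x0 + 2 * norm (c *\<^sub>R (x0 - \<xi>)) + r < M"
  shows "\<forall>\<^sub>F x in nhds x0. \<forall>q\<in>cball 0 r. \<bar>G x (c *\<^sub>R (x - \<xi>) + q) - G x (c *\<^sub>R (x - \<xi>))\<bar> \<le> e"
proof -
  define k where "k = (\<lambda>x. norm x + 2 * norm (c *\<^sub>R (x - \<xi>)) + r)"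
  have "isCont k x0"
    unfolding k_def by (intro continuous_intros)
  then have "(k \<longlongrightarrow> k x0) (nhds x0)"
    by (simp add: isCont_def tendsto_at_iff_tendsto_nhds)
  then have "\<forall>\<^sub>F x in nhds x0. k x < M"
    by (rule order_tendstoD) (use assms in \<open>simp add: k_def\<close>)
  then have "\<forall>\<^sub>F x in nhds x0. norm x + 2 * norm (c *\<^sub>R (x - \<xi>)) + r < M"
    by (simp only: k_def)
  then show ?thesis
  proof eventually_elim
    case (elim x)
    show ?case
    proof
      fix q :: 'a assume "q \<in> cball 0 r"
      then have q: "norm q \<le> r" by simp
      let ?p = "c *\<^sub>R (x - \<xi>)"
      have "norm x + norm (?p + q) + norm ?p < M"
        using norm_triangle_ineq[of ?p q] q elim by linarith
      moreover have "norm (?p - (?p + q)) \<le> r" using q by simp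
      ultimately show "\<bar>G x (?p + q) - G x ?p\<bar> \<le> e" by (rule G_osc)
    qed
  qed
qed

lemma subsolution_at_maximum:
  assumes sub: "viscosity_subsolution \<alpha> (H0_hat C G) h u"
    and c: "c > 0" and \<xi>: "\<xi> \<in> Domain C"
    and M: "norm x0 + 2 * norm (c *\<^sub>R (x0 - \<xi>)) + r < M"
    and max: "\<And>x. u x - (c / 2 * (norm (x - \<xi>))\<^sup>2 + r * tataru_dist C x y)
        \<le> u x0 - (c / 2 * (norm (x0 - \<xi>))\<^sup>2 + r * tataru_dist C x0 y)"
  shows "inverse \<alpha> * (u x0 - h x0) \<le> c * ((x0 - \<xi>) \<bullet> min_section C \<xi>) + r + G x0 (c *\<^sub>R (x0 - \<xi>)) + e"
proof -
  define g where "g = (\<lambda>x. c / 2 * (norm (x - \<xi>))\<^sup>2)"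
  define f where "f = (\<lambda>x. g x + r * tataru_dist C x y)"
  define Hf where "Hf = (\<lambda>x. c * ((x - \<xi>) \<bullet> min_section C \<xi>) + r + (SUP q\<in>cball 0 r. G x (gradient g x + q)))"
  define k where "k = (\<lambda>x. c * ((x - \<xi>) \<bullet> min_section C \<xi>) + r + G x (c *\<^sub>R (x - \<xi>)) + e)"
  have grad: "gradient g x = c *\<^sub>R (x - \<xi>)" for x
    unfolding g_def by (rule gradient_quadratic)
  have "(f, Hf) \<in> H0_hat C G"
    unfolding H0_hat_def f_def Hf_def g_def using c r \<xi> by blast
  moreover have "\<forall>x. u x - f x \<le> u x0 - f x0"
    using max by (simp add: f_def g_def)
  ultimately have "ereal (inverse \<alpha> * (u x0 - h x0)) \<le> upper_envelope Hf x0"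
    using sub unfolding viscosity_subsolution_def by blast
  also have "\<dots> \<le> ereal (k x0)"
  proof (rule upper_envelope_le)
    show "isCont k x0"
      unfolding k_def by (intro continuous_intros isCont_along_gradient)
    show "\<forall>\<^sub>F x in nhds x0. Hf x \<le> k x"
      using eventually_small_shift[OF M]
    proof eventually_elim
      case (elim x)
      have "(SUP q\<in>cball 0 r. G x (gradient g x + q)) \<le> G x (c *\<^sub>R (x - \<xi>)) + e"
        by (rule cSUP_least) (use elim r in \<open>auto simp: grad abs_le_iff\<close>, force)
      then show ?case by (simp add: Hf_def k_def)
    qed
  qed
  finally show ?thesis by (simp add: k_def)
qed

lemma supersolution_at_minimum:
  assumes super: "viscosity_supersolution \<alpha> (H1_hat C G) h v"
    and c: "c > 0" and \<xi>: "\<xi> \<in> Domain C"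
    and M: "norm x0 + 2 * norm (c *\<^sub>R (x0 - \<xi>)) + r < M"
    and min: "\<And>x. v x0 + (c / 2 * (norm (x0 - \<xi>))\<^sup>2 + r * tataru_dist C x0 y)
        \<le> v x + (c / 2 * (norm (x - \<xi>))\<^sup>2 + r * tataru_dist C x y)"
  shows "- c * ((x0 - \<xi>) \<bullet> min_section C \<xi>) - r + G x0 (c *\<^sub>R (\<xi> - x0)) - e \<le> inverse \<alpha> * (v x0 - h x0)"
proof -
  define g where "g = (\<lambda>x. - (c / 2) * (norm (x - \<xi>))\<^sup>2)"
  define f where "f = (\<lambda>x. g x - r * tataru_dist C x y)"
  define Hf where "Hf = (\<lambda>x. - c * ((x - \<xi>) \<bullet> min_section C \<xi>) - r + (INF q\<in>cball 0 r. G x (gradient g x + q)))"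
  define k where "k = (\<lambda>x. - c * ((x - \<xi>) \<bullet> min_section C \<xi>) - r + G x ((- c) *\<^sub>R (x - \<xi>)) - e)"
  have grad: "gradient g x = (- c) *\<^sub>R (x - \<xi>)" for x
    unfolding g_def using gradient_quadratic[of "- c" \<xi> x] by simp
  have "(f, Hf) \<in> H1_hat C G"
    unfolding H1_hat_def f_def Hf_def g_def using c r \<xi> by blast
  moreover have "\<forall>x. f x - v x \<le> f x0 - v x0"
    using min by (simp add: f_def g_def algebra_simps)
  ultimately have "lower_envelope Hf x0 \<le> ereal (inverse \<alpha> * (v x0 - h x0))"
    using super unfolding viscosity_supersolution_def by blast
  moreover have "ereal (k x0) \<le> lower_envelope Hf x0"
  proof (rule lower_envelope_ge)
    show "isCont k x0"
      unfolding k_def by (intro continuous_intros isCont_along_gradient)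
    have M': "norm x0 + 2 * norm ((- c) *\<^sub>R (x0 - \<xi>)) + r < M" using M by simp
    show "\<forall>\<^sub>F x in nhds x0. k x \<le> Hf x"
      using eventually_small_shift[OF M']
    proof eventually_elim
      case (elim x)
      have "G x ((- c) *\<^sub>R (x - \<xi>)) - e \<le> (INF q\<in>cball 0 r. G x (gradient g x + q))"
        by (rule cINF_greatest) (use elim r in \<open>auto simp: grad abs_le_iff\<close>, force)
      then show ?case by (simp add: Hf_def k_def)
    qed
  qed
  ultimately have "ereal (k x0) \<le> ereal (inverse \<alpha> * (v x0 - h x0))" by (rule order_trans[rotated])
  then show ?thesis by (simp add: k_def scaleR_diff_right)
qed

end

section \<open>Doubling through intermediate points\<close>

text \<open>Instead of coupling \<open>x\<close> and \<open>y\<close> directly, the chain \<open>x, \<xi>, \<eta>, y\<close> is coupled. The outer links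
  are centred at \<open>\<xi>\<close> and \<open>\<eta>\<close>, which can be kept in the domain, and thus give admissible test
  functions. The inner link and the penalty do not contain \<open>x\<close> or \<open>y\<close> and never enter a
  test function.\<close>

definition chain_energy :: "real \<Rightarrow> ('a::real_inner \<Rightarrow> real) \<Rightarrow> real \<Rightarrow> 'a \<Rightarrow> 'a \<Rightarrow> 'a \<Rightarrow> 'a \<Rightarrow> real" where
  "chain_energy \<mu> P \<nu> x y \<xi> \<eta> =
     \<nu> / 2 * (norm (x - \<xi>))\<^sup>2 + \<nu> / 2 * (norm (y - \<eta>))\<^sup>2 + \<mu> / 2 * (norm (\<xi> - \<eta>))\<^sup>2 + P \<xi>"

lemma norm_add_squared: "(norm (a + b))\<^sup>2 = (norm a)\<^sup>2 + 2 * (a \<bullet> b) + (norm b)\<^sup>2" for a b :: "'a::real_inner"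
  by (simp add: power2_norm_eq_inner inner_add_left inner_add_right inner_commute)

lemma norm_diff_squared: "(norm (a - b))\<^sup>2 = (norm a)\<^sup>2 - 2 * (a \<bullet> b) + (norm b)\<^sup>2" for a b :: "'a::real_inner"
  by (simp add: power2_norm_eq_inner inner_diff_left inner_diff_right inner_commute)

lemma le_one_plus_of_square_le:
  fixes t a :: real
  assumes "t\<^sup>2 \<le> a" shows "t \<le> 1 + a"
proof -
  have "0 \<le> (t - 1 / 2)\<^sup>2" by simp
  then have "t \<le> 1 + t\<^sup>2" by (simp add: power2_eq_square algebra_simps)
  also have "\<dots> \<le> 1 + a" using assms by simp
  finally show ?thesis .
qed

context
  fixes C :: "('a::{real_inner, complete_space} \<times> 'a) set" and G :: "'a \<Rightarrow> 'a \<Rightarrow> real"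
    and \<alpha> B lam \<mu> :: real and h u v P :: "'a \<Rightarrow> real" and DP :: "'a \<Rightarrow> 'a"
  assumes diss: "m_dissipative C" and dense: "closure (Domain C) = UNIV"
    and G_cont: "continuous_on UNIV (\<lambda>(x, p). G x p)"
    and G_mod: "\<And>M e. M > 0 \<Longrightarrow> e > 0 \<Longrightarrow> \<exists>d>0. \<forall>x p q. norm x + norm p + norm q < M \<longrightarrow>
          norm (q - p) \<le> d \<longrightarrow> \<bar>G x p - G x q\<bar> \<le> e"
    and sub: "viscosity_subsolution \<alpha> (H0_hat C G) h u"
    and super: "viscosity_supersolution \<alpha> (H1_hat C G) h v"
    and u_bound: "\<And>x. \<bar>u x\<bar> \<le> B" and v_bound: "\<And>x. \<bar>v x\<bar> \<le> B"
    and \<alpha>: "\<alpha> > 0" and lam: "lam \<ge> 1" and \<mu>: "\<mu> > 0"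
    and P_nonneg: "\<And>x. 0 \<le> P x"
    and P_resolvent: "\<And>t x. t > 0 \<Longrightarrow> P (resolvent C t x) \<le> P x"
    and P_coercive: "\<And>b. \<exists>r. \<forall>x. P x \<le> b \<longrightarrow> norm x \<le> r"
    and P_deriv: "\<And>r e. e > 0 \<Longrightarrow> \<exists>s>0. \<forall>x w. norm x \<le> r \<longrightarrow> norm w \<le> s \<longrightarrow>
          \<bar>P (x + w) - P x - DP x \<bullet> w\<bar> \<le> e * norm w"
    and DP_bounded: "\<And>r. \<exists>K. \<forall>x. norm x \<le> r \<longrightarrow> norm (DP x) \<le> K"
    and DP_cont: "\<And>r e. e > 0 \<Longrightarrow> \<exists>s>0. \<forall>x y. norm x \<le> r \<longrightarrow> norm y \<le> r \<longrightarrow>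
          norm (x - y) \<le> s \<longrightarrow> norm (DP x - DP y) \<le> e"
begin

abbreviation (input) E where "E \<equiv> chain_energy \<mu> P"

lemma continuous_on_penalty: "continuous_on UNIV P"
proof -
  have "isCont P x" for x
  proof -
    obtain s where s: "s > 0" "\<And>w. norm w \<le> s \<Longrightarrow> \<bar>P (x + w) - P x - DP x \<bullet> w\<bar> \<le> 1 * norm w"
      using P_deriv[of 1 "norm x"] by auto
    have "(\<lambda>w. P (x + w) - P x) \<midarrow>0\<rightarrow> 0"
    proof (rule Lim_null_comparison)
      show "\<forall>\<^sub>F w in at 0. norm (P (x + w) - P x) \<le> (1 + norm (DP x)) * norm w"
        unfolding eventually_at
      proof (intro exI[of _ s] conjI ballI impI s(1))
        fix w :: 'a assume "w \<noteq> 0 \<and> dist w 0 < s"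
        then have "\<bar>P (x + w) - P x - DP x \<bullet> w\<bar> \<le> norm w" using s(2)[of w] by simp
        moreover have "\<bar>DP x \<bullet> w\<bar> \<le> norm (DP x) * norm w" by (rule Cauchy_Schwarz_ineq2)
        ultimately show "norm (P (x + w) - P x) \<le> (1 + norm (DP x)) * norm w"
          by (simp add: algebra_simps)
      qed
      show "(\<lambda>w. (1 + norm (DP x)) * norm w) \<midarrow>0\<rightarrow> 0"
        by (auto intro!: tendsto_eq_intros)
    qed
    then show ?thesis
      unfolding isCont_iff using LIM_zero_iff by blast
  qed
  then show ?thesis by (simp add: continuous_at_imp_continuous_on)
qed

lemma continuous_on_chain_energy:
  "continuous_on UNIV (\<lambda>z. E \<nu> (fst z) (fst (snd z)) (fst (snd (snd z))) (snd (snd (snd z))))"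
  unfolding chain_energy_def
  by (intro continuous_intros continuous_on_compose2[OF continuous_on_penalty]) auto

text \<open>Comparison with the origin bounds the energy, and coercivity of the penalty then bounds \<open>\<xi>\<close> and all
  points linked to it. The radius has to be uniform in \<open>\<nu> \<ge> 1\<close>, because \<open>\<nu>\<close> tends to infinity later.\<close>

lemma chain_near_maximum_bounded:
  "\<exists>r>0. \<forall>\<nu>\<ge>1. \<forall>x y \<xi> \<eta>.
     (\<forall>x' y' \<xi>' \<eta>'. lam * u x' - v y' - E \<nu> x' y' \<xi>' \<eta>' \<le> lam * u x - v y - E \<nu> x y \<xi> \<eta> + 1) \<longrightarrow>
     norm x \<le> r \<and> norm y \<le> r \<and> norm \<xi> \<le> r \<and> norm \<eta> \<le> r"
proof -
  define b where "b = 2 * (lam + 1) * B + P 0 + 1"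
  obtain r0 where r0: "\<And>x. P x \<le> b \<Longrightarrow> norm x \<le> r0" using P_coercive by blast
  have B0: "0 \<le> B" using u_bound[of 0] by linarith
  then have b0: "0 \<le> b" using lam P_nonneg[of 0] by (simp add: b_def)
  define r where "r = \<bar>r0\<bar> + 2 + 2 * b + 2 * b / \<mu>"
  have "2 * b / \<mu> \<ge> 0" using b0 \<mu> by simp
  then have r: "r > 0" using b0 unfolding r_def by linarith
  have "norm x \<le> r \<and> norm y \<le> r \<and> norm \<xi> \<le> r \<and> norm \<eta> \<le> r"
    if \<nu>: "\<nu> \<ge> 1" and near: "\<forall>x' y' \<xi>' \<eta>'. lam * u x' - v y' - E \<nu> x' y' \<xi>' \<eta>' \<le> lam * u x - v y - E \<nu> x y \<xi> \<eta> + 1"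
    for \<nu> x y \<xi> \<eta>
  proof -
    have "lam * u 0 - v 0 - E \<nu> 0 0 0 0 \<le> lam * u x - v y - E \<nu> x y \<xi> \<eta> + 1" using near by blast
    moreover have "E \<nu> 0 0 0 0 = P 0" by (simp add: chain_energy_def)
    moreover have "lam * u x \<le> lam * B" using u_bound[of x] lam by (intro mult_left_mono) auto
    moreover have "lam * (- B) \<le> lam * u 0" using u_bound[of 0] lam by (intro mult_left_mono) auto
    moreover have "\<bar>v 0\<bar> \<le> B" "\<bar>v y\<bar> \<le> B" by (rule v_bound)+
    ultimately have Eb: "E \<nu> x y \<xi> \<eta> \<le> b"
      unfolding b_def by (simp add: algebra_simps abs_le_iff)
    have nn: "0 \<le> \<nu> / 2 * (norm (x - \<xi>))\<^sup>2" "0 \<le> \<nu> / 2 * (norm (y - \<eta>))\<^sup>2" "0 \<le> \<mu> / 2 * (norm (\<xi> - \<eta>))\<^sup>2"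
      using \<nu> \<mu> by auto
    have "norm \<xi> \<le> r0" using Eb nn r0 unfolding chain_energy_def by force
    have half: "1 / 2 * (norm z)\<^sup>2 \<le> \<nu> / 2 * (norm z)\<^sup>2" for z :: 'a
      using \<nu> by (intro mult_right_mono) auto
    have "(norm (x - \<xi>))\<^sup>2 \<le> 2 * b" "(norm (y - \<eta>))\<^sup>2 \<le> 2 * b"
      using Eb nn half[of "x - \<xi>"] half[of "y - \<eta>"] P_nonneg[of \<xi>] unfolding chain_energy_def by linarith+
    moreover have "\<mu> / 2 * (norm (\<xi> - \<eta>))\<^sup>2 \<le> b"
      using Eb nn P_nonneg[of \<xi>] unfolding chain_energy_def by linarith
    then have "(norm (\<xi> - \<eta>))\<^sup>2 \<le> 2 * b / \<mu>" using \<mu> by (simp add: field_simps)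
    ultimately have "norm (x - \<xi>) \<le> 1 + 2 * b" "norm (y - \<eta>) \<le> 1 + 2 * b" "norm (\<xi> - \<eta>) \<le> 1 + 2 * b / \<mu>"
      by (blast intro: le_one_plus_of_square_le)+
    moreover have "norm x \<le> norm \<xi> + norm (x - \<xi>)" "norm \<eta> \<le> norm \<xi> + norm (\<xi> - \<eta>)" "norm y \<le> norm \<eta> + norm (y - \<eta>)"
      using norm_triangle_ineq[of \<xi> "x - \<xi>"] norm_triangle_ineq4[of \<xi> "\<xi> - \<eta>"] norm_triangle_ineq[of \<eta> "y - \<eta>"] by simp_all
    ultimately show ?thesis
      using \<open>norm \<xi> \<le> r0\<close> b0 \<open>2 * b / \<mu> \<ge> 0\<close> unfolding r_def by linarith
  qed
  with r show ?thesis by blast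
qed

text \<open>The optimum is sought with \<open>\<xi>\<close> and \<open>\<eta>\<close> in \<open>slope_le C R\<close>: this set is closed, it lies in the domain, and it
  is mapped into itself by the resolvents. For large \<open>R\<close> the restriction costs at most \<open>\<kappa>\<close>, as the domain
  is dense. Ekeland's principle with the Tataru distance supplies the optimum, and its perturbation
  in \<open>x\<close> and in \<open>y\<close> has exactly the form admitted in the test functions. Replacing \<open>\<xi>\<close> and \<open>\<eta>\<close> by
  their resolvents increases neither the inner link nor the penalty, so optimality bounds the
  sum of the two drift terms \<open>\<nu> (x - \<xi>) \<bullet> C\<^sup>0 \<xi>\<close> and \<open>\<nu> (y - \<eta>) \<bullet> C\<^sup>0 \<eta>\<close> from above by the
  perturbation, which is the bound needed when the two viscosity inequalities are subtracted.\<close>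

lemma chain_optimum:
  assumes \<nu>: "\<nu> \<ge> 1" and \<kappa>: "0 < \<kappa>" "\<kappa> \<le> 1"
  obtains x y \<xi> \<eta> where
    "\<And>x' y' \<xi>' \<eta>'. lam * u x' - v y' - E \<nu> x' y' \<xi>' \<eta>' \<le> lam * u x - v y - E \<nu> x y \<xi> \<eta> + \<kappa>"
    "inverse \<alpha> * (lam * (u x - h x) - (v y - h y))
       \<le> lam * G x ((\<nu> / lam) *\<^sub>R (x - \<xi>)) - G y (\<nu> *\<^sub>R (\<eta> - y)) + \<kappa>"
proof -
  obtain r where r: "r > 0" and rb: "\<And>x y \<xi> \<eta>.
     (\<forall>x' y' \<xi>' \<eta>'. lam * u x' - v y' - E \<nu> x' y' \<xi>' \<eta>' \<le> lam * u x - v y - E \<nu> x y \<xi> \<eta> + 1) \<Longrightarrow>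
     norm x \<le> r \<and> norm y \<le> r \<and> norm \<xi> \<le> r \<and> norm \<eta> \<le> r"
    using chain_near_maximum_bounded \<nu> by blast
  \<comment> \<open>\<open>M\<close> dominates \<open>|x|\<close> plus twice the gradient of an outer link plus the perturbation \<open>\<rho> \<le> 1\<close>.\<close>
  define M where "M = r + 2 * (\<nu> * (2 * r)) + 2"
  have M: "M > 0" using r \<nu> unfolding M_def by (simp add: add_pos_pos)
  define e where "e = \<kappa> / (2 * (lam + 1))"
  have e: "e > 0" using \<kappa> lam by (simp add: e_def)
  have e2: "(lam + 1) * e = \<kappa> / 2" using lam by (simp add: e_def field_simps)
  obtain d where d: "d > 0" "\<And>x p q. norm x + norm p + norm q < M \<Longrightarrow> norm (q - p) \<le> d \<Longrightarrow> \<bar>G x p - G x q\<bar> \<le> e"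
    using G_mod[OF M e] by blast
  define \<Phi> where "\<Phi> = (\<lambda>z. lam * u (fst z) - v (fst (snd z)) - E \<nu> (fst z) (fst (snd z)) (fst (snd (snd z))) (snd (snd (snd z))))"
  have E0: "0 \<le> E \<nu> x y \<xi> \<eta>" for x y \<xi> \<eta>
    using \<nu> \<mu> P_nonneg unfolding chain_energy_def by (intro add_nonneg_nonneg) auto
  have \<Phi>_le: "\<Phi> z \<le> lam * B + B" for z
  proof -
    have "lam * u (fst z) \<le> lam * B" using u_bound[of "fst z"] lam by (intro mult_left_mono) auto
    then show ?thesis using v_bound[of "fst (snd z)"] E0 unfolding \<Phi>_def
      by (smt (verit))
  qed
  have bdd: "bdd_above (range \<Phi>)" using \<Phi>_le by (auto intro!: bdd_aboveI[of _ "lam * B + B"])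
  define m where "m = (SUP z. \<Phi> z)"
  have m: "\<Phi> z \<le> m" for z unfolding m_def by (rule cSUP_upper[OF _ bdd]) simp
  have "m - \<kappa> < (SUP z. \<Phi> z)" using \<kappa> by (simp add: m_def)
  then obtain z1 where z1: "m - \<kappa> < \<Phi> z1" using less_cSUP_iff[OF _ bdd] by blast
  \<comment> \<open>The energy is continuous in the two middle points, so these can be moved into the domain.\<close>
  define x1 y1 where "x1 = fst z1" and "y1 = fst (snd z1)"
  define W where "W = {w. E \<nu> x1 y1 (fst w) (snd w) < lam * u x1 - v y1 - (m - \<kappa>)}"
  have "open W"
    unfolding W_def chain_energy_def
    by (intro open_Collect_less continuous_intros continuous_on_compose2[OF continuous_on_penalty]) auto
  moreover have "snd (snd z1) \<in> W" using z1 by (simp add: W_def \<Phi>_def x1_def y1_def)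
  moreover have "closure (Domain C \<times> Domain C) = UNIV"
    by (simp add: closure_Times dense)
  ultimately have "W \<inter> (Domain C \<times> Domain C) \<noteq> {}"
    using open_Int_closure_eq_empty[of W "Domain C \<times> Domain C"] by blast
  then obtain \<xi>1 \<eta>1 p1 q1 where w1: "(\<xi>1, \<eta>1) \<in> W" "(\<xi>1, p1) \<in> C" "(\<eta>1, q1) \<in> C" by auto
  define R where "R = max (norm p1) (norm q1)"
  have R0: "R \<ge> 0" by (simp add: R_def le_max_iff_disj)
  \<comment> \<open>The drift error is \<open>2 \<rho> R\<close>, so \<open>\<rho>\<close> is chosen after \<open>R\<close>.\<close>
  define \<rho> where "\<rho> = min (min d 1) (\<kappa> / (4 * (R + 1)))"
  have \<rho>: "\<rho> > 0" "\<rho> \<le> d" "\<rho> \<le> 1" using d \<kappa> R0 by (auto simp: \<rho>_def)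
  have "\<rho> \<le> \<kappa> / (4 * (R + 1))" by (simp add: \<rho>_def)
  then have \<rho>R: "2 * \<rho> * R + 2 * \<rho> \<le> \<kappa> / 2" using R0 by (simp add: field_simps)
  define S where "S = {z::'a \<times> 'a \<times> 'a \<times> 'a. fst (snd (snd z)) \<in> slope_le C R \<and> snd (snd (snd z)) \<in> slope_le C R}"
  define dd where "dd = (\<lambda>z w::'a \<times> 'a \<times> 'a \<times> 'a. tataru_dist C (fst z) (fst w) + tataru_dist C (fst (snd z)) (fst (snd w))
     + tataru_dist C (fst (snd (snd z))) (fst (snd (snd w))) + tataru_dist C (snd (snd (snd z))) (snd (snd (snd w))))"
  note td_nonneg = tataru_dist_nonneg[OF diss dense] and td_self = tataru_dist_self[OF diss dense]
  have z1S: "(x1, y1, \<xi>1, \<eta>1) \<in> S"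
    using in_slope_le[OF diss w1(2), of R] in_slope_le[OF diss w1(3), of R] by (simp add: S_def R_def)
  obtain z where z: "z \<in> S" "\<Phi> (x1, y1, \<xi>1, \<eta>1) \<le> \<Phi> z" "\<And>w. w \<in> S \<Longrightarrow> \<Phi> w - \<rho> * dd w z \<le> \<Phi> z"
  proof (rule ekeland_quasi_metric[OF z1S, of dd \<Phi> "lam * B + B" \<rho>])
    show "dd x z \<le> dd x y + dd y z" for x y z
      unfolding dd_def
      using tataru_dist_triangle[OF diss dense, of "fst x" "fst z" "fst y"]
        tataru_dist_triangle[OF diss dense, of "fst (snd x)" "fst (snd z)" "fst (snd y)"]
        tataru_dist_triangle[OF diss dense, of "fst (snd (snd x))" "fst (snd (snd z))" "fst (snd (snd y))"]
        tataru_dist_triangle[OF diss dense, of "snd (snd (snd x))" "snd (snd (snd z))" "snd (snd (snd y))"]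
      by linarith
    show "0 \<le> dd x y" for x y unfolding dd_def by (intro add_nonneg_nonneg td_nonneg)
    show "dd x x = 0" for x unfolding dd_def by (simp add: td_self)
    show "continuous_on UNIV (\<lambda>x. dd x y)" for y
      unfolding dd_def
      by (intro continuous_intros continuous_on_compose2[OF continuous_on_tataru_dist[OF diss dense]]) auto
    show "\<exists>l\<in>S. x \<longlonglongrightarrow> l" if xS: "\<And>n. x n \<in> S" and xd: "\<And>n. dd (x (Suc n)) (x n) \<le> (1 / 2) ^ n" for x
    proof -
      let ?t = "tataru_dist C"
      have le: "?t (fst (x (Suc n))) (fst (x n)) \<le> (1 / 2) ^ n"
        "?t (fst (snd (x (Suc n)))) (fst (snd (x n))) \<le> (1 / 2) ^ n"
        "?t (fst (snd (snd (x (Suc n))))) (fst (snd (snd (x n)))) \<le> (1 / 2) ^ n"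
        "?t (snd (snd (snd (x (Suc n))))) (snd (snd (snd (x n)))) \<le> (1 / 2) ^ n" for n
        using xd[of n] td_nonneg[of "fst (x (Suc n))" "fst (x n)"]
          td_nonneg[of "fst (snd (x (Suc n)))" "fst (snd (x n))"]
          td_nonneg[of "fst (snd (snd (x (Suc n))))" "fst (snd (snd (x n)))"]
          td_nonneg[of "snd (snd (snd (x (Suc n))))" "snd (snd (snd (x n)))"]
        unfolding dd_def by linarith+
      have "convergent (\<lambda>n. fst (x n))" "convergent (\<lambda>n. fst (snd (x n)))"
        "convergent (\<lambda>n. fst (snd (snd (x n))))" "convergent (\<lambda>n. snd (snd (snd (x n))))"
        by (rule tataru_dist_summable_convergent[OF diss dense], rule le)+
      then obtain a b c d where lim: "(\<lambda>n. fst (x n)) \<longlonglongrightarrow> a" "(\<lambda>n. fst (snd (x n))) \<longlonglongrightarrow> b"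
        "(\<lambda>n. fst (snd (snd (x n)))) \<longlonglongrightarrow> c" "(\<lambda>n. snd (snd (snd (x n)))) \<longlonglongrightarrow> d"
        unfolding convergent_def by blast
      have "(\<lambda>n. (fst (x n), fst (snd (x n)), fst (snd (snd (x n))), snd (snd (snd (x n))))) \<longlonglongrightarrow> (a, b, c, d)"
        by (intro tendsto_Pair lim)
      then have "x \<longlonglongrightarrow> (a, b, c, d)" by simp
      moreover have "c \<in> slope_le C R" "d \<in> slope_le C R"
        using closed_sequentially[OF closed_slope_le[OF diss] _ lim(3)]
          closed_sequentially[OF closed_slope_le[OF diss] _ lim(4)] xS by (auto simp: S_def)
      ultimately show ?thesis by (auto simp: S_def)
    qed
    show "c \<le> \<Phi> l" if x: "x \<longlonglongrightarrow> l" and c: "(\<lambda>n. \<Phi> (x n)) \<longlonglongrightarrow> c" for x l c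
    proof (rule field_le_epsilon)
      fix e :: real assume e: "e > 0"
      let ?E = "\<lambda>z. E \<nu> (fst z) (fst (snd z)) (fst (snd (snd z))) (snd (snd (snd z)))"
      have "(\<lambda>n. ?E (x n)) \<longlonglongrightarrow> ?E l"
        by (rule continuous_on_tendsto_compose[OF continuous_on_chain_energy x]) auto
      with c have lim: "(\<lambda>n. \<Phi> (x n) + ?E (x n)) \<longlonglongrightarrow> c + ?E l" by (rule tendsto_add)
      have e': "e / (2 * lam) > 0" "e / 2 > 0" using e lam by auto
      have "\<forall>\<^sub>F n in sequentially. u (fst (x n)) < u (fst l) + e / (2 * lam)"
        using upper_semicontinuous_eventually[OF _ e'(1), of u "fst l"] sub tendsto_fst[OF x]
        unfolding viscosity_subsolution_def filterlim_iff by blast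
      moreover have "\<forall>\<^sub>F n in sequentially. v (fst (snd l)) - e / 2 < v (fst (snd (x n)))"
        using lower_semicontinuous_eventually[OF _ e'(2), of v "fst (snd l)"] super tendsto_fst[OF tendsto_snd[OF x]]
        unfolding viscosity_supersolution_def filterlim_iff by blast
      ultimately have "\<forall>\<^sub>F n in sequentially. \<Phi> (x n) + ?E (x n) \<le> \<Phi> l + ?E l + e"
      proof eventually_elim
        case (elim n)
        have "lam * u (fst (x n)) \<le> lam * (u (fst l) + e / (2 * lam))"
          using elim lam by (intro mult_left_mono) auto
        also have "\<dots> = lam * u (fst l) + e / 2" using lam by (simp add: field_simps)
        finally show ?case using elim by (simp add: \<Phi>_def)
      qed
      then have "c + ?E l \<le> \<Phi> l + ?E l + e"
        by (rule tendsto_upperbound[OF lim]) simp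
      then show "c \<le> \<Phi> l + e" by simp
    qed
  qed (use \<Phi>_le \<rho> in auto)
  obtain x y \<xi> \<eta> where zeq: "z = (x, y, \<xi>, \<eta>)" by (cases z) auto
  have slope: "\<xi> \<in> slope_le C R" "\<eta> \<in> slope_le C R" using z(1) by (auto simp: S_def zeq)
  then have dom: "\<xi> \<in> Domain C" "\<eta> \<in> Domain C" using slope_le_subset_Domain[OF diss] by blast+
  have near: "lam * u x' - v y' - E \<nu> x' y' \<xi>' \<eta>' \<le> lam * u x - v y - E \<nu> x y \<xi> \<eta> + \<kappa>" for x' y' \<xi>' \<eta>'
    using m[of "(x', y', \<xi>', \<eta>')"] z(2) w1(1) unfolding W_def \<Phi>_def zeq by simp
  have "norm x \<le> r \<and> norm y \<le> r \<and> norm \<xi> \<le> r \<and> norm \<eta> \<le> r"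
    by (rule rb) (use near \<kappa> in \<open>smt (verit)\<close>)
  then have norms: "norm x \<le> r" "norm y \<le> r" "norm \<xi> \<le> r" "norm \<eta> \<le> r" by auto
  \<comment> \<open>The drift terms are limits of those with the Yosida approximations, whose step sizes are \<open>1 / (n + 1)\<close>.\<close>
  define A where "A = (\<lambda>n w. yosida C (inverse (real (Suc n))) w)"
  have drift_n: "\<nu> * ((x - \<xi>) \<bullet> A n \<xi> + (y - \<eta>) \<bullet> A n \<eta>) \<le> 2 * \<rho> * R + \<nu> * inverse (real (Suc n)) * R\<^sup>2" for n
  proof -
    define t where "t = inverse (real (Suc n))"
    have t: "t > 0" by (simp add: t_def)
    let ?J = "resolvent C t"
    have J: "?J w = w + t *\<^sub>R A n w" for w
      using resolvent_eq_yosida[OF diss t, of w] by (simp add: A_def t_def)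
    have AR: "norm (A n \<xi>) \<le> R" "norm (A n \<eta>) \<le> R"
      using slope t by (auto simp: slope_le_def A_def t_def)
    have td: "tataru_dist C (?J w) w \<le> t * R" if "norm (A n w) \<le> R" for w
    proof -
      have "tataru_dist C (?J w) w \<le> norm (?J w - w)"
        using tataru_dist_le[OF diss dense, of 0 "?J w" w] by (simp add: semigroup_of_def)
      also have "\<dots> \<le> t * R" using that t by (simp add: J)
      finally show ?thesis .
    qed
    have "(x, y, ?J \<xi>, ?J \<eta>) \<in> S"
      using resolvent_in_slope_le[OF diss t] slope by (simp add: S_def)
    from z(3)[OF this] have "E \<nu> x y \<xi> \<eta> - E \<nu> x y (?J \<xi>) (?J \<eta>) \<le> \<rho> * (tataru_dist C (?J \<xi>) \<xi> + tataru_dist C (?J \<eta>) \<eta>)"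
      by (simp add: zeq \<Phi>_def dd_def td_self)
    also have "\<dots> \<le> \<rho> * (t * R + t * R)"
      using \<rho> by (intro mult_left_mono add_mono td AR) auto
    finally have up: "E \<nu> x y \<xi> \<eta> - E \<nu> x y (?J \<xi>) (?J \<eta>) \<le> t * (2 * \<rho> * R)" by (simp add: algebra_simps)
    have exp: "(norm (a - ?J w))\<^sup>2 \<le> (norm (a - w))\<^sup>2 - 2 * t * ((a - w) \<bullet> A n w) + t\<^sup>2 * R\<^sup>2"
      if "norm (A n w) \<le> R" for a w
    proof -
      have "(norm (a - ?J w))\<^sup>2 = (norm ((a - w) - t *\<^sub>R A n w))\<^sup>2" by (simp add: J algebra_simps)
      also have "\<dots> = (norm (a - w))\<^sup>2 - 2 * t * ((a - w) \<bullet> A n w) + t\<^sup>2 * (norm (A n w))\<^sup>2"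
        by (simp add: norm_diff_squared power_mult_distrib)
      also have "t\<^sup>2 * (norm (A n w))\<^sup>2 \<le> t\<^sup>2 * R\<^sup>2"
        using that by (intro mult_left_mono power_mono) auto
      finally show ?thesis by simp
    qed
    have "\<nu> / 2 * (norm (x - ?J \<xi>))\<^sup>2 \<le> \<nu> / 2 * ((norm (x - \<xi>))\<^sup>2 - 2 * t * ((x - \<xi>) \<bullet> A n \<xi>) + t\<^sup>2 * R\<^sup>2)"
      using \<nu> exp[OF AR(1)] by (intro mult_left_mono) auto
    moreover have "\<nu> / 2 * (norm (y - ?J \<eta>))\<^sup>2 \<le> \<nu> / 2 * ((norm (y - \<eta>))\<^sup>2 - 2 * t * ((y - \<eta>) \<bullet> A n \<eta>) + t\<^sup>2 * R\<^sup>2)"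
      using \<nu> exp[OF AR(2)] by (intro mult_left_mono) auto
    moreover have "\<mu> / 2 * (norm (?J \<xi> - ?J \<eta>))\<^sup>2 \<le> \<mu> / 2 * (norm (\<xi> - \<eta>))\<^sup>2"
      using \<mu> resolvent_nonexpansive[OF diss t, of \<xi> \<eta>] by (intro mult_left_mono power_mono) auto
    moreover have "P (?J \<xi>) \<le> P \<xi>" by (rule P_resolvent[OF t])
    ultimately have "E \<nu> x y (?J \<xi>) (?J \<eta>) \<le> E \<nu> x y \<xi> \<eta>
        - t * (\<nu> * ((x - \<xi>) \<bullet> A n \<xi> + (y - \<eta>) \<bullet> A n \<eta>)) + t * (\<nu> * t * R\<^sup>2)"
      unfolding chain_energy_def by (simp add: algebra_simps power2_eq_square)
    then have "t * (\<nu> * ((x - \<xi>) \<bullet> A n \<xi> + (y - \<eta>) \<bullet> A n \<eta>)) \<le> t * (2 * \<rho> * R + \<nu> * t * R\<^sup>2)"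
      using up unfolding distrib_left[of t "2 * \<rho> * R"] by linarith
    then show ?thesis using t by (simp only: mult_le_cancel_left_pos t_def[symmetric])
  qed
  have drift: "\<nu> * ((x - \<xi>) \<bullet> min_section C \<xi> + (y - \<eta>) \<bullet> min_section C \<eta>) \<le> 2 * \<rho> * R"
  proof (rule LIMSEQ_le)
    show "(\<lambda>n. \<nu> * ((x - \<xi>) \<bullet> A n \<xi> + (y - \<eta>) \<bullet> A n \<eta>)) \<longlonglongrightarrow> \<nu> * ((x - \<xi>) \<bullet> min_section C \<xi> + (y - \<eta>) \<bullet> min_section C \<eta>)"
      unfolding A_def by (intro tendsto_intros yosida_tendsto_min_section[OF diss] dom)
    have "(\<lambda>n. 2 * \<rho> * R + \<nu> * inverse (real (Suc n)) * R\<^sup>2) \<longlonglongrightarrow> 2 * \<rho> * R + \<nu> * 0 * R\<^sup>2"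
      by (intro tendsto_intros LIMSEQ_inverse_real_of_nat)
    then show "(\<lambda>n. 2 * \<rho> * R + \<nu> * inverse (real (Suc n)) * R\<^sup>2) \<longlonglongrightarrow> 2 * \<rho> * R" by simp
  qed (use drift_n in blast)
  have diam: "norm (x - \<xi>) \<le> 2 * r" "norm (y - \<eta>) \<le> 2 * r"
    using norms norm_triangle_ineq4[of x \<xi>] norm_triangle_ineq4[of y \<eta>] by linarith+
  have "inverse \<alpha> * (u x - h x) \<le> (\<nu> / lam) * ((x - \<xi>) \<bullet> min_section C \<xi>) + \<rho> / lam + G x ((\<nu> / lam) *\<^sub>R (x - \<xi>)) + e"
  proof (rule subsolution_at_maximum[OF G_cont _ _ sub, where M = M and y = x])
    have \<rho>l: "\<rho> / lam \<le> \<rho>" using \<rho> lam by (simp add: divide_le_eq mult_le_cancel_left1)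
    show "\<bar>G x p - G x q\<bar> \<le> e" if "norm x + norm p + norm q < M" "norm (q - p) \<le> \<rho> / lam" for x p q
      using d(2)[OF that(1)] that(2) \<rho> \<rho>l by linarith
    show "\<rho> / lam > 0" "\<nu> / lam > 0" using \<rho> \<nu> lam by auto
    show "\<xi> \<in> Domain C" by (rule dom)
    have "\<nu> / lam \<le> \<nu>" using \<nu> lam by (simp add: divide_le_eq mult_le_cancel_left1)
    then have "(\<nu> / lam) * norm (x - \<xi>) \<le> \<nu> * (2 * r)"
      using diam \<nu> lam by (intro mult_mono) auto
    then have "norm ((\<nu> / lam) *\<^sub>R (x - \<xi>)) \<le> \<nu> * (2 * r)" using \<nu> lam by simp
    then show "norm x + 2 * norm ((\<nu> / lam) *\<^sub>R (x - \<xi>)) + \<rho> / lam < M"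
      using norms \<rho> \<rho>l unfolding M_def by linarith
    fix x'
    have "(x', y, \<xi>, \<eta>) \<in> S" using slope by (simp add: S_def)
    from z(3)[OF this] have "lam * u x' - \<nu> / 2 * (norm (x' - \<xi>))\<^sup>2 - \<rho> * tataru_dist C x' x \<le> lam * u x - \<nu> / 2 * (norm (x - \<xi>))\<^sup>2"
      by (simp add: zeq \<Phi>_def dd_def td_self chain_energy_def)
    moreover have scale: "lam * (a - (\<nu> / lam / 2 * b + \<rho> / lam * c)) = lam * a - \<nu> / 2 * b - \<rho> * c" for a b c
      using lam by (simp add: field_simps)
    ultimately have "lam * (u x' - (\<nu> / lam / 2 * (norm (x' - \<xi>))\<^sup>2 + \<rho> / lam * tataru_dist C x' x))
        \<le> lam * (u x - (\<nu> / lam / 2 * (norm (x - \<xi>))\<^sup>2 + \<rho> / lam * tataru_dist C x x))"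
      unfolding scale td_self by simp
    then show "u x' - (\<nu> / lam / 2 * (norm (x' - \<xi>))\<^sup>2 + \<rho> / lam * tataru_dist C x' x)
        \<le> u x - (\<nu> / lam / 2 * (norm (x - \<xi>))\<^sup>2 + \<rho> / lam * tataru_dist C x x)"
      using lam by (simp only: mult_le_cancel_left_pos)
  qed
  then have "lam * (inverse \<alpha> * (u x - h x)) \<le> lam * ((\<nu> / lam) * ((x - \<xi>) \<bullet> min_section C \<xi>) + \<rho> / lam + G x ((\<nu> / lam) *\<^sub>R (x - \<xi>)) + e)"
    using lam by (intro mult_left_mono) auto
  also have "\<dots> = \<nu> * ((x - \<xi>) \<bullet> min_section C \<xi>) + \<rho> + lam * G x ((\<nu> / lam) *\<^sub>R (x - \<xi>)) + lam * e"
    using lam by (simp add: distrib_left)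
  finally have up: "lam * (inverse \<alpha> * (u x - h x)) \<le> \<dots>" .
  have lo: "- \<nu> * ((y - \<eta>) \<bullet> min_section C \<eta>) - \<rho> + G y (\<nu> *\<^sub>R (\<eta> - y)) - e \<le> inverse \<alpha> * (v y - h y)"
  proof (rule supersolution_at_minimum[OF G_cont _ _ super, where M = M and y = y])
    show "\<bar>G x p - G x q\<bar> \<le> e" if "norm x + norm p + norm q < M" "norm (q - p) \<le> \<rho>" for x p q
      using d(2)[OF that(1)] that(2) \<rho> by linarith
    show "\<rho> > 0" "\<nu> > 0" using \<rho> \<nu> by auto
    show "\<eta> \<in> Domain C" by (rule dom)
    have "\<nu> * norm (y - \<eta>) \<le> \<nu> * (2 * r)"
      using diam \<nu> by (intro mult_left_mono) auto
    then have "norm (\<nu> *\<^sub>R (y - \<eta>)) \<le> \<nu> * (2 * r)" using \<nu> by simp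
    then show "norm y + 2 * norm (\<nu> *\<^sub>R (y - \<eta>)) + \<rho> < M"
      using norms \<rho> unfolding M_def by linarith
    fix y'
    have "(x, y', \<xi>, \<eta>) \<in> S" using slope by (simp add: S_def)
    from z(3)[OF this]
    show "v y + (\<nu> / 2 * (norm (y - \<eta>))\<^sup>2 + \<rho> * tataru_dist C y y) \<le> v y' + (\<nu> / 2 * (norm (y' - \<eta>))\<^sup>2 + \<rho> * tataru_dist C y' y)"
      by (simp add: zeq \<Phi>_def dd_def td_self chain_energy_def)
  qed
  have "inverse \<alpha> * (lam * (u x - h x) - (v y - h y)) = lam * (inverse \<alpha> * (u x - h x)) - inverse \<alpha> * (v y - h y)"
    by (simp add: algebra_simps)
  also have "\<dots> \<le> lam * G x ((\<nu> / lam) *\<^sub>R (x - \<xi>)) - G y (\<nu> *\<^sub>R (\<eta> - y))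
      + \<nu> * ((x - \<xi>) \<bullet> min_section C \<xi> + (y - \<eta>) \<bullet> min_section C \<eta>) + 2 * \<rho> + (lam + 1) * e"
    using up lo by (simp add: algebra_simps)
  also have "\<dots> \<le> lam * G x ((\<nu> / lam) *\<^sub>R (x - \<xi>)) - G y (\<nu> *\<^sub>R (\<eta> - y)) + \<kappa>"
    using drift \<rho>R e2 by linarith
  finally show ?thesis using that near by blast
qed

text \<open>Since the optimum is nearly optimal among all \<open>\<xi>\<close> and \<open>\<eta>\<close>, not only among those in the domain, first
  order conditions hold up to a small error: the gradient of the outer link at \<open>x\<close> balances that of
  the inner link and the penalty, and the one at \<open>y\<close> balances that of the inner link.\<close>

lemma chain_optimum_gradients:
  "\<exists>r>0. \<forall>\<nu>\<ge>1. \<forall>\<tau>>0. \<exists>x y \<xi> \<eta>. norm x \<le> r \<and> norm y \<le> r \<and> norm \<xi> \<le> r \<and> norm \<eta> \<le> r \<and>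
     (\<forall>x' y' \<xi>' \<eta>'. lam * u x' - v y' - E \<nu> x' y' \<xi>' \<eta>' \<le> lam * u x - v y - E \<nu> x y \<xi> \<eta> + \<tau>) \<and>
     inverse \<alpha> * (lam * (u x - h x) - (v y - h y))
       \<le> lam * G x ((\<nu> / lam) *\<^sub>R (x - \<xi>)) - G y (\<nu> *\<^sub>R (\<eta> - y)) + \<tau> \<and>
     norm (\<nu> *\<^sub>R (x - \<xi>) - \<mu> *\<^sub>R (\<xi> - \<eta>) - DP \<xi>) \<le> \<tau> \<and>
     norm (\<nu> *\<^sub>R (\<eta> - y) - \<mu> *\<^sub>R (\<xi> - \<eta>)) \<le> \<tau>"
proof -
  obtain r where r: "r > 0" and rb: "\<And>\<nu> x y \<xi> \<eta>. \<nu> \<ge> 1 \<Longrightarrow>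
     (\<forall>x' y' \<xi>' \<eta>'. lam * u x' - v y' - E \<nu> x' y' \<xi>' \<eta>' \<le> lam * u x - v y - E \<nu> x y \<xi> \<eta> + 1) \<Longrightarrow>
     norm x \<le> r \<and> norm y \<le> r \<and> norm \<xi> \<le> r \<and> norm \<eta> \<le> r"
    using chain_near_maximum_bounded by blast
  have "\<exists>x y \<xi> \<eta>. norm x \<le> r \<and> norm y \<le> r \<and> norm \<xi> \<le> r \<and> norm \<eta> \<le> r \<and>
     (\<forall>x' y' \<xi>' \<eta>'. lam * u x' - v y' - E \<nu> x' y' \<xi>' \<eta>' \<le> lam * u x - v y - E \<nu> x y \<xi> \<eta> + \<tau>) \<and>
     inverse \<alpha> * (lam * (u x - h x) - (v y - h y))
       \<le> lam * G x ((\<nu> / lam) *\<^sub>R (x - \<xi>)) - G y (\<nu> *\<^sub>R (\<eta> - y)) + \<tau> \<and>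
     norm (\<nu> *\<^sub>R (x - \<xi>) - \<mu> *\<^sub>R (\<xi> - \<eta>) - DP \<xi>) \<le> \<tau> \<and>
     norm (\<nu> *\<^sub>R (\<eta> - y) - \<mu> *\<^sub>R (\<xi> - \<eta>)) \<le> \<tau>"
    if \<nu>: "\<nu> \<ge> 1" and \<tau>: "\<tau> > 0" for \<nu> \<tau>
  proof -
    obtain s0 where s0: "s0 > 0" "\<And>x w. norm x \<le> r \<Longrightarrow> norm w \<le> s0 \<Longrightarrow> \<bar>P (x + w) - P x - DP x \<bullet> w\<bar> \<le> \<tau> / 3 * norm w"
      using P_deriv[of "\<tau> / 3" r] \<tau> by auto
    define s where "s = min s0 (2 * \<tau> / (3 * (\<nu> + \<mu>)))"
    have s: "s > 0" "s \<le> s0" using s0 \<tau> \<nu> \<mu> by (auto simp: s_def)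
    have "s \<le> 2 * \<tau> / (3 * (\<nu> + \<mu>))" by (simp add: s_def)
    then have s3: "(\<nu> + \<mu>) / 2 * s \<le> \<tau> / 3" using \<nu> \<mu> by (simp add: field_simps)
    define \<kappa> where "\<kappa> = min (min 1 \<tau>) (min (s * \<tau> / 3) (\<tau>\<^sup>2 / (2 * (\<nu> + \<mu>))))"
    have \<kappa>: "0 < \<kappa>" "\<kappa> \<le> 1" "\<kappa> \<le> \<tau>" "\<kappa> \<le> s * \<tau> / 3" "\<kappa> \<le> \<tau>\<^sup>2 / (2 * (\<nu> + \<mu>))"
    proof -
      show "0 < \<kappa>" using s \<tau> \<nu> \<mu> by (simp add: \<kappa>_def)
      show "\<kappa> \<le> 1" "\<kappa> \<le> \<tau>" "\<kappa> \<le> s * \<tau> / 3" "\<kappa> \<le> \<tau>\<^sup>2 / (2 * (\<nu> + \<mu>))"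
        unfolding \<kappa>_def by (meson min.cobounded1 min.cobounded2 order_trans)+
    qed
    obtain x y \<xi> \<eta> where near:
      "\<And>x' y' \<xi>' \<eta>'. lam * u x' - v y' - E \<nu> x' y' \<xi>' \<eta>' \<le> lam * u x - v y - E \<nu> x y \<xi> \<eta> + \<kappa>"
      and ineq: "inverse \<alpha> * (lam * (u x - h x) - (v y - h y))
       \<le> lam * G x ((\<nu> / lam) *\<^sub>R (x - \<xi>)) - G y (\<nu> *\<^sub>R (\<eta> - y)) + \<kappa>"
      using chain_optimum[OF \<nu> \<kappa>(1,2)] by blast
    have near_mono: "lam * u x' - v y' - E \<nu> x' y' \<xi>' \<eta>' \<le> lam * u x - v y - E \<nu> x y \<xi> \<eta> + k" if "\<kappa> \<le> k" for x' y' \<xi>' \<eta>' k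
      using near[of x' y' \<xi>' \<eta>'] that by linarith
    have norms: "norm x \<le> r \<and> norm y \<le> r \<and> norm \<xi> \<le> r \<and> norm \<eta> \<le> r"
      by (rule rb[OF \<nu>]) (use near_mono[OF \<kappa>(2)] in blast)
    define g where "g = \<nu> *\<^sub>R (x - \<xi>) - \<mu> *\<^sub>R (\<xi> - \<eta>) - DP \<xi>"
    have "norm g \<le> \<tau>"
    proof (cases "g = 0")
      case True then show ?thesis using \<tau> by simp
    next
      case False
      \<comment> \<open>Test the near optimality of \<open>\<xi>\<close> by a step of length \<open>s\<close> along the gradient defect.\<close>
      define w where "w = (s / norm g) *\<^sub>R g"
      have w: "norm w = s" using False s by (simp add: w_def)
      have gw: "g \<bullet> w = s * norm g" using False by (simp add: w_def dot_square_norm power2_eq_square)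
      have e1: "E \<nu> x y \<xi> \<eta> \<le> E \<nu> x y (\<xi> + w) \<eta> + \<kappa>" using near[of x y "\<xi> + w" \<eta>] by simp
      have n1: "(norm (x - (\<xi> + w)))\<^sup>2 = (norm (x - \<xi>))\<^sup>2 - 2 * ((x - \<xi>) \<bullet> w) + s\<^sup>2"
        using norm_diff_squared[of "x - \<xi>" w] w by (simp add: algebra_simps)
      have n2: "(norm (\<xi> + w - \<eta>))\<^sup>2 = (norm (\<xi> - \<eta>))\<^sup>2 + 2 * ((\<xi> - \<eta>) \<bullet> w) + s\<^sup>2"
        using norm_add_squared[of "\<xi> - \<eta>" w] w by (simp add: algebra_simps)
      have p1: "P (\<xi> + w) \<le> P \<xi> + DP \<xi> \<bullet> w + \<tau> / 3 * s"
      proof -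
        have "norm \<xi> \<le> r" "norm w \<le> s0" using norms w s by auto
        from s0(2)[OF this] show ?thesis unfolding w by linarith
      qed
      have "\<nu> * ((x - \<xi>) \<bullet> w) - \<mu> * ((\<xi> - \<eta>) \<bullet> w) - DP \<xi> \<bullet> w
          \<le> s * ((\<nu> + \<mu>) / 2 * s) + \<tau> / 3 * s + \<kappa>"
        using e1 p1 unfolding chain_energy_def n1 n2 by (simp add: field_simps power2_eq_square)
      also have "\<nu> * ((x - \<xi>) \<bullet> w) - \<mu> * ((\<xi> - \<eta>) \<bullet> w) - DP \<xi> \<bullet> w = g \<bullet> w"
        by (simp add: g_def inner_diff_left)
      also have "s * ((\<nu> + \<mu>) / 2 * s) \<le> s * (\<tau> / 3)" using s3 s by (intro mult_left_mono) auto
      finally have "s * norm g \<le> s * (\<tau> / 3) + \<tau> / 3 * s + \<kappa>" unfolding gw by simp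
      moreover have "s * (\<tau> / 3) + \<tau> / 3 * s + s * \<tau> / 3 = s * \<tau>" by (simp add: field_simps)
      ultimately have "s * norm g \<le> s * \<tau>" using \<kappa>(4) by linarith
      then show ?thesis using s by simp
    qed
    moreover have "norm (\<nu> *\<^sub>R (\<eta> - y) - \<mu> *\<^sub>R (\<xi> - \<eta>)) \<le> \<tau>"
    proof -
      define f where "f = \<nu> *\<^sub>R (y - \<eta>) + \<mu> *\<^sub>R (\<xi> - \<eta>)"
      have nm: "\<nu> + \<mu> > 0" using \<nu> \<mu> by simp
      \<comment> \<open>In \<open>\<eta>\<close> the energy is quadratic with Hessian \<open>\<nu> + \<mu>\<close>, so this is the Newton step.\<close>
      define w where "w = (1 / (\<nu> + \<mu>)) *\<^sub>R f"
      have fw: "f \<bullet> w = (norm f)\<^sup>2 / (\<nu> + \<mu>)" by (simp add: w_def dot_square_norm)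
      have ww: "(norm w)\<^sup>2 = (norm f)\<^sup>2 / (\<nu> + \<mu>)\<^sup>2" using nm by (simp add: w_def power_divide)
      have e1: "E \<nu> x y \<xi> \<eta> \<le> E \<nu> x y \<xi> (\<eta> + w) + \<kappa>" using near[of x y \<xi> "\<eta> + w"] by simp
      have n1: "(norm (y - (\<eta> + w)))\<^sup>2 = (norm (y - \<eta>))\<^sup>2 - 2 * ((y - \<eta>) \<bullet> w) + (norm w)\<^sup>2"
        using norm_diff_squared[of "y - \<eta>" w] by (simp add: algebra_simps)
      have n2: "(norm (\<xi> - (\<eta> + w)))\<^sup>2 = (norm (\<xi> - \<eta>))\<^sup>2 - 2 * ((\<xi> - \<eta>) \<bullet> w) + (norm w)\<^sup>2"
        using norm_diff_squared[of "\<xi> - \<eta>" w] by (simp add: algebra_simps)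
      have "\<nu> * ((y - \<eta>) \<bullet> w) + \<mu> * ((\<xi> - \<eta>) \<bullet> w) \<le> (\<nu> + \<mu>) / 2 * (norm w)\<^sup>2 + \<kappa>"
        using e1 unfolding chain_energy_def n1 n2 by (simp add: field_simps)
      also have "\<nu> * ((y - \<eta>) \<bullet> w) + \<mu> * ((\<xi> - \<eta>) \<bullet> w) = f \<bullet> w"
        by (simp add: f_def inner_add_left)
      finally have "(norm f)\<^sup>2 / (\<nu> + \<mu>) \<le> (\<nu> + \<mu>) / 2 * ((norm f)\<^sup>2 / (\<nu> + \<mu>)\<^sup>2) + \<tau>\<^sup>2 / (2 * (\<nu> + \<mu>))"
        unfolding fw ww using \<kappa>(5) by linarith
      moreover have "a \<le> b" if "a / c \<le> c / 2 * (a / c\<^sup>2) + b / (2 * c)" "c > 0" for a b c :: real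
        using that by (simp add: field_simps power2_eq_square)
      ultimately have "(norm f)\<^sup>2 \<le> \<tau>\<^sup>2" using nm by blast
      then have "norm f \<le> \<tau>" using \<tau> by (simp add: power2_le_iff_abs_le)
      moreover have "\<nu> *\<^sub>R (\<eta> - y) - \<mu> *\<^sub>R (\<xi> - \<eta>) = - f" by (simp add: f_def algebra_simps)
      ultimately show ?thesis by simp
    qed
    moreover have "inverse \<alpha> * (lam * (u x - h x) - (v y - h y))
       \<le> lam * G x ((\<nu> / lam) *\<^sub>R (x - \<xi>)) - G y (\<nu> *\<^sub>R (\<eta> - y)) + \<tau>"
      using ineq \<kappa>(3) by linarith
    ultimately show ?thesis
      using norms near_mono[OF \<kappa>(3)] unfolding g_def by blast
  qed
  with r show ?thesis by blast
qed

text \<open>The first order conditions bound \<open>\<nu> (x - \<xi>)\<close> and \<open>\<nu> (y - \<eta>)\<close> independently of \<open>\<nu>\<close>. As \<open>\<nu>\<close> grows, \<open>\<xi>\<close> and \<open>\<eta>\<close>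
  therefore merge with \<open>x\<close> and \<open>y\<close>, and the result reads as if \<open>\<mu> / 2 |x - y|\<^sup>2 + P x\<close> had been an
  admissible test function with an attained maximum.\<close>

lemma penalized_doubling:
  assumes \<tau>: "\<tau> > 0"
  obtains x y where
    "\<And>x' y'. lam * u x' - v y' - \<mu> / 2 * (norm (x' - y'))\<^sup>2 - P x'
       \<le> lam * u x - v y - \<mu> / 2 * (norm (x - y))\<^sup>2 + \<tau>"
    "lam * (u x - h x) - (v y - h y)
       \<le> \<alpha> * (lam * G x ((1 / lam) *\<^sub>R (\<mu> *\<^sub>R (x - y) + DP x)) - G y (\<mu> *\<^sub>R (x - y))) + \<tau>"
proof -
  obtain r where r: "r > 0" and opt: "\<And>\<nu> \<tau>. \<nu> \<ge> 1 \<Longrightarrow> \<tau> > 0 \<Longrightarrow>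
     \<exists>x y \<xi> \<eta>. norm x \<le> r \<and> norm y \<le> r \<and> norm \<xi> \<le> r \<and> norm \<eta> \<le> r \<and>
     (\<forall>x' y' \<xi>' \<eta>'. lam * u x' - v y' - E \<nu> x' y' \<xi>' \<eta>' \<le> lam * u x - v y - E \<nu> x y \<xi> \<eta> + \<tau>) \<and>
     inverse \<alpha> * (lam * (u x - h x) - (v y - h y))
       \<le> lam * G x ((\<nu> / lam) *\<^sub>R (x - \<xi>)) - G y (\<nu> *\<^sub>R (\<eta> - y)) + \<tau> \<and>
     norm (\<nu> *\<^sub>R (x - \<xi>) - \<mu> *\<^sub>R (\<xi> - \<eta>) - DP \<xi>) \<le> \<tau> \<and>
     norm (\<nu> *\<^sub>R (\<eta> - y) - \<mu> *\<^sub>R (\<xi> - \<eta>)) \<le> \<tau>"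
    using chain_optimum_gradients by blast
  obtain K0 where K0: "\<And>x. norm x \<le> r \<Longrightarrow> norm (DP x) \<le> K0" using DP_bounded by blast
  \<comment> \<open>\<open>K\<close> bounds the gradients of both outer links, so \<open>K \<le> \<nu> * s\<close> keeps the length of these links below or at \<open>s\<close>.\<close>
  define K where "K = 1 + 2 * \<mu> * r + \<bar>K0\<bar>"
  have K: "K > 0" using r \<mu> by (simp add: K_def add_pos_nonneg)
  define M where "M = r + 2 * K + 1"
  have M: "M > 0" using r K by (simp add: M_def)
  define e where "e = \<tau> / (2 * \<alpha> * (lam + 1))"
  have e: "e > 0" using \<tau> \<alpha> lam by (simp add: e_def)
  have "\<alpha> * (L * (\<tau> / (2 * \<alpha> * L))) = \<tau> / 2" if "L \<noteq> 0" for L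
    using that \<alpha> by (simp add: field_simps)
  then have e2: "\<alpha> * ((lam + 1) * e) = \<tau> / 2"
    unfolding e_def by this (use lam in simp)
  obtain d where d: "d > 0" "\<And>x p q. norm x + norm p + norm q < M \<Longrightarrow> norm (q - p) \<le> d \<Longrightarrow> \<bar>G x p - G x q\<bar> \<le> e"
    using G_mod[OF M e] by blast
  obtain s1 where s1: "s1 > 0" "\<And>x y. norm x \<le> r \<Longrightarrow> norm y \<le> r \<Longrightarrow> norm (x - y) \<le> s1 \<Longrightarrow> norm (DP x - DP y) \<le> d / 3"
    using DP_cont[of "d / 3" r] d by auto
  define s where "s = min s1 (min (d / (6 * \<mu>)) (\<tau> / (8 * \<mu> * r)))"
  have s: "s > 0" "s \<le> s1" "s \<le> d / (6 * \<mu>)" "s \<le> \<tau> / (8 * \<mu> * r)"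
    using s1 d \<tau> \<mu> r by (auto simp: s_def)
  have sd: "2 * \<mu> * s \<le> d / 3" using s(3) \<mu> by (simp add: field_simps)
  have st: "\<mu> * (4 * r * s) \<le> \<tau> / 2" using s(4) \<mu> r by (simp add: field_simps)
  define \<kappa> where "\<kappa> = min (min 1 (\<tau> / 2)) (min (d / 3) (\<tau> / (2 * \<alpha>)))"
  have \<kappa>: "\<kappa> > 0" "\<kappa> \<le> 1" "\<kappa> \<le> \<tau> / 2" "\<kappa> \<le> d / 3" "\<kappa> \<le> \<tau> / (2 * \<alpha>)"
    using \<tau> d \<alpha> by (auto simp: \<kappa>_def)
  have \<kappa>\<alpha>: "\<alpha> * \<kappa> \<le> \<tau> / 2" using \<kappa>(5) \<alpha> by (simp add: field_simps)
  define \<nu> where "\<nu> = max 1 (K / s)"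
  have \<nu>: "\<nu> \<ge> 1" by (simp add: \<nu>_def)
  have "K / s \<le> \<nu>" by (simp add: \<nu>_def)
  then have Ks: "K \<le> \<nu> * s" using s by (simp add: field_simps)
  obtain x y \<xi> \<eta> where norms: "norm x \<le> r" "norm y \<le> r" "norm \<xi> \<le> r" "norm \<eta> \<le> r"
    and near: "\<And>x' y' \<xi>' \<eta>'. lam * u x' - v y' - E \<nu> x' y' \<xi>' \<eta>' \<le> lam * u x - v y - E \<nu> x y \<xi> \<eta> + \<kappa>"
    and ineq: "inverse \<alpha> * (lam * (u x - h x) - (v y - h y))
       \<le> lam * G x ((\<nu> / lam) *\<^sub>R (x - \<xi>)) - G y (\<nu> *\<^sub>R (\<eta> - y)) + \<kappa>"
    and gx: "norm (\<nu> *\<^sub>R (x - \<xi>) - \<mu> *\<^sub>R (\<xi> - \<eta>) - DP \<xi>) \<le> \<kappa>"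
    and gy: "norm (\<nu> *\<^sub>R (\<eta> - y) - \<mu> *\<^sub>R (\<xi> - \<eta>)) \<le> \<kappa>"
    using opt[OF \<nu> \<kappa>(1)] by blast
  define p q where "p = \<nu> *\<^sub>R (x - \<xi>)" and "q = \<nu> *\<^sub>R (\<eta> - y)"
  define q' p' where "q' = \<mu> *\<^sub>R (x - y)" and "p' = q' + DP x"
  have le2r: "norm (\<mu> *\<^sub>R (a - b)) \<le> 2 * \<mu> * r" if "norm a \<le> r" "norm b \<le> r" for a b :: 'a
  proof -
    have "norm (a - b) \<le> 2 * r" using norm_triangle_ineq4[of a b] that by linarith
    then have "\<mu> * norm (a - b) \<le> \<mu> * (2 * r)" using \<mu> by (intro mult_left_mono) auto
    then show ?thesis using \<mu> by simp
  qed
  have pK: "norm p \<le> K"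
  proof -
    have "norm p \<le> norm (p - \<mu> *\<^sub>R (\<xi> - \<eta>) - DP \<xi>) + norm (\<mu> *\<^sub>R (\<xi> - \<eta>)) + norm (DP \<xi>)"
      using norm_triangle_ineq[of "p - \<mu> *\<^sub>R (\<xi> - \<eta>) - DP \<xi>" "\<mu> *\<^sub>R (\<xi> - \<eta>) + DP \<xi>"]
        norm_triangle_ineq[of "\<mu> *\<^sub>R (\<xi> - \<eta>)" "DP \<xi>"] by simp
    also have "\<dots> \<le> \<kappa> + 2 * \<mu> * r + \<bar>K0\<bar>"
      using gx le2r[OF norms(3,4)] K0[OF norms(3)] unfolding p_def by linarith
    finally show ?thesis using \<kappa> by (simp add: K_def)
  qed
  have qK: "norm q \<le> K"
  proof -
    have "norm q \<le> norm (q - \<mu> *\<^sub>R (\<xi> - \<eta>)) + norm (\<mu> *\<^sub>R (\<xi> - \<eta>))"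
      using norm_triangle_ineq[of "q - \<mu> *\<^sub>R (\<xi> - \<eta>)" "\<mu> *\<^sub>R (\<xi> - \<eta>)"] by simp
    also have "\<dots> \<le> \<kappa> + 2 * \<mu> * r" using gy le2r[OF norms(3,4)] unfolding q_def by linarith
    finally show ?thesis using \<kappa> by (simp add: K_def)
  qed
  have p'K: "norm p' \<le> K"
    using norm_triangle_ineq[of q' "DP x"] le2r[OF norms(1,2)] K0[OF norms(1)]
    unfolding p'_def q'_def K_def by linarith
  have q'K: "norm q' \<le> K"
    using le2r[OF norms(1,2)] unfolding q'_def K_def by linarith
  have close: "norm a \<le> s" if "norm (\<nu> *\<^sub>R a) \<le> K" for a :: 'a
  proof -
    have "\<nu> * norm a \<le> K" using that \<nu> by simp
    then have "\<nu> * norm a \<le> \<nu> * s" using Ks by linarith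
    moreover have "\<nu> > 0" using \<nu> by simp
    ultimately show ?thesis by (simp only: mult_le_cancel_left_pos)
  qed
  have xs: "norm (x - \<xi>) \<le> s" by (rule close) (use pK in \<open>simp only: p_def\<close>)
  have ys: "norm (\<eta> - y) \<le> s" by (rule close) (use qK in \<open>simp only: q_def\<close>)
  have diff: "norm ((\<xi> - \<eta>) - (x - y)) \<le> 2 * s"
    using norm_triangle_ineq[of "x - \<xi>" "\<eta> - y"] xs ys norm_minus_cancel[of "(\<xi> - \<eta>) - (x - y)"]
    by (simp add: algebra_simps)
  then have "\<mu> * norm ((\<xi> - \<eta>) - (x - y)) \<le> \<mu> * (2 * s)" using \<mu> by (intro mult_left_mono) auto
  moreover have "norm (\<mu> *\<^sub>R (\<xi> - \<eta>) - q') = \<mu> * norm ((\<xi> - \<eta>) - (x - y))"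
    using \<mu> unfolding q'_def scaleR_diff_right[symmetric] by simp
  ultimately have \<mu>diff: "norm (\<mu> *\<^sub>R (\<xi> - \<eta>) - q') \<le> d / 3"
    using sd by linarith
  have "norm (q - q') \<le> norm (q - \<mu> *\<^sub>R (\<xi> - \<eta>)) + norm (\<mu> *\<^sub>R (\<xi> - \<eta>) - q')"
    using norm_triangle_ineq[of "q - \<mu> *\<^sub>R (\<xi> - \<eta>)" "\<mu> *\<^sub>R (\<xi> - \<eta>) - q'"] by simp
  then have qq: "norm (q - q') \<le> d" using gy \<mu>diff \<kappa>(4) d unfolding q_def by linarith
  have "norm (p - p') \<le> norm (p - \<mu> *\<^sub>R (\<xi> - \<eta>) - DP \<xi>) + norm (\<mu> *\<^sub>R (\<xi> - \<eta>) - q') + norm (DP \<xi> - DP x)"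
    using norm_triangle_ineq[of "p - \<mu> *\<^sub>R (\<xi> - \<eta>) - DP \<xi>" "(\<mu> *\<^sub>R (\<xi> - \<eta>) - q') + (DP \<xi> - DP x)"]
      norm_triangle_ineq[of "\<mu> *\<^sub>R (\<xi> - \<eta>) - q'" "DP \<xi> - DP x"]
    by (simp add: p'_def algebra_simps)
  moreover have "norm (DP \<xi> - DP x) \<le> d / 3"
    using s1(2)[OF norms(3,1)] xs s by (simp add: norm_minus_commute)
  ultimately have pp: "norm (p - p') \<le> d" using gx \<mu>diff \<kappa>(4) unfolding p_def by linarith
  have shrink: "norm ((1 / lam) *\<^sub>R a) \<le> norm a" for a :: 'a
    using lam by (simp add: divide_le_eq mult_le_cancel_left1)
  have "\<bar>G x ((1 / lam) *\<^sub>R p) - G x ((1 / lam) *\<^sub>R p')\<bar> \<le> e"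
  proof (rule d(2))
    show "norm x + norm ((1 / lam) *\<^sub>R p) + norm ((1 / lam) *\<^sub>R p') < M"
      using norms pK p'K shrink[of p] shrink[of p'] unfolding M_def by linarith
    show "norm ((1 / lam) *\<^sub>R p' - (1 / lam) *\<^sub>R p) \<le> d"
      using shrink[of "p' - p"] pp by (simp add: scaleR_diff_right norm_minus_commute)
  qed
  then have Gx: "lam * G x ((1 / lam) *\<^sub>R p) \<le> lam * (G x ((1 / lam) *\<^sub>R p') + e)"
    using lam by (intro mult_left_mono) auto
  have "\<bar>G y q - G y q'\<bar> \<le> e"
  proof (rule d(2))
    show "norm y + norm q + norm q' < M" using norms qK q'K unfolding M_def by linarith
    show "norm (q' - q) \<le> d" using qq by (simp add: norm_minus_commute)
  qed
  with Gx have G_le: "lam * G x ((1 / lam) *\<^sub>R p) - G y q \<le> lam * G x ((1 / lam) *\<^sub>R p') - G y q' + (lam + 1) * e"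
    by (simp add: algebra_simps abs_le_iff)
  have "lam * (u x - h x) - (v y - h y) = \<alpha> * (inverse \<alpha> * (lam * (u x - h x) - (v y - h y)))"
    using \<alpha> by simp
  also have "\<dots> \<le> \<alpha> * (lam * G x ((1 / lam) *\<^sub>R p) - G y q + \<kappa>)"
    using ineq \<alpha> unfolding p_def q_def by (intro mult_left_mono) auto
  also have "\<dots> \<le> \<alpha> * ((lam * G x ((1 / lam) *\<^sub>R p') - G y q' + (lam + 1) * e) + \<kappa>)"
    using G_le \<alpha> by (intro mult_left_mono add_right_mono) auto
  also have "\<dots> = \<alpha> * (lam * G x ((1 / lam) *\<^sub>R p') - G y q') + \<alpha> * ((lam + 1) * e) + \<alpha> * \<kappa>"
    by (simp add: algebra_simps)
  also have "\<dots> \<le> \<alpha> * (lam * G x ((1 / lam) *\<^sub>R p') - G y q') + \<tau>"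
    using \<kappa>\<alpha> e2 by linarith
  finally have second: "lam * (u x - h x) - (v y - h y) \<le> \<alpha> * (lam * G x ((1 / lam) *\<^sub>R p') - G y q') + \<tau>" .
  have first: "lam * u x' - v y' - \<mu> / 2 * (norm (x' - y'))\<^sup>2 - P x'
       \<le> lam * u x - v y - \<mu> / 2 * (norm (x - y))\<^sup>2 + \<tau>" for x' y'
  proof -
    have "lam * u x' - v y' - (\<mu> / 2 * (norm (x' - y'))\<^sup>2 + P x') \<le> lam * u x - v y - E \<nu> x y \<xi> \<eta> + \<kappa>"
      using near[of x' y' x' y'] by (simp add: chain_energy_def)
    moreover have "\<mu> / 2 * (norm (\<xi> - \<eta>))\<^sup>2 \<le> E \<nu> x y \<xi> \<eta>"
      using \<nu> P_nonneg[of \<xi>] unfolding chain_energy_def by simp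
    moreover have "\<mu> / 2 * (norm (x - y))\<^sup>2 \<le> \<mu> / 2 * (norm (\<xi> - \<eta>))\<^sup>2 + \<tau> / 2"
    proof -
      let ?a = "norm (x - y)" and ?b = "norm (\<xi> - \<eta>)"
      have "?a - ?b \<le> 2 * s"
        using norm_triangle_ineq2[of "x - y" "\<xi> - \<eta>"] diff by (simp add: norm_minus_commute)
      moreover have "?a \<le> 2 * r" "?b \<le> 2 * r"
        using norm_triangle_ineq4[of x y] norm_triangle_ineq4[of \<xi> \<eta>] norms by linarith+
      ultimately have "(?a - ?b) * (?a + ?b) \<le> 2 * s * (4 * r)"
        using s r by (intro mult_mono) auto
      then have "?a\<^sup>2 - ?b\<^sup>2 \<le> 2 * (4 * r * s)" by (simp add: power2_eq_square algebra_simps)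
      then have "\<mu> / 2 * (?a\<^sup>2 - ?b\<^sup>2) \<le> \<mu> / 2 * (2 * (4 * r * s))" using \<mu> by (intro mult_left_mono) auto
      then show ?thesis using st by (simp add: algebra_simps)
    qed
    ultimately show ?thesis using \<kappa>(3) by linarith
  qed
  show ?thesis
    by (rule that[OF first second[unfolded p'_def q'_def]])
qed

end

section \<open>Radial penalties\<close>

lemma modulus_tendsto_zero:
  fixes \<sigma> :: "real \<Rightarrow> real"
  assumes "continuous_on {0..} \<sigma>" "\<sigma> 0 = 0" "e > 0"
  obtains d where "d > 0" "\<And>r. 0 \<le> r \<Longrightarrow> r \<le> d \<Longrightarrow> \<bar>\<sigma> r\<bar> \<le> e"
proof -
  obtain d where d: "d > 0" "\<And>r. r \<in> {0..} \<Longrightarrow> dist r 0 < d \<Longrightarrow> dist (\<sigma> r) (\<sigma> 0) < e"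
    using assms unfolding continuous_on_iff by (metis atLeast_iff order_refl)
  have "\<bar>\<sigma> r\<bar> \<le> e" if "0 \<le> r" "r \<le> d / 2" for r
    using d(2)[of r] that d(1) assms(2) by (simp add: dist_real_def)
  with d(1) that[of "d / 2"] show ?thesis by auto
qed

context
  fixes \<phi> \<phi>' :: "real \<Rightarrow> real" and \<epsilon> :: real
  assumes \<phi>_mono: "mono_on {0..} \<phi>" and \<phi>_nonneg: "\<And>r. r \<ge> 0 \<Longrightarrow> 0 \<le> \<phi> r"
    and \<phi>_deriv: "\<And>r. r \<ge> 0 \<Longrightarrow> (\<phi> has_real_derivative \<phi>' r) (at r within {0..})"
    and \<phi>'_cont: "continuous_on {0..} \<phi>'"
    and \<phi>_top: "filterlim \<phi> at_top at_top"
    and \<epsilon>: "\<epsilon> > 0"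
begin

lemma radial_derivative_bounded: "\<exists>K. \<forall>a. 0 \<le> a \<longrightarrow> a \<le> R \<longrightarrow> \<bar>\<phi>' a\<bar> \<le> K"
proof -
  have "compact (\<phi>' ` {0..R})"
    by (intro compact_continuous_image continuous_on_subset[OF \<phi>'_cont]) auto
  then have "bounded (\<phi>' ` {0..R})" by (rule compact_imp_bounded)
  then obtain K where "\<And>x. x \<in> \<phi>' ` {0..R} \<Longrightarrow> \<bar>x\<bar> \<le> K"
    unfolding bounded_iff by auto
  then show ?thesis by (intro exI[of _ K]) auto
qed

lemma radial_derivative_modulus:
  assumes "e > 0"
  shows "\<exists>s>0. \<forall>a b. 0 \<le> a \<longrightarrow> a \<le> R \<longrightarrow> 0 \<le> b \<longrightarrow> b \<le> R \<longrightarrow> \<bar>b - a\<bar> \<le> s \<longrightarrow> \<bar>\<phi>' b - \<phi>' a\<bar> \<le> e"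
proof -
  have "uniformly_continuous_on {0..R} \<phi>'"
    by (intro compact_uniformly_continuous continuous_on_subset[OF \<phi>'_cont]) auto
  then obtain d where d: "d > 0" "\<And>a b. a \<in> {0..R} \<Longrightarrow> b \<in> {0..R} \<Longrightarrow> dist b a < d \<Longrightarrow> dist (\<phi>' b) (\<phi>' a) < e"
    using assms unfolding uniformly_continuous_on_def by metis
  have "\<bar>\<phi>' b - \<phi>' a\<bar> \<le> e" if "0 \<le> a" "a \<le> R" "0 \<le> b" "b \<le> R" "\<bar>b - a\<bar> \<le> d / 2" for a b
    using d(2)[of a b] that d(1) by (simp add: dist_real_def)
  with d(1) show ?thesis by (intro exI[of _ "d / 2"]) auto
qed

lemma radial_mean_value:
  assumes "0 \<le> a" "0 \<le> b"
  obtains c where "min a b \<le> c" "c \<le> max a b" "\<phi> b - \<phi> a = \<phi>' c * (b - a)"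
proof (cases "a = b")
  case True
  then show ?thesis using that[of a] by simp
next
  case False
  let ?l = "min a b" and ?u = "max a b"
  have lu: "?l < ?u" "0 \<le> ?l" using False assms by auto
  have "\<exists>c\<in>{?l<..<?u}. \<phi> ?u - \<phi> ?l = (\<lambda>y. \<phi>' c * y) (?u - ?l)"
  proof (rule mvt_simple[OF lu(1)])
    fix x assume x: "?l \<le> x" "x \<le> ?u"
    have "(\<phi> has_real_derivative \<phi>' x) (at x within {?l..?u})"
      by (rule has_field_derivative_subset[OF \<phi>_deriv]) (use x lu in auto)
    then show "(\<phi> has_derivative (\<lambda>y. \<phi>' x * y)) (at x within {?l..?u})"
      by (simp add: has_field_derivative_def)
  qed
  then obtain c where "?l < c" "c < ?u" "\<phi> ?u - \<phi> ?l = \<phi>' c * (?u - ?l)" by auto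
  then show ?thesis using that[of c]
    by (cases "a \<le> b") (auto simp: algebra_simps)
qed

text \<open>The radial function \<open>\<epsilon> \<phi> (|x|\<^sup>2)\<close> will serve as penalty. On bounded sets its linearization error is
  uniformly small, because \<open>\<phi>'\<close> is uniformly continuous on compact intervals.\<close>

lemma radial_linearization:
  fixes x w :: "'a::real_inner"
  assumes e: "e > 0"
  shows "\<exists>s>0. \<forall>x w::'a. norm x \<le> r \<longrightarrow> norm w \<le> s \<longrightarrow>
    \<bar>\<epsilon> * \<phi> ((norm (x + w))\<^sup>2) - \<epsilon> * \<phi> ((norm x)\<^sup>2) - (2 * \<epsilon> * \<phi>' ((norm x)\<^sup>2)) *\<^sub>R x \<bullet> w\<bar> \<le> e * norm w"
proof -
  define R where "R = (\<bar>r\<bar> + 1)\<^sup>2"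
  obtain K where K: "\<And>a. 0 \<le> a \<Longrightarrow> a \<le> R \<Longrightarrow> \<bar>\<phi>' a\<bar> \<le> K" using radial_derivative_bounded by blast
  have K0: "0 \<le> K" using K[of 0] by (simp add: R_def)
  define L where "L = 2 * \<bar>r\<bar> + 1"
  have L: "L \<ge> 1" by (simp add: L_def)
  define e1 where "e1 = e / (2 * \<epsilon> * L)"
  have e1: "e1 > 0" using e \<epsilon> L by (simp add: e1_def)
  have e1': "\<epsilon> * e1 * L = e / 2" using \<epsilon> L by (simp add: e1_def)
  obtain s1 where s1: "s1 > 0" "\<And>a b. 0 \<le> a \<Longrightarrow> a \<le> R \<Longrightarrow> 0 \<le> b \<Longrightarrow> b \<le> R \<Longrightarrow> \<bar>b - a\<bar> \<le> s1 \<Longrightarrow> \<bar>\<phi>' b - \<phi>' a\<bar> \<le> e1"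
    using radial_derivative_modulus[OF e1, of R] by blast
  define s where "s = min (min 1 (s1 / L)) (e / (2 * \<epsilon> * (K + 1)))"
  have s: "s > 0" "s \<le> 1" using s1 L e \<epsilon> K0 by (auto simp: s_def)
  have "s \<le> s1 / L" by (simp add: s_def)
  then have sL: "s * L \<le> s1" using L by (simp add: field_simps)
  have "s \<le> e / (2 * \<epsilon> * (K + 1))" by (simp add: s_def)
  then have "s * (2 * \<epsilon> * (K + 1)) \<le> e" using \<epsilon> K0 by (simp add: pos_le_divide_eq)
  moreover have "0 \<le> s * (2 * \<epsilon>)" using s \<epsilon> by simp
  ultimately have sK: "\<epsilon> * K * s \<le> e / 2" by (simp add: algebra_simps)
  have "\<bar>\<epsilon> * \<phi> ((norm (x + w))\<^sup>2) - \<epsilon> * \<phi> ((norm x)\<^sup>2) - (2 * \<epsilon> * \<phi>' ((norm x)\<^sup>2)) *\<^sub>R x \<bullet> w\<bar> \<le> e * norm w"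
    if x: "norm x \<le> r" and w: "norm w \<le> s" for x w :: 'a
  proof -
    define a b where "a = (norm x)\<^sup>2" and "b = (norm (x + w))\<^sup>2"
    have "norm (x + w) \<le> \<bar>r\<bar> + 1" using norm_triangle_ineq[of x w] x w s by linarith
    then have b: "0 \<le> b" "b \<le> R" unfolding b_def R_def by (auto intro!: power_mono)
    have a: "0 \<le> a" "a \<le> R" unfolding a_def R_def using x by (auto intro!: power_mono)
    have ba: "b - a = 2 * (x \<bullet> w) + (norm w)\<^sup>2"
      by (simp add: a_def b_def norm_add_squared)
    have ww: "(norm w)\<^sup>2 \<le> s * norm w" using w by (simp add: power2_eq_square mult_right_mono)
    also have "\<dots> \<le> norm w" using s by (simp add: mult_left_le_one_le)
    finally have "(norm w)\<^sup>2 \<le> norm w" .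
    moreover have "\<bar>x \<bullet> w\<bar> \<le> \<bar>r\<bar> * norm w"
      using Cauchy_Schwarz_ineq2[of x w] mult_right_mono[of "norm x" "\<bar>r\<bar>" "norm w"] x by fastforce
    moreover have "0 \<le> (norm w)\<^sup>2" by simp
    moreover have "L * norm w = 2 * (\<bar>r\<bar> * norm w) + norm w" by (simp add: L_def algebra_simps)
    ultimately have baL: "\<bar>b - a\<bar> \<le> L * norm w" unfolding ba by linarith
    also have "\<dots> \<le> L * s" using w L by (intro mult_left_mono) auto
    finally have bas: "\<bar>b - a\<bar> \<le> s1" using sL by (simp add: mult.commute)
    obtain c where c: "min a b \<le> c" "c \<le> max a b" "\<phi> b - \<phi> a = \<phi>' c * (b - a)"
      using radial_mean_value[OF a(1) b(1)] by blast
    have "\<bar>c - a\<bar> \<le> s1" "0 \<le> c" "c \<le> R" using c bas a b by (auto simp: abs_le_iff min_def max_def split: if_splits)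
    then have ce: "\<bar>\<phi>' c - \<phi>' a\<bar> \<le> e1" using s1(2)[of a c] a by simp
    have "\<epsilon> * \<phi> b - \<epsilon> * \<phi> a - 2 * \<epsilon> * \<phi>' a * (x \<bullet> w) = \<epsilon> * ((\<phi>' c - \<phi>' a) * (b - a)) + \<epsilon> * (\<phi>' a * (norm w)\<^sup>2)"
    proof -
      have "\<epsilon> * \<phi> b - \<epsilon> * \<phi> a = \<epsilon> * (\<phi>' c * (b - a))"
        unfolding c(3)[symmetric] by (simp only: right_diff_distrib)
      moreover have xw: "2 * (x \<bullet> w) = (b - a) - (norm w)\<^sup>2" using ba by simp
      have "2 * \<epsilon> * \<phi>' a * (x \<bullet> w) = \<epsilon> * \<phi>' a * ((b - a) - (norm w)\<^sup>2)"
        unfolding xw[symmetric] by simp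
      ultimately show ?thesis by (simp add: algebra_simps)
    qed
    moreover have "\<bar>\<epsilon> * ((\<phi>' c - \<phi>' a) * (b - a))\<bar> \<le> e / 2 * norm w"
    proof -
      have "\<bar>\<phi>' c - \<phi>' a\<bar> * \<bar>b - a\<bar> \<le> e1 * (L * norm w)"
        using ce baL e1 by (intro mult_mono) auto
      then have "\<epsilon> * (\<bar>\<phi>' c - \<phi>' a\<bar> * \<bar>b - a\<bar>) \<le> \<epsilon> * (e1 * (L * norm w))"
        using \<epsilon> by (intro mult_left_mono) auto
      also have "\<dots> = \<epsilon> * e1 * L * norm w" by simp
      finally show ?thesis using \<epsilon> unfolding e1' by (simp add: abs_mult)
    qed
    moreover have "\<bar>\<epsilon> * (\<phi>' a * (norm w)\<^sup>2)\<bar> \<le> e / 2 * norm w"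
    proof -
      have "\<bar>\<phi>' a\<bar> * (norm w)\<^sup>2 \<le> K * (s * norm w)"
        using K[OF a] ww K0 by (intro mult_mono) auto
      then have "\<epsilon> * (\<bar>\<phi>' a\<bar> * (norm w)\<^sup>2) \<le> \<epsilon> * (K * (s * norm w))"
        using \<epsilon> by (intro mult_left_mono) auto
      also have "\<dots> = \<epsilon> * K * s * norm w" by simp
      also have "\<dots> \<le> e / 2 * norm w" by (intro mult_right_mono sK) simp
      finally show ?thesis using \<epsilon> by (simp add: abs_mult)
    qed
    moreover have "e / 2 * norm w + e / 2 * norm w = e * norm w" by (simp add: field_simps)
    ultimately have "\<bar>\<epsilon> * \<phi> b - \<epsilon> * \<phi> a - 2 * \<epsilon> * \<phi>' a * (x \<bullet> w)\<bar> \<le> e * norm w"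
      by linarith
    then show ?thesis by (simp add: a_def b_def)
  qed
  with s(1) show ?thesis by blast
qed

lemma radial_gradient_bounded:
  "\<exists>K. \<forall>x::'a::real_inner. norm x \<le> r \<longrightarrow> norm ((2 * \<epsilon> * \<phi>' ((norm x)\<^sup>2)) *\<^sub>R x) \<le> K"
proof -
  obtain K where K: "\<And>a. 0 \<le> a \<Longrightarrow> a \<le> r\<^sup>2 \<Longrightarrow> \<bar>\<phi>' a\<bar> \<le> K" using radial_derivative_bounded by blast
  have K0: "0 \<le> K" using K[of 0] by simp
  have "norm ((2 * \<epsilon> * \<phi>' ((norm x)\<^sup>2)) *\<^sub>R x) \<le> 2 * \<epsilon> * (K * r)" if x: "norm x \<le> r" for x :: 'a
  proof -
    have "\<bar>\<phi>' ((norm x)\<^sup>2)\<bar> * norm x \<le> K * r"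
      using x K0 by (intro mult_mono K) (auto intro: power_mono)
    then have "2 * \<epsilon> * (\<bar>\<phi>' ((norm x)\<^sup>2)\<bar> * norm x) \<le> 2 * \<epsilon> * (K * r)"
      using \<epsilon> by (intro mult_left_mono) auto
    then show ?thesis using \<epsilon> by (simp add: abs_mult mult.assoc)
  qed
  then show ?thesis by blast
qed

lemma radial_gradient_modulus:
  assumes e: "e > 0"
  shows "\<exists>s>0. \<forall>x y::'a::real_inner. norm x \<le> r \<longrightarrow> norm y \<le> r \<longrightarrow> norm (x - y) \<le> s \<longrightarrow>
    norm ((2 * \<epsilon> * \<phi>' ((norm x)\<^sup>2)) *\<^sub>R x - (2 * \<epsilon> * \<phi>' ((norm y)\<^sup>2)) *\<^sub>R y) \<le> e"
proof -
  obtain K where K: "\<And>a. 0 \<le> a \<Longrightarrow> a \<le> r\<^sup>2 \<Longrightarrow> \<bar>\<phi>' a\<bar> \<le> K" using radial_derivative_bounded by blast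
  have K0: "0 \<le> K" using K[of 0] by simp
  define L where "L = \<bar>r\<bar> + 1"
  have L: "L > 0" by (simp add: L_def)
  define e1 where "e1 = e / (4 * \<epsilon> * L)"
  have e1: "e1 > 0" using e \<epsilon> L by (simp add: e1_def)
  have e1': "2 * \<epsilon> * (e1 * L) = e / 2" using \<epsilon> L by (simp add: e1_def)
  obtain s1 where s1: "s1 > 0" "\<And>a b. 0 \<le> a \<Longrightarrow> a \<le> r\<^sup>2 \<Longrightarrow> 0 \<le> b \<Longrightarrow> b \<le> r\<^sup>2 \<Longrightarrow> \<bar>b - a\<bar> \<le> s1 \<Longrightarrow> \<bar>\<phi>' b - \<phi>' a\<bar> \<le> e1"
    using radial_derivative_modulus[OF e1, of "r\<^sup>2"] by blast
  define s where "s = min (s1 / (2 * L)) (e / (4 * \<epsilon> * (K + 1)))"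
  have s: "s > 0" using s1 L e \<epsilon> K0 by (auto simp: s_def)
  have "s \<le> s1 / (2 * L)" by (simp add: s_def)
  then have sL: "s * (2 * L) \<le> s1" using L by (simp add: field_simps)
  have "s \<le> e / (4 * \<epsilon> * (K + 1))" by (simp add: s_def)
  then have "s * (4 * \<epsilon> * (K + 1)) \<le> e" using \<epsilon> K0 by (simp add: pos_le_divide_eq)
  moreover have "0 \<le> s * (4 * \<epsilon>)" using s \<epsilon> by simp
  ultimately have sK: "2 * \<epsilon> * (K * s) \<le> e / 2" by (simp add: algebra_simps)
  have "norm ((2 * \<epsilon> * \<phi>' ((norm x)\<^sup>2)) *\<^sub>R x - (2 * \<epsilon> * \<phi>' ((norm y)\<^sup>2)) *\<^sub>R y) \<le> e"
    if x: "norm x \<le> r" and y: "norm y \<le> r" and xy: "norm (x - y) \<le> s" for x y :: 'a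
  proof -
    define a b where "a = (norm x)\<^sup>2" and "b = (norm y)\<^sup>2"
    have a: "0 \<le> a" "a \<le> r\<^sup>2" and b: "0 \<le> b" "b \<le> r\<^sup>2"
      unfolding a_def b_def using x y by (auto intro!: power_mono)
    have "\<bar>norm x - norm y\<bar> \<le> s" using norm_triangle_ineq3[of x y] xy by linarith
    moreover have "\<bar>norm x + norm y\<bar> \<le> 2 * L" using x y unfolding L_def by (simp add: abs_le_iff)
    ultimately have "\<bar>norm x - norm y\<bar> * \<bar>norm x + norm y\<bar> \<le> s * (2 * L)"
      using s by (intro mult_mono) auto
    moreover have "a - b = (norm x - norm y) * (norm x + norm y)"
      by (simp add: a_def b_def power2_eq_square algebra_simps)
    ultimately have "\<bar>a - b\<bar> \<le> s1" using sL by (simp add: abs_mult)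
    then have ab: "\<bar>\<phi>' a - \<phi>' b\<bar> \<le> e1" using s1(2)[OF b a] by simp
    have "(2 * \<epsilon> * \<phi>' a) *\<^sub>R x - (2 * \<epsilon> * \<phi>' b) *\<^sub>R y = (2 * \<epsilon> * \<phi>' a) *\<^sub>R (x - y) + (2 * \<epsilon> * (\<phi>' a - \<phi>' b)) *\<^sub>R y"
      by (simp add: algebra_simps)
    then have "norm ((2 * \<epsilon> * \<phi>' a) *\<^sub>R x - (2 * \<epsilon> * \<phi>' b) *\<^sub>R y)
        \<le> norm ((2 * \<epsilon> * \<phi>' a) *\<^sub>R (x - y)) + norm ((2 * \<epsilon> * (\<phi>' a - \<phi>' b)) *\<^sub>R y)"
      using norm_triangle_ineq by metis
    also have "\<dots> = 2 * \<epsilon> * (\<bar>\<phi>' a\<bar> * norm (x - y)) + 2 * \<epsilon> * (\<bar>\<phi>' a - \<phi>' b\<bar> * norm y)"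
      using \<epsilon> by (simp add: abs_mult mult.assoc)
    also have "\<dots> \<le> 2 * \<epsilon> * (K * s) + 2 * \<epsilon> * (e1 * L)"
      using K[OF a] xy ab y K0 e1 \<epsilon> unfolding L_def by (intro add_mono mult_left_mono mult_mono) auto
    also have "\<dots> \<le> e" using sK e1' by linarith
    finally show ?thesis by (simp add: a_def b_def)
  qed
  with s show ?thesis by blast
qed

lemma radial_coercive: "\<exists>r. \<forall>x::'a::real_inner. \<epsilon> * \<phi> ((norm x)\<^sup>2) \<le> b \<longrightarrow> norm x \<le> r"
proof -
  obtain N where N: "\<And>t. t \<ge> N \<Longrightarrow> \<phi> t > b / \<epsilon>"
    using \<phi>_top unfolding filterlim_at_top_dense eventually_at_top_linorder by blast
  have "norm x \<le> 1 + \<bar>N\<bar>" if "\<epsilon> * \<phi> ((norm x)\<^sup>2) \<le> b" for x :: 'a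
  proof -
    have "\<phi> ((norm x)\<^sup>2) \<le> b / \<epsilon>" using that \<epsilon> by (simp add: field_simps)
    then have "(norm x)\<^sup>2 \<le> \<bar>N\<bar>" using N[of "(norm x)\<^sup>2"] by linarith
    then show ?thesis by (rule le_one_plus_of_square_le)
  qed
  then show ?thesis by blast
qed

end

section \<open>Comparison\<close>

text \<open>With \<open>lam = k\<^sup>2\<close> the factor \<open>k\<close> is used twice: once to remove the penalty by the growth condition, once to
  compare \<open>G x\<close> with \<open>G y\<close>. The parameters are chosen in the order \<open>\<mu>\<close>, then \<open>\<epsilon>\<close>. Since the values
  \<open>A \<mu>\<close> of the unpenalized problem decrease in \<open>\<mu>\<close> and are bounded below, some large \<open>\<mu>\<close> satisfies
  \<open>A (\<mu> / 2) - A \<mu> \<le> e\<close>, which gives \<open>\<mu> |x - y|\<^sup>2 \<le> 16 e\<close> at near maximum points. The gradient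
  \<open>\<mu> (x - y)\<close> is then bounded for this fixed \<open>\<mu>\<close>, although \<open>x\<close> may escape to infinity as \<open>\<epsilon>\<close> tends to \<open>0\<close>;
  the growth condition is uniform in \<open>x\<close> and applies.\<close>

lemma comparison_up_to_scaling:
  fixes C :: "('a::{real_inner, complete_space} \<times> 'a) set" and G :: "'a \<Rightarrow> 'a \<Rightarrow> real"
    and \<alpha> B k e' :: real and h u v :: "'a \<Rightarrow> real" and \<phi> \<phi>' \<omega> :: "real \<Rightarrow> real"
  assumes diss: "m_dissipative C" and dense: "closure (Domain C) = UNIV" and zero: "(0, 0) \<in> C"
    and G_cont: "continuous_on UNIV (\<lambda>(x, p). G x p)"
    and G_mod: "\<And>M e. M > 0 \<Longrightarrow> e > 0 \<Longrightarrow> \<exists>d>0. \<forall>x p q. norm x + norm p + norm q < M \<longrightarrow>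
          norm (q - p) \<le> d \<longrightarrow> \<bar>G x p - G x q\<bar> \<le> e"
    and G_diss: "continuous_on {0..} \<omega>" "\<omega> 0 = 0"
          "\<And>x y \<mu>. \<mu> > 0 \<Longrightarrow> k * G x ((\<mu> / k) *\<^sub>R (x - y)) - G y (\<mu> *\<^sub>R (x - y)) \<le> \<omega> (norm (x - y) + \<mu> * (norm (x - y))\<^sup>2)"
    and \<phi>: "mono_on {0..} \<phi>" "\<And>r. r \<ge> 0 \<Longrightarrow> 0 \<le> \<phi> r"
          "\<And>r. r \<ge> 0 \<Longrightarrow> (\<phi> has_real_derivative \<phi>' r) (at r within {0..})"
          "continuous_on {0..} \<phi>'" "filterlim \<phi> at_top at_top"
    and growth: "\<And>M. M > 0 \<Longrightarrow> \<exists>\<gamma>. continuous_on {0..} \<gamma> \<and> \<gamma> 0 = 0 \<and>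
          (\<forall>\<epsilon>\<ge>0. \<forall>x p. norm p \<le> M \<longrightarrow>
             k * G x ((1 / k) *\<^sub>R (p + (\<epsilon> * \<phi>' ((norm x)\<^sup>2)) *\<^sub>R x)) - G x p \<le> \<gamma> \<epsilon>)"
    and sub: "viscosity_subsolution \<alpha> (H0_hat C G) h u"
    and super: "viscosity_supersolution \<alpha> (H1_hat C G) h v"
    and u_bound: "\<And>x. \<bar>u x\<bar> \<le> B" and v_bound: "\<And>x. \<bar>v x\<bar> \<le> B" and h_bound: "\<And>x. \<bar>h x\<bar> \<le> B"
    and h_cont: "uniformly_continuous_on UNIV h"
    and \<alpha>: "\<alpha> > 0" and k: "k > 1" and e': "e' > 0"
  shows "u z - v z \<le> (k\<^sup>2 - 1) * (2 * B) + e'"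
proof -
  define lam where "lam = k\<^sup>2"
  have lam: "lam \<ge> 1" using k by (simp add: lam_def)
  obtain d\<omega> where d\<omega>: "d\<omega> > 0" "\<And>r. 0 \<le> r \<Longrightarrow> r \<le> d\<omega> \<Longrightarrow> \<bar>\<omega> r\<bar> \<le> e' / (4 * \<alpha>)"
    using modulus_tendsto_zero[OF G_diss(1,2), of "e' / (4 * \<alpha>)"] e' \<alpha> by auto
  obtain dh where dh: "dh > 0" "\<And>x y. dist x y < dh \<Longrightarrow> dist (h x) (h y) < e' / 4"
    using h_cont e' unfolding uniformly_continuous_on_def
    by (metis UNIV_I divide_pos_pos zero_less_numeral)
  \<comment> \<open>The argument of \<open>\<omega>\<close> and the distance \<open>|x - y|\<close> will be at most \<open>20 e\<close> and \<open>4 e\<close>; the errors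
    proportional to \<open>e\<close> add up to \<open>(4 + \<alpha>) e\<close>.\<close>
  define e where "e = min (e' / (4 * (4 + \<alpha>))) (min (d\<omega> / 20) (dh / 8))"
  have e: "e > 0" "e \<le> e' / (4 * (4 + \<alpha>))" "20 * e \<le> d\<omega>" "8 * e \<le> dh"
    using e' \<alpha> d\<omega> dh by (auto simp: e_def)
  have e4: "(4 + \<alpha>) * e \<le> e' / 4" using e(2) \<alpha> by (simp add: pos_le_divide_eq mult_ac)
  define F where "F = (\<lambda>\<mu> w. lam * u (fst w) - v (snd w) - \<mu> / 2 * (norm (fst w - snd w))\<^sup>2)"
  have F_le: "F \<mu> w \<le> lam * B + B" if "\<mu> \<ge> 0" for \<mu> w
  proof -
    have "lam * u (fst w) \<le> lam * B" using u_bound[of "fst w"] lam by (intro mult_left_mono) auto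
    moreover have "0 \<le> \<mu> / 2 * (norm (fst w - snd w))\<^sup>2" using that by simp
    ultimately show ?thesis using v_bound[of "snd w"] unfolding F_def by linarith
  qed
  define A where "A = (\<lambda>\<mu>. SUP w. F \<mu> w)"
  have F_le_A: "F \<mu> w \<le> A \<mu>" if "\<mu> \<ge> 0" for \<mu> w
    unfolding A_def by (rule cSUP_upper) (use F_le[OF that] in \<open>auto intro!: bdd_aboveI\<close>)
  have "\<exists>\<mu>. \<mu> \<ge> 1 / e \<and> A (\<mu> / 2) - A \<mu> \<le> e"
  proof -
    \<comment> \<open>Along powers of \<open>2\<close> the values \<open>A\<close> decrease and are bounded below, so their differences tend to \<open>0\<close>.\<close>
    define a where "a n = A (2 ^ n)" for n :: nat
    have "decseq a"
    proof (rule decseq_SucI)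
      fix n
      have "F (2 ^ Suc n) w \<le> a n" for w
      proof -
        have "(2 ^ n) / 2 * (norm (fst w - snd w))\<^sup>2 \<le> (2 ^ Suc n) / 2 * (norm (fst w - snd w))\<^sup>2"
          by (intro mult_right_mono) auto
        then have "F (2 ^ Suc n) w \<le> F (2 ^ n) w" unfolding F_def by linarith
        also have "\<dots> \<le> a n" unfolding a_def by (rule F_le_A) simp
        finally show ?thesis .
      qed
      then show "a (Suc n) \<le> a n" unfolding a_def A_def by (intro cSUP_least) auto
    qed
    moreover have "\<forall>n. F 0 (z, z) \<le> a n"
    proof
      fix n
      have "F 0 (z, z) = F (2 ^ n) (z, z)" by (simp add: F_def)
      also have "\<dots> \<le> a n" unfolding a_def by (rule F_le_A) simp
      finally show "F 0 (z, z) \<le> a n" .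
    qed
    ultimately obtain l where l: "a \<longlonglongrightarrow> l" using decseq_convergent by blast
    then have "(\<lambda>n. a n - a (Suc n)) \<longlonglongrightarrow> l - l"
      by (intro tendsto_diff LIMSEQ_Suc)
    then have "\<forall>\<^sub>F n in sequentially. a n - a (Suc n) < e"
      by (rule order_tendstoD) (use e in simp)
    then obtain N where N: "\<And>n. n \<ge> N \<Longrightarrow> a n - a (Suc n) < e"
      unfolding eventually_sequentially by blast
    obtain m where m: "1 / e < 2 ^ m" using real_arch_pow[of 2 "1 / e"] by auto
    define n where "n = max N m"
    have "(2::real) ^ m \<le> 2 ^ Suc n" by (intro power_increasing) (auto simp: n_def)
    then have "1 / e \<le> 2 ^ Suc n" using m by linarith
    moreover have "A (2 ^ Suc n / 2) - A (2 ^ Suc n) \<le> e"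
      using N[of n] unfolding a_def n_def by simp
    ultimately show ?thesis by blast
  qed
  then obtain \<mu> where \<mu>: "\<mu> \<ge> 1 / e" "A (\<mu> / 2) - A \<mu> \<le> e" by blast
  have "0 < 1 / e" using e by simp
  then have \<mu>0: "\<mu> > 0" using \<mu>(1) by linarith
  have \<mu>e: "1 \<le> \<mu> * e" using \<mu>(1) e by (simp add: pos_divide_le_eq)
  have "A \<mu> - e < (SUP w. F \<mu> w)" using e by (simp add: A_def)
  moreover have "bdd_above (range (F \<mu>))"
    using F_le[of \<mu>] \<mu>0 by (intro bdd_aboveI[of _ "lam * B + B"]) auto
  ultimately obtain ws where ws: "A \<mu> - e < F \<mu> ws"
    using less_cSUP_iff[of UNIV "F \<mu>"] by blast
  obtain xs ys where wxy: "ws = (xs, ys)" by (cases ws)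
  define M where "M = 4 * e * \<mu> + 1"
  have M: "M > 0" using e \<mu>0 by (simp add: M_def add_pos_pos)
  obtain \<gamma> where \<gamma>: "continuous_on {0..} \<gamma>" "\<gamma> 0 = 0"
    "\<And>\<epsilon> x p. \<epsilon> \<ge> 0 \<Longrightarrow> norm p \<le> M \<Longrightarrow>
       k * G x ((1 / k) *\<^sub>R (p + (\<epsilon> * \<phi>' ((norm x)\<^sup>2)) *\<^sub>R x)) - G x p \<le> \<gamma> \<epsilon>"
    using growth[OF M] by blast
  obtain d\<gamma> where d\<gamma>: "d\<gamma> > 0" "\<And>r. 0 \<le> r \<Longrightarrow> r \<le> d\<gamma> \<Longrightarrow> \<bar>\<gamma> r\<bar> \<le> e / k"
    using modulus_tendsto_zero[OF \<gamma>(1,2), of "e / k"] e k by auto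
  have \<phi>s: "0 \<le> \<phi> ((norm xs)\<^sup>2)" by (rule \<phi>(2)) simp
  \<comment> \<open>The penalty must be negligible at the near maximum point \<open>xs\<close> of the unpenalized problem.\<close>
  define \<epsilon> where "\<epsilon> = min (k * d\<gamma> / 2) (e / (\<phi> ((norm xs)\<^sup>2) + 1))"
  have \<epsilon>: "\<epsilon> > 0" using k d\<gamma> e \<phi>s by (simp add: \<epsilon>_def)
  have "\<epsilon> \<le> k * d\<gamma> / 2" unfolding \<epsilon>_def by (rule min.cobounded1)
  then have \<epsilon>\<gamma>: "2 * \<epsilon> / k \<le> d\<gamma>" using k by (simp add: field_simps)
  have "\<epsilon> \<le> e / (\<phi> ((norm xs)\<^sup>2) + 1)" unfolding \<epsilon>_def by (rule min.cobounded2)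
  then have "\<epsilon> * (\<phi> ((norm xs)\<^sup>2) + 1) \<le> e" using \<phi>s by (simp add: pos_le_divide_eq)
  then have \<epsilon>\<phi>: "\<epsilon> * \<phi> ((norm xs)\<^sup>2) \<le> e" using \<epsilon> by (simp add: algebra_simps)
  have res: "norm (resolvent C t x) \<le> norm x" if "t > 0" for t x
    using resolvent_nonexpansive[OF diss that, of x 0] resolvent_eqI[OF diss that zero, of 0] by simp
  define P where "P = (\<lambda>x::'a. \<epsilon> * \<phi> ((norm x)\<^sup>2))"
  define DP where "DP = (\<lambda>x::'a. (2 * \<epsilon> * \<phi>' ((norm x)\<^sup>2)) *\<^sub>R x)"
  obtain x y where near: "\<And>x' y'. lam * u x' - v y' - \<mu> / 2 * (norm (x' - y'))\<^sup>2 - P x'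
       \<le> lam * u x - v y - \<mu> / 2 * (norm (x - y))\<^sup>2 + e"
    and ineq: "lam * (u x - h x) - (v y - h y)
       \<le> \<alpha> * (lam * G x ((1 / lam) *\<^sub>R (\<mu> *\<^sub>R (x - y) + DP x)) - G y (\<mu> *\<^sub>R (x - y))) + e"
  proof (rule penalized_doubling[OF diss dense G_cont G_mod sub super u_bound v_bound \<alpha> lam \<mu>0, of P DP e])
    show "0 \<le> P x" for x using \<epsilon> \<phi>(2)[of "(norm x)\<^sup>2"] by (simp add: P_def)
    show "P (resolvent C t x) \<le> P x" if "t > 0" for t x
    proof -
      have "\<phi> ((norm (resolvent C t x))\<^sup>2) \<le> \<phi> ((norm x)\<^sup>2)"
        by (rule mono_onD[OF \<phi>(1)]) (use res[OF that, of x] in \<open>auto intro: power_mono\<close>)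
      then show ?thesis using \<epsilon> by (simp add: P_def)
    qed
    show "\<exists>r. \<forall>x. P x \<le> b \<longrightarrow> norm x \<le> r" for b
      unfolding P_def by (rule radial_coercive[OF \<phi> \<epsilon>])
    show "\<exists>s>0. \<forall>x w. norm x \<le> r \<longrightarrow> norm w \<le> s \<longrightarrow> \<bar>P (x + w) - P x - DP x \<bullet> w\<bar> \<le> e * norm w" if "e > 0" for r e
      unfolding P_def DP_def by (rule radial_linearization[OF \<phi> \<epsilon> that])
    show "\<exists>K. \<forall>x. norm x \<le> r \<longrightarrow> norm (DP x) \<le> K" for r
      unfolding DP_def by (rule radial_gradient_bounded[OF \<phi> \<epsilon>])
    show "\<exists>s>0. \<forall>x y. norm x \<le> r \<longrightarrow> norm y \<le> r \<longrightarrow> norm (x - y) \<le> s \<longrightarrow> norm (DP x - DP y) \<le> e" if "e > 0" for r e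
      unfolding DP_def by (rule radial_gradient_modulus[OF \<phi> \<epsilon> that])
  qed (use e in auto)
  have "F \<mu> (xs, ys) - e \<le> F \<mu> (x, y) + e"
    using near[of xs ys] \<epsilon>\<phi> by (simp add: F_def P_def)
  then have low: "A \<mu> - 3 * e \<le> F \<mu> (x, y)" using ws wxy by simp
  have "F \<mu> (x, y) = F (\<mu> / 2) (x, y) - \<mu> / 4 * (norm (x - y))\<^sup>2" by (simp add: F_def field_simps)
  moreover have "F (\<mu> / 2) (x, y) \<le> A (\<mu> / 2)" by (rule F_le_A) (use \<mu>0 in simp)
  ultimately have d16: "\<mu> * (norm (x - y))\<^sup>2 \<le> 16 * e" using low \<mu>(2) by simp
  have "(norm (x - y))\<^sup>2 \<le> (4 * e)\<^sup>2"
  proof -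
    have "(norm (x - y))\<^sup>2 * 1 \<le> (norm (x - y))\<^sup>2 * (\<mu> * e)" by (intro mult_left_mono \<mu>e) simp
    also have "\<dots> = \<mu> * (norm (x - y))\<^sup>2 * e" by simp
    also have "\<dots> \<le> 16 * e * e" using d16 e by (intro mult_right_mono) auto
    finally show ?thesis by (simp add: power2_eq_square)
  qed
  then have d4: "norm (x - y) \<le> 4 * e" by (rule power2_le_imp_le) (use e in simp)
  define p where "p = (\<mu> / k) *\<^sub>R (x - y)"
  have "norm p \<le> M"
  proof -
    have "\<mu> / k \<le> \<mu>" using \<mu>0 k by (simp add: divide_le_eq mult_le_cancel_left1)
    then have "\<mu> / k * norm (x - y) \<le> \<mu> * (4 * e)"
      using d4 \<mu>0 k by (intro mult_mono) auto
    then show ?thesis using \<mu>0 k by (simp add: p_def M_def mult_ac)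
  qed
  from \<gamma>(3)[OF _ this, of "2 * \<epsilon> / k" x]
  have "k * G x ((1 / k) *\<^sub>R (p + (2 * \<epsilon> / k * \<phi>' ((norm x)\<^sup>2)) *\<^sub>R x)) \<le> G x p + \<gamma> (2 * \<epsilon> / k)"
    using \<epsilon> k by simp
  also have "\<gamma> (2 * \<epsilon> / k) \<le> e / k"
    using d\<gamma>(2)[OF _ \<epsilon>\<gamma>] \<epsilon> k by (simp add: abs_le_iff)
  finally have "k * (k * G x ((1 / k) *\<^sub>R (p + (2 * \<epsilon> / k * \<phi>' ((norm x)\<^sup>2)) *\<^sub>R x))) \<le> k * (G x p + e / k)"
    using k by (intro mult_left_mono) auto
  moreover have "(1 / k) *\<^sub>R (p + (2 * \<epsilon> / k * \<phi>' ((norm x)\<^sup>2)) *\<^sub>R x) = (1 / lam) *\<^sub>R (\<mu> *\<^sub>R (x - y) + DP x)"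
    by (simp add: p_def lam_def DP_def scaleR_add_right power2_eq_square)
  moreover have "k * (G x p + e / k) = k * G x p + e" using k by (simp add: field_simps)
  ultimately have "lam * G x ((1 / lam) *\<^sub>R (\<mu> *\<^sub>R (x - y) + DP x)) \<le> k * G x p + e"
    by (simp add: lam_def power2_eq_square)
  moreover have "k * G x p - G y (\<mu> *\<^sub>R (x - y)) \<le> e' / (4 * \<alpha>)"
  proof -
    have "norm (x - y) + \<mu> * (norm (x - y))\<^sup>2 \<le> d\<omega>" using d4 d16 e(3) by linarith
    then have "\<bar>\<omega> (norm (x - y) + \<mu> * (norm (x - y))\<^sup>2)\<bar> \<le> e' / (4 * \<alpha>)"
      using \<mu>0 by (intro d\<omega>(2)) auto
    then show ?thesis using G_diss(3)[OF \<mu>0, of x y] unfolding p_def by linarith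
  qed
  ultimately have "lam * G x ((1 / lam) *\<^sub>R (\<mu> *\<^sub>R (x - y) + DP x)) - G y (\<mu> *\<^sub>R (x - y)) \<le> e + e' / (4 * \<alpha>)"
    by linarith
  then have "\<alpha> * (lam * G x ((1 / lam) *\<^sub>R (\<mu> *\<^sub>R (x - y) + DP x)) - G y (\<mu> *\<^sub>R (x - y))) \<le> \<alpha> * (e + e' / (4 * \<alpha>))"
    using \<alpha> by (intro mult_left_mono) auto
  also have "\<dots> = \<alpha> * e + e' / 4" using \<alpha> by (simp add: field_simps)
  finally have up: "lam * (u x - h x) - (v y - h y) \<le> \<alpha> * e + e' / 4 + e" using ineq by linarith
  have "F \<mu> (z, z) \<le> A \<mu>" by (rule F_le_A) (use \<mu>0 in simp)
  then have "lam * u z - v z - 3 * e \<le> F \<mu> (x, y)" using low by (simp add: F_def)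
  moreover have "0 \<le> \<mu> / 2 * (norm (x - y))\<^sup>2" using \<mu>0 by simp
  ultimately have lo: "lam * u z - v z - 3 * e \<le> lam * u x - v y" unfolding F_def by simp
  have hxy: "h x - h y \<le> e' / 4"
  proof -
    have "dist x y < dh" using d4 e by (simp add: dist_norm)
    from dh(2)[OF this] show ?thesis unfolding dist_real_def by linarith
  qed
  have "(lam - 1) * h x \<le> (lam - 1) * B"
    using lam h_bound[of x] by (intro mult_left_mono) auto
  moreover have "(lam - 1) * (- B) \<le> (lam - 1) * u z"
    using lam u_bound[of z] by (intro mult_left_mono) auto
  ultimately have "u z - v z \<le> (lam - 1) * (2 * B) + ((4 + \<alpha>) * e + e' / 4) + e' / 4"
    using up lo hxy by (simp add: algebra_simps)
  also have "\<dots> \<le> (lam - 1) * (2 * B) + e'" using e4 e' by linarith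
  finally show ?thesis by (simp add: lam_def)
qed

theorem theorem5p2:
  fixes C :: "('a::{real_inner, complete_space, second_countable_topology} \<times> 'a) set"
    and G :: "'a \<Rightarrow> 'a \<Rightarrow> real"
    and \<alpha> :: real
    and h f_sub f_super :: "'a \<Rightarrow> real"
  assumes C_dissipative: "m_dissipative C"
    and C_dense: "closure (Domain C) = UNIV"
    and C_zero: "(0, 0) \<in> C"
    and G_continuous: "continuous_on UNIV (\<lambda>(x, p). G x p)"
    and G_dissipative:
      "\<forall>\<kappa>>1.
         \<exists>\<rho> :: real \<Rightarrow> real. continuous_on {0..} \<rho> \<and> \<rho> 0 = 0 \<and>
           (\<forall>x y \<mu>. \<mu> > 0 \<longrightarrow>
              \<kappa> * G x ((\<mu> / \<kappa>) *\<^sub>R (x - y)) - G y (\<mu> *\<^sub>R (x - y))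
                \<le> \<rho> (norm (x - y) + \<mu> * (norm (x - y))\<^sup>2))"
    and G_modulus:
      "\<forall>M>0.
         \<exists>\<sigma> :: real \<Rightarrow> real. continuous_on {0..} \<sigma> \<and> \<sigma> 0 = 0 \<and>
           (\<forall>r\<ge>0. \<forall>x p q. norm x + norm p + norm q < M \<longrightarrow> norm (q - p) \<le> r \<longrightarrow>
              \<bar>G x p - G x q\<bar> \<le> \<sigma> r)"
    and G_growth:
      "\<exists>\<phi> \<phi>' :: real \<Rightarrow> real.
         mono_on {0..} \<phi> \<and> (\<forall>r\<ge>0. 0 \<le> \<phi> r) \<and>
         (\<forall>r\<ge>0. (\<phi> has_real_derivative \<phi>' r) (at r within {0..})) \<and>
         continuous_on {0..} \<phi>' \<and> (\<forall>r\<ge>0. \<phi>' r > 0) \<and>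
         filterlim \<phi> at_top at_top \<and>
         bdd_above ((\<lambda>r. \<bar>r * \<phi>' (r\<^sup>2)\<bar> + \<bar>r * \<phi>' r\<bar>) ` {0..}) \<and>
         (\<forall>M>0. \<forall>\<kappa>>1. \<exists>\<gamma> :: real \<Rightarrow> real. continuous_on {0..} \<gamma> \<and> \<gamma> 0 = 0 \<and>
            (\<forall>\<epsilon>\<ge>0. \<forall>x p. norm p \<le> M \<longrightarrow>
               \<kappa> * G x ((1 / \<kappa>) *\<^sub>R (p + (\<epsilon> * \<phi>' ((norm x)\<^sup>2)) *\<^sub>R x)) - G x p \<le> \<gamma> \<epsilon>))"
    and \<alpha>_pos: "\<alpha> > 0"
    and h_bounded: "bounded (range h)"
    and h_uniformly_continuous: "uniformly_continuous_on UNIV h"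
    and sub: "viscosity_subsolution \<alpha> (H0_hat C G) h f_sub"
    and super: "viscosity_supersolution \<alpha> (H1_hat C G) h f_super"
  shows "\<forall>x. f_sub x \<le> f_super x"
proof
  fix z
  obtain Bu Bv Bh where B: "\<And>x. \<bar>f_sub x\<bar> \<le> Bu" "\<And>x. \<bar>f_super x\<bar> \<le> Bv" "\<And>x. \<bar>h x\<bar> \<le> Bh"
    using sub super h_bounded
    unfolding viscosity_subsolution_def viscosity_supersolution_def bounded_iff by auto
  define B where "B = max Bu (max Bv Bh)"
  have bounds: "\<bar>f_sub x\<bar> \<le> B" "\<bar>f_super x\<bar> \<le> B" "\<bar>h x\<bar> \<le> B" for x
    using B[of x] by (auto simp: B_def)
  have B0: "0 \<le> B" using bounds(1)[of 0] by linarith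
  have G_mod: "\<exists>d>0. \<forall>x p q. norm x + norm p + norm q < M \<longrightarrow> norm (q - p) \<le> d \<longrightarrow> \<bar>G x p - G x q\<bar> \<le> e"
    if Me: "M > 0" "e > 0" for M e
  proof -
    from G_modulus[rule_format, OF Me(1)] obtain \<sigma> :: "real \<Rightarrow> real"
      where \<sigma>: "continuous_on {0..} \<sigma>" "\<sigma> 0 = 0"
      and \<sigma>_le: "\<forall>r\<ge>0. \<forall>x p q. norm x + norm p + norm q < M \<longrightarrow> norm (q - p) \<le> r \<longrightarrow> \<bar>G x p - G x q\<bar> \<le> \<sigma> r"
      by (elim exE conjE)
    obtain d where d: "d > 0" "\<And>r. 0 \<le> r \<Longrightarrow> r \<le> d \<Longrightarrow> \<bar>\<sigma> r\<bar> \<le> e"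
      using modulus_tendsto_zero[OF \<sigma>(1,2) Me(2)] by blast
    have \<sigma>d: "\<sigma> d \<le> e" using d(2)[of d] d(1) by simp
    show ?thesis
    proof (intro exI[of _ d] conjI allI impI d(1))
      fix x p q :: "'a" assume "norm x + norm p + norm q < M" "norm (q - p) \<le> d"
      then have "\<bar>G x p - G x q\<bar> \<le> \<sigma> d" using \<sigma>_le[rule_format, of d x p q] d(1) by simp
      with \<sigma>d show "\<bar>G x p - G x q\<bar> \<le> e" by linarith
    qed
  qed
  from G_growth obtain \<phi> \<phi>' :: "real \<Rightarrow> real" where \<phi>_mono: "mono_on {0..} \<phi>" and \<phi>_nonneg: "\<forall>r\<ge>0. 0 \<le> \<phi> r"
    and \<phi>_deriv: "\<forall>r\<ge>0. (\<phi> has_real_derivative \<phi>' r) (at r within {0..})"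
    and \<phi>'_cont: "continuous_on {0..} \<phi>'" and \<phi>_top: "filterlim \<phi> at_top at_top"
    and growth: "\<forall>M>0. \<forall>\<kappa>>1. \<exists>\<gamma> :: real \<Rightarrow> real. continuous_on {0..} \<gamma> \<and> \<gamma> 0 = 0 \<and>
            (\<forall>\<epsilon>\<ge>0. \<forall>x p. norm p \<le> M \<longrightarrow>
               \<kappa> * G x ((1 / \<kappa>) *\<^sub>R (p + (\<epsilon> * \<phi>' ((norm x)\<^sup>2)) *\<^sub>R x)) - G x p \<le> \<gamma> \<epsilon>)"
    by (elim exE conjE)
  show "f_sub z \<le> f_super z"
  proof (rule field_le_epsilon)
    fix e :: real assume e: "e > 0"
    \<comment> \<open>Chosen so that \<open>(k\<^sup>2 - 1) * (2 * B) \<le> e / 2\<close>.\<close>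
    define k where "k = sqrt (1 + e / (4 * (B + 1)))"
    have frac: "e / (4 * (B + 1)) > 0" using e B0 by simp
    have k: "k > 1" using frac unfolding k_def by simp
    have k2: "k\<^sup>2 - 1 = e / (4 * (B + 1))" using frac unfolding k_def by simp
    from G_dissipative[rule_format, OF k] obtain \<omega> :: "real \<Rightarrow> real"
      where \<omega>: "continuous_on {0..} \<omega>" "\<omega> 0 = 0"
      and \<omega>_le: "\<forall>x y \<mu>. \<mu> > 0 \<longrightarrow> k * G x ((\<mu> / k) *\<^sub>R (x - y)) - G y (\<mu> *\<^sub>R (x - y)) \<le> \<omega> (norm (x - y) + \<mu> * (norm (x - y))\<^sup>2)"
      by (elim exE conjE)
    have "f_sub z - f_super z \<le> (k\<^sup>2 - 1) * (2 * B) + e / 2"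
      by (rule comparison_up_to_scaling[OF C_dissipative C_dense C_zero G_continuous G_mod \<omega> \<omega>_le[rule_format]
            \<phi>_mono \<phi>_nonneg[rule_format] \<phi>_deriv[rule_format] \<phi>'_cont \<phi>_top growth[rule_format, OF _ k]
            sub super bounds h_uniformly_continuous \<alpha>_pos k]) (use e in auto)
    also have "(k\<^sup>2 - 1) * (2 * B) \<le> e / 2"
      unfolding k2 using e B0 by (simp add: field_simps)
    finally show "f_sub z \<le> f_super z + e" by simp
  qed
qed

end
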